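(* Let $a<0$, $c<0$, $a_2>0$, $c_2>0$, $b>0$, $b_2>0$ be real constants and let $\omega$ satisfy $$0<|\omega|<\min\left\{1,\frac{-a}{b},\frac{-c}{b},\frac{a_2}{b_2},\frac{c_2}{b_2}\right\}.$$ Let $F:\mathbb{R}^4\to\mathbb{R}$ be a $C^2$ function with $F(0)=0$ satisfying conditions (a), (b), (c) described in the context. Let $((\psi_n,v_n))_n$ be a minimizing sequence for $S(\omega)$, i.e. $(\psi_n,v_n)\in\mathcal M_\omega\setminus\{0\}$ for all $n$ and $J_\omega(\psi_n,v_n)\to S(\omega)$. Then there exist a subsequence $((\psi_{n_k},v_{n_k}))_k$, a sequence of points $y_k\in\mathbb{R}$ and $(\psi_0,v_0)\in\mathcal M_\omega\setminus\{0\}$ such that $$(\psi_{n_k}(\cdot+y_k),v_{n_k}(\cdot+y_k))\to(\psi_0,v_0)\quad\text{in } X=H^2(\mathbb{R})\times H^2(\mathbb{R})\text{ as }k\to\infty,$$ and $J_\omega(\psi_0,v_0)=S(\omega)$. In particular $(\psi_0,v_0)$ is a minimizer of $J_\omega$ on $\mathcal M_\omega\setminus\{0\}$ and a weak solution of the traveling-wave system (a critical point of $J_\omega$ on $X$).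
   Context: Setting: traveling waves $\eta(x,t)=\psi(x-\omega t)$, $u(x,t)=v(x-\omega t)$ of a higher-order Boussinesq system with coefficients $b=d>0$, $b_2=d_2>0$, $a,c<0$, $a_2,c_2>0$; weak solutions of the traveling-wave equations are by definition the critical points of the functional $J_\omega$ below on $X=H^2(\mathbb{R})\times H^2(\mathbb{R})$. For $(\psi,v)\in X$ define $I_1(\psi,v)=\int_{\mathbb R}[\psi^2-c(\psi')^2+c_2(\psi'')^2+v^2-a(v')^2+a_2(v'')^2]\,dx$, $I_2(\psi,v)=\int_{\mathbb R}(\psi v+b\psi'v'+b_2\psi''v'')\,dx$, $I_\omega=I_1-2\omega I_2$. $F:\mathbb{R}^4\to\mathbb{R}$ is $C^2$ with $F(0)=0$, and $G(w)=w\cdot\nabla F(w)$ for $w\in\mathbb{R}^4$. Conditions: (a) there is $p>0$ with $w\cdot\nabla G(w)\ge (p+2)G(w)$ for all $w\in\mathbb{R}^4$; (b) there exist $0<q_1\le q_2<\infty$ and $C>0$ with $|D^2F(w)|\le C(|w|^{q_1}+|w|^{q_2})$ for all $w\in\mathbb{R}^4$; (c) there exist $u,v\in H^2(\mathbb{R})$ with $\int_{\mathbb R}F(u,u',v,v')\,dx>0$. $K(\psi,v)=\int_{\mathbb R}F(\psi,\psi',v,v')\,dx$, $N(\psi,v)=\int_{\mathbb R}G(\psi,\psi',v,v')\,dx$, $J_\omega=\tfrac12 I_\omega-K$, $P_\omega=I_\omega-N$ (so $P_\omega(\Psi)=\langle J_\omega'(\Psi),\Psi\rangle$), $\mathcal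 M_\omega=\{(\psi,v)\in X: P_\omega(\psi,v)=0\}$, and $S(\omega)=\inf\{J_\omega(\psi,v):(\psi,v)\in\mathcal M_\omega\setminus\{0\}\}$. *)

theory Defs
  imports "HOL-Analysis.Analysis"
begin

text \<open>Functions on the real line are represented by (Borel measurable) representatives;
  all quantities below are invariant under changes on null sets.\<close>

definition L2 :: "(real \<Rightarrow> real) \<Rightarrow> bool" where
  "L2 f \<longleftrightarrow> f \<in> borel_measurable lborel \<and> integrable lborel (\<lambda>x. (f x)\<^sup>2)"

definition test_fun :: "(real \<Rightarrow> real) \<Rightarrow> bool" where
  "test_fun \<phi> \<longleftrightarrow>
     (\<exists>D :: nat \<Rightarrow> real \<Rightarrow> real. D 0 = \<phi> \<and>
        (\<forall>k x. (D k has_real_derivative D (Suc k) x) (at x))) \<and>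
     (\<exists>R. \<forall>x. \<bar>x\<bar> > R \<longrightarrow> \<phi> x = 0)"

definition weak_deriv :: "(real \<Rightarrow> real) \<Rightarrow> (real \<Rightarrow> real) \<Rightarrow> bool" where
  "weak_deriv f g \<longleftrightarrow>
     f \<in> borel_measurable lborel \<and> g \<in> borel_measurable lborel \<and>
     (\<forall>r s. set_integrable lborel {r..s} f \<and> set_integrable lborel {r..s} g) \<and>
     (\<forall>\<phi>. test_fun \<phi> \<longrightarrow>
        (LINT x|lborel. f x * deriv \<phi> x) = - (LINT x|lborel. g x * \<phi> x))"

definition H2 :: "(real \<Rightarrow> real) \<Rightarrow> bool" where
  "H2 f \<longleftrightarrow> (\<exists>g h. L2 f \<and> L2 g \<and> L2 h \<and> weak_deriv f g \<and> weak_deriv g h)"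

text \<open>A chosen representative of the weak derivative (unique a.e.).\<close>
definition wd :: "(real \<Rightarrow> real) \<Rightarrow> real \<Rightarrow> real" where
  "wd f = (SOME g. L2 g \<and> weak_deriv f g)"

definition wd2 :: "(real \<Rightarrow> real) \<Rightarrow> real \<Rightarrow> real" where
  "wd2 f = wd (wd f)"

definition H2_norm :: "(real \<Rightarrow> real) \<Rightarrow> real" where
  "H2_norm f = sqrt (LINT x|lborel. (f x)\<^sup>2 + (wd f x)\<^sup>2 + (wd2 f x)\<^sup>2)"

definition nonzeroX :: "(real \<Rightarrow> real) \<Rightarrow> (real \<Rightarrow> real) \<Rightarrow> bool" where
  "nonzeroX \<psi> v \<longleftrightarrow> \<not> (AE x in lborel. \<psi> x = 0 \<and> v x = 0)"

definition I1 :: "real \<Rightarrow> real \<Rightarrow> real \<Rightarrow> real \<Rightarrow> (real \<Rightarrow> real) \<Rightarrow> (real \<Rightarrow> real) \<Rightarrow> real" where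
  "I1 a c a2 c2 \<psi> v = (LINT x|lborel.
      (\<psi> x)\<^sup>2 - c * (wd \<psi> x)\<^sup>2 + c2 * (wd2 \<psi> x)\<^sup>2
    + (v x)\<^sup>2 - a * (wd v x)\<^sup>2 + a2 * (wd2 v x)\<^sup>2)"

definition I2 :: "real \<Rightarrow> real \<Rightarrow> (real \<Rightarrow> real) \<Rightarrow> (real \<Rightarrow> real) \<Rightarrow> real" where
  "I2 b b2 \<psi> v = (LINT x|lborel. \<psi> x * v x + b * wd \<psi> x * wd v x + b2 * wd2 \<psi> x * wd2 v x)"

definition Iw :: "real \<Rightarrow> real \<Rightarrow> real \<Rightarrow> real \<Rightarrow> real \<Rightarrow> real \<Rightarrow> real
                   \<Rightarrow> (real \<Rightarrow> real) \<Rightarrow> (real \<Rightarrow> real) \<Rightarrow> real" where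
  "Iw a c a2 c2 b b2 \<omega> \<psi> v = I1 a c a2 c2 \<psi> v - 2 * \<omega> * I2 b b2 \<psi> v"

definition jet :: "(real \<Rightarrow> real) \<Rightarrow> (real \<Rightarrow> real) \<Rightarrow> real \<Rightarrow> real^4" where
  "jet \<psi> v x = vector [\<psi> x, wd \<psi> x, v x, wd v x]"

definition Kf :: "(real^4 \<Rightarrow> real) \<Rightarrow> (real \<Rightarrow> real) \<Rightarrow> (real \<Rightarrow> real) \<Rightarrow> real" where
  "Kf F \<psi> v = (LINT x|lborel. F (jet \<psi> v x))"

definition Gf :: "(real^4 \<Rightarrow> real^4) \<Rightarrow> real^4 \<Rightarrow> real" where
  "Gf gradF w = w \<bullet> gradF w"

definition Nf :: "(real^4 \<Rightarrow> real^4) \<Rightarrow> (real \<Rightarrow> real) \<Rightarrow> (real \<Rightarrow> real) \<Rightarrow> real" where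
  "Nf gradF \<psi> v = (LINT x|lborel. Gf gradF (jet \<psi> v x))"

definition Jw :: "real \<Rightarrow> real \<Rightarrow> real \<Rightarrow> real \<Rightarrow> real \<Rightarrow> real \<Rightarrow> real \<Rightarrow> (real^4 \<Rightarrow> real)
                   \<Rightarrow> (real \<Rightarrow> real) \<Rightarrow> (real \<Rightarrow> real) \<Rightarrow> real" where
  "Jw a c a2 c2 b b2 \<omega> F \<psi> v = Iw a c a2 c2 b b2 \<omega> \<psi> v / 2 - Kf F \<psi> v"

definition Pw :: "real \<Rightarrow> real \<Rightarrow> real \<Rightarrow> real \<Rightarrow> real \<Rightarrow> real \<Rightarrow> real \<Rightarrow> (real^4 \<Rightarrow> real^4)
                   \<Rightarrow> (real \<Rightarrow> real) \<Rightarrow> (real \<Rightarrow> real) \<Rightarrow> real" where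
  "Pw a c a2 c2 b b2 \<omega> gradF \<psi> v = Iw a c a2 c2 b b2 \<omega> \<psi> v - Nf gradF \<psi> v"

definition Mw0 :: "real \<Rightarrow> real \<Rightarrow> real \<Rightarrow> real \<Rightarrow> real \<Rightarrow> real \<Rightarrow> real \<Rightarrow> (real^4 \<Rightarrow> real^4)
                   \<Rightarrow> ((real \<Rightarrow> real) \<times> (real \<Rightarrow> real)) set" where
  "Mw0 a c a2 c2 b b2 \<omega> gradF = {(\<psi>, v). H2 \<psi> \<and> H2 v \<and> nonzeroX \<psi> v \<and>
                                   Pw a c a2 c2 b b2 \<omega> gradF \<psi> v = 0}"

definition Sw :: "real \<Rightarrow> real \<Rightarrow> real \<Rightarrow> real \<Rightarrow> real \<Rightarrow> real \<Rightarrow> real \<Rightarrow> (real^4 \<Rightarrow> real)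
                   \<Rightarrow> (real^4 \<Rightarrow> real^4) \<Rightarrow> real" where
  "Sw a c a2 c2 b b2 \<omega> F gradF =
     Inf ((\<lambda>(\<psi>, v). Jw a c a2 c2 b b2 \<omega> F \<psi> v) ` Mw0 a c a2 c2 b b2 \<omega> gradF)"

end

theory Submission
  imports Defs "HOL-Probability.Sinc_Integral" "HOL-Complex_Analysis.Great_Picard"
begin

text \<open>Let \<open>R = G/(p+2) - F\<close>. Condition (a) makes \<open>R\<close> nonnegative and nondecreasing along rays, so
  \<open>Q = J\<^sub>\<omega> - P\<^sub>\<omega>/(p+2) = p/(2(p+2)) I\<^sub>\<omega> + \<integral>R\<close> is nonnegative, agrees with \<open>J\<^sub>\<omega>\<close> on the Nehari set and,
  by rescaling, satisfies \<open>Q \<ge> S(\<omega>)\<close> on the nonzero states with \<open>P\<^sub>\<omega> \<le> 0\<close>. Hence a minimizing sequence is bounded;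
  since \<open>N = I\<^sub>\<omega> > 0\<close> along it and \<open>G\<close> is superquadratic at \<open>0\<close>, its 1-jets do not tend uniformly to \<open>0\<close>,
  so that after translations a subsequence has a nonzero weak limit \<open>\<Psi>\<close>. With \<open>D\<^sub>n = \<Psi>\<^sub>n - \<Psi>\<close> the bound
  \<open>|f(u + v) - f(u) - f(v)| \<le> L |u| |v|\<close> for \<open>f = F, G\<close> on bounded sets gives
  \<open>P\<^sub>\<omega>(\<Psi>) + P\<^sub>\<omega>(D\<^sub>n) \<rightarrow> 0\<close> and \<open>Q(\<Psi>) + Q(D\<^sub>n) \<rightarrow> S(\<omega>)\<close>. If \<open>P\<^sub>\<omega>(\<Psi>) > 0\<close>, then \<open>P\<^sub>\<omega>(D\<^sub>n) < 0\<close> eventually, so \<open>Q(D\<^sub>n) \<ge> S(\<omega>)\<close>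
  and \<open>Q(\<Psi>) \<le> 0\<close>, contradicting \<open>\<Psi> \<noteq> 0\<close>. Therefore \<open>P\<^sub>\<omega>(\<Psi>) \<le> 0\<close>, hence \<open>Q(\<Psi>) \<ge> S(\<omega>)\<close> and
  \<open>Q(D\<^sub>n) \<rightarrow> 0\<close>, which is strong convergence.\<close>

section \<open>Square-integrable functions and weak compactness\<close>

text \<open>The obstacle is translation invariance: mass can drift to infinity or split, and neither
  \<open>J\<close> nor the constraint survives weak limits. \<open>Q\<close> replaces
  \<open>J\<close> because the remainders \<open>D n\<close> leave the Nehari set, and off that set
  \<open>J\<close> has no sign. Superquadraticity at 0 rests on two facts: (b) gives
  \<open>HessF 0 = 0\<close>, and (a) with continuity of the Hessian forces
  \<open>gradF 0 = 0\<close>. Weak derivatives are known only by testing against smooth compactly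
  supported functions. All pointwise control of jets comes from one estimate: a function differs
  from its mean over an interval of length d to the right of x by at most sqrt d times the L2 norm
  of its derivative. Means are L2 pairings with indicators, so they pass to weak limits; they give
  the a.e. convergence of the jets and also certify that the weak limit is nonzero. Criticality is
  obtained without a Lagrange multiplier: \<open>Q\<close> is minimal at the limit among nonzero
  states with \<open>P \<le> 0\<close>, and \<open>dP Z Z < 0\<close> allows any direction to be
  bent into that side.\<close>

definition square_int :: "(real \<Rightarrow> 'a::euclidean_space) \<Rightarrow> bool" where
  "square_int f \<longleftrightarrow> f \<in> borel_measurable lborel \<and> integrable lborel (\<lambda>x. f x \<bullet> f x)"

definition ip :: "(real \<Rightarrow> 'a::euclidean_space) \<Rightarrow> (real \<Rightarrow> 'a) \<Rightarrow> real" where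
  "ip f g = (LBINT x. f x \<bullet> g x)"

abbreviation nsq :: "(real \<Rightarrow> 'a::euclidean_space) \<Rightarrow> real" where
  "nsq f \<equiv> ip f f"

lemma L2_iff_square_int: "L2 f \<longleftrightarrow> square_int f"
  by (simp add: L2_def square_int_def power2_eq_square)

lemma square_int_measurable [measurable_dest]: "square_int f \<Longrightarrow> f \<in> borel_measurable lborel"
  by (simp add: square_int_def)

lemma integrable_norm_mult_square_int:
  fixes f :: "real \<Rightarrow> 'a::euclidean_space" and g :: "real \<Rightarrow> 'b::euclidean_space"
  assumes f: "square_int f" and g: "square_int g"
  shows "integrable lborel (\<lambda>x. norm (f x) * norm (g x))"
proof (rule Bochner_Integration.integrable_bound)
  show "integrable lborel (\<lambda>x. f x \<bullet> f x + g x \<bullet> g x)"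
    using f g by (auto simp: square_int_def)
  show "(\<lambda>x. norm (f x) * norm (g x)) \<in> borel_measurable lborel"
    using f g by measurable
  have "norm (f x) * norm (g x) \<le> f x \<bullet> f x + g x \<bullet> g x" for x
    using sum_squares_bound[of "norm (f x)" "norm (g x)"]
      mult_nonneg_nonneg[OF norm_ge_zero[of "f x"] norm_ge_zero[of "g x"]]
    unfolding power2_norm_eq_inner[symmetric] by linarith
  then show "AE x in lborel. norm (norm (f x) * norm (g x)) \<le> norm (f x \<bullet> f x + g x \<bullet> g x)"
    by (intro AE_I2) (simp add: order_trans[OF _ abs_ge_self])
qed

lemma integrable_inner_square_int:
  assumes f: "square_int f" and g: "square_int g"
  shows "integrable lborel (\<lambda>x. f x \<bullet> g x)"
proof (rule Bochner_Integration.integrable_bound[OF integrable_norm_mult_square_int[OF f g]])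
  show "(\<lambda>x. f x \<bullet> g x) \<in> borel_measurable lborel"
    using f g by measurable
qed (auto simp: Cauchy_Schwarz_ineq2)

lemma square_int_add:
  assumes f: "square_int f" and g: "square_int g"
  shows "square_int (\<lambda>x. f x + g x)"
  unfolding square_int_def
proof
  show "(\<lambda>x. f x + g x) \<in> borel_measurable lborel" using f g by measurable
  have "integrable lborel (\<lambda>x. f x \<bullet> f x + 2 * (f x \<bullet> g x) + g x \<bullet> g x)"
    using integrable_inner_square_int[OF f f] integrable_inner_square_int[OF f g]
      integrable_inner_square_int[OF g g] by simp
  then show "integrable lborel (\<lambda>x. (f x + g x) \<bullet> (f x + g x))"
    by (simp add: algebra_simps inner_commute)
qed

lemma square_int_bounded_linear:
  assumes T: "bounded_linear T" and f: "square_int f"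
  shows "square_int (\<lambda>x. T (f x))"
proof -
  obtain K where K: "\<And>x. norm (T x) \<le> norm x * K" "0 < K"
    using bounded_linear.pos_bounded[OF T] by (auto simp: mult.commute)
  have T': "T \<in> borel_measurable borel"
    using linear_continuous_on[OF T] by (intro borel_measurable_continuous_onI)
  have m: "(\<lambda>x. T (f x)) \<in> borel_measurable lborel"
    using measurable_compose[OF square_int_measurable[OF f] T'] by simp
  have "integrable lborel (\<lambda>x. T (f x) \<bullet> T (f x))"
  proof (rule Bochner_Integration.integrable_bound)
    show "integrable lborel (\<lambda>x. K\<^sup>2 * (f x \<bullet> f x))" using f by (simp add: square_int_def)
    show "(\<lambda>x. T (f x) \<bullet> T (f x)) \<in> borel_measurable lborel" using m by measurable
    show "AE x in lborel. norm (T (f x) \<bullet> T (f x)) \<le> norm (K\<^sup>2 * (f x \<bullet> f x))"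
      using K(1) by (intro AE_I2) (simp add: power2_norm_eq_inner[symmetric] 
          power_mult_distrib[symmetric] power_mono mult.commute)
  qed
  with m show ?thesis by (simp add: square_int_def)
qed

lemma square_int_scaleR: "square_int f \<Longrightarrow> square_int (\<lambda>x. c *\<^sub>R f x)"
  by (rule square_int_bounded_linear[OF bounded_linear_scaleR_right])

lemma square_int_diff: "square_int f \<Longrightarrow> square_int g \<Longrightarrow> square_int (\<lambda>x. f x - g x)"
  using square_int_add[OF _ square_int_scaleR[of g "-1"], of f] by simp

lemma square_int_zero: "square_int (\<lambda>x. 0)"
  by (simp add: square_int_def)

lemma ip_commute: "ip f g = ip g f"
  by (simp add: ip_def inner_commute)

lemma ip_add_right:
  "square_int f \<Longrightarrow> square_int g \<Longrightarrow> square_int h \<Longrightarrow> ip f (\<lambda>x. g x + h x) = ip f g + ip f h"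
  by (simp add: ip_def inner_add_right integrable_inner_square_int)

lemma ip_diff_right:
  "square_int f \<Longrightarrow> square_int g \<Longrightarrow> square_int h \<Longrightarrow> ip f (\<lambda>x. g x - h x) = ip f g - ip f h"
  by (simp add: ip_def inner_diff_right integrable_inner_square_int)

lemma ip_scaleR_right: "ip f (\<lambda>x. c *\<^sub>R g x) = c * ip f g"
  by (simp add: ip_def)

lemma ip_self_nonneg: "0 \<le> nsq f"
  by (simp add: ip_def)

text \<open>Cauchy-Schwarz from the sign of a quadratic polynomial in s. It is stated for norms so
  that the two functions may take values in different spaces.\<close>

lemma integral_norm_mult_le:
  fixes f :: "real \<Rightarrow> 'a::euclidean_space" and g :: "real \<Rightarrow> 'b::euclidean_space"
  assumes f: "square_int f" and g: "square_int g"
  shows "(LBINT x. norm (f x) * norm (g x)) \<le> sqrt (nsq f) * sqrt (nsq g)"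
proof -
  define A B C where "A = nsq f" and "B = nsq g"
    and "C = (LBINT x. norm (f x) * norm (g x))"
  have nonneg: "0 \<le> A" "0 \<le> B" "0 \<le> C" by (auto simp: A_def B_def C_def ip_self_nonneg)
  have quad: "0 \<le> s\<^sup>2 * A - 2 * s * C + B" for s
  proof -
    have "0 \<le> (LBINT x. (s * norm (f x) - norm (g x))\<^sup>2)" by simp
    also have "\<dots> = (LBINT x. s\<^sup>2 * (f x \<bullet> f x) - 2 * s * (norm (f x) * norm (g x)) + g x \<bullet> g x)"
      by (simp add: power2_diff power_mult_distrib power2_norm_eq_inner algebra_simps)
    also have "\<dots> = s\<^sup>2 * A - 2 * s * C + B"
      using f g integrable_norm_mult_square_int[OF f g] by (simp add: A_def B_def C_def ip_def square_int_def)
    finally show ?thesis .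
  qed
  have "C\<^sup>2 \<le> A * B"
  proof (cases "A = 0")
    case True
    have "C = 0"
    proof (rule ccontr)
      assume "C \<noteq> 0"
      \<comment> \<open>With A = 0 the polynomial is affine in s, and at this s it equals
        -1.\<close>
      with quad[of "(B + 1) / (2 * C)"] True show False by simp
    qed
    then show ?thesis using nonneg by simp
  next
    case False
    with nonneg have "A > 0" by simp
    \<comment> \<open>C / A is the vertex of the parabola.\<close>
    with quad[of "C / A"] have "0 \<le> A * ((C / A)\<^sup>2 * A - 2 * (C / A) * C + B)" by simp
    also have "\<dots> = A * B - C\<^sup>2" using \<open>A > 0\<close> by (simp add: field_simps power2_eq_square)
    finally show ?thesis by simp
  qed
  then have "C \<le> sqrt (A * B)" by (rule real_le_rsqrt)
  then show ?thesis unfolding real_sqrt_mult A_def B_def C_def .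
qed

lemma abs_ip_le:
  assumes f: "square_int f" and g: "square_int g"
  shows "\<bar>ip f g\<bar> \<le> sqrt (nsq f) * sqrt (nsq g)"
proof -
  have "\<bar>ip f g\<bar> \<le> (LBINT x. norm (f x \<bullet> g x))"
    unfolding ip_def using integral_norm_bound[of lborel "\<lambda>x. f x \<bullet> g x"] by simp
  also have "\<dots> \<le> (LBINT x. norm (f x) * norm (g x))"
    by (intro integral_mono integrable_norm integrable_inner_square_int f g
        integrable_norm_mult_square_int) (simp add: Cauchy_Schwarz_ineq2)
  finally show ?thesis using integral_norm_mult_le[OF f g] by linarith
qed

lemma ip_self_eq_0_iff:
  assumes "square_int f"
  shows "nsq f = 0 \<longleftrightarrow> (AE x in lborel. f x = 0)"
proof -
  have "nsq f = 0 \<longleftrightarrow> (AE x in lborel. f x \<bullet> f x = 0)"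
    unfolding ip_def using assms by (intro integral_nonneg_eq_0_iff_AE) (auto simp: square_int_def)
  then show ?thesis by simp
qed

text \<open>Riesz-Fischer. On a space of infinite measure an L2 Cauchy sequence need not be Cauchy
  in L1, so it is first multiplied by a positive weight \<open>w\<close> in L2; Cauchy-Schwarz then
  gives an L1 Cauchy sequence, hence an a.e. convergent subsequence, and dividing by
  \<open>w\<close> recovers the limit.\<close>

lemma square_int_complete:
  fixes g :: "nat \<Rightarrow> real \<Rightarrow> 'a::euclidean_space"
  assumes g: "\<And>n. square_int (g n)"
    and cauchy: "\<And>e. e > 0 \<Longrightarrow>
      \<exists>N. \<forall>i\<ge>N. \<forall>j\<ge>N. nsq (\<lambda>x. g i x - g j x) \<le> e"
  obtains h where "square_int h" "(\<lambda>n. nsq (\<lambda>x. g n x - h x)) \<longlonglongrightarrow> 0"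
proof -
  define w :: "real \<Rightarrow> real" where "w = (\<lambda>x. sqrt (inverse (1 + x\<^sup>2)))"
  have pos1: "0 < 1 + x\<^sup>2" for x :: real by (simp add: add_pos_nonneg)
  have w_pos: "w x > 0" for x using pos1[of x] by (simp add: w_def)
  have "integrable lborel (\<lambda>x::real. inverse (1 + x\<^sup>2))"
    using integrable_inverse_1_plus_square by (simp add: set_integrable_def)
  moreover have "w x \<bullet> w x = inverse (1 + x\<^sup>2)" for x
    using pos1[of x] by (simp add: w_def less_imp_le)
  ultimately have w: "square_int w"
    by (auto simp: square_int_def w_def)
  have diff: "square_int (\<lambda>x. g i x - g j x)" for i j by (intro square_int_diff g)
  obtain r where r: "strict_mono r" and AE_C: "AE x in lborel. Cauchy (\<lambda>i. w x *\<^sub>R g (r i) x)"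
  proof (rule cauchy_L1_AE_cauchy_subseq[of lborel "\<lambda>i x. w x *\<^sub>R g i x"])
    show "integrable lborel (\<lambda>x. w x *\<^sub>R g n x)" for n
    proof (rule Bochner_Integration.integrable_bound[OF integrable_norm_mult_square_int[OF w g[of n]]])
      show "(\<lambda>x. w x *\<^sub>R g n x) \<in> borel_measurable lborel" using w g[of n] by measurable
    qed auto
    fix e :: real assume e: "e > 0"
    define K where "K = sqrt (nsq w) + 1"
    have K: "K > 0" "sqrt (nsq w) < K" using ip_self_nonneg[of w] by (auto simp: K_def add_nonneg_pos)
    have "(e / K)\<^sup>2 / 4 > 0" using e K by simp
    from cauchy[OF this] obtain N where
      N: "\<And>i j. i \<ge> N \<Longrightarrow> j \<ge> N \<Longrightarrow> nsq (\<lambda>x. g i x - g j x) \<le> (e / K)\<^sup>2 / 4"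
      by blast
    have "(LBINT x. norm (w x *\<^sub>R g i x - w x *\<^sub>R g j x)) < e" if "i \<ge> N" "j \<ge> N" for i j
    proof -
      have "(LBINT x. norm (w x *\<^sub>R g i x - w x *\<^sub>R g j x)) =
          (LBINT x. norm (w x) * norm (g i x - g j x))"
        by (simp add: scaleR_diff_right[symmetric])
      also have "\<dots> \<le> sqrt (nsq w) * sqrt (nsq (\<lambda>x. g i x - g j x))"
        by (rule integral_norm_mult_le[OF w diff])
      also have "\<dots> \<le> K * sqrt ((e / K)\<^sup>2 / 4)"
        using K N[OF that] ip_self_nonneg[of w] by (intro mult_mono) (auto simp: ip_self_nonneg)
      also have "\<dots> = e / 2" using e K by (simp add: real_sqrt_divide)
      finally show ?thesis using e by simp
    qed
    then show "\<exists>N. \<forall>i\<ge>N. \<forall>j\<ge>N. (LBINT x. norm (w x *\<^sub>R g i x - w x *\<^sub>R g j x)) < e"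
      by blast
  qed
  define h where "h x = lim (\<lambda>i. g (r i) x)" for x
  have conv: "AE x in lborel. (\<lambda>i. g (r i) x) \<longlonglongrightarrow> h x"
    using AE_C
  proof eventually_elim
    case (elim x)
    then have "convergent (\<lambda>i. w x *\<^sub>R g (r i) x)" by (rule Cauchy_convergent)
    then obtain l where "(\<lambda>i. w x *\<^sub>R g (r i) x) \<longlonglongrightarrow> l" by (auto simp: convergent_def)
    from tendsto_scaleR[OF tendsto_const[of "inverse (w x)"] this]
    have "(\<lambda>i. g (r i) x) \<longlonglongrightarrow> inverse (w x) *\<^sub>R l" using w_pos[of x] by simp
    then show ?case by (simp add: h_def convergent_def convergent_LIMSEQ_iff[symmetric]) blast
  qed
  have hm [measurable]: "h \<in> borel_measurable lborel"
    unfolding h_def using g by (intro borel_measurable_lim_metric square_int_measurable)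
  have gm [measurable]: "g n \<in> borel_measurable lborel" for n using g by (rule square_int_measurable)
  have bound: "\<exists>N. \<forall>i\<ge>N. square_int (\<lambda>x. g i x - h x) \<and> nsq (\<lambda>x. g i x - h x) \<le> e"
    if e: "e > 0" for e
  proof -
    from cauchy[OF e] obtain N where
      N: "\<And>i j. i \<ge> N \<Longrightarrow> j \<ge> N \<Longrightarrow> nsq (\<lambda>x. g i x - g j x) \<le> e" by blast
    show ?thesis
    proof (intro exI[of _ N] allI impI)
      fix i assume i: "i \<ge> N"
      \<comment> \<open>Fatou in the second index, along the a.e. convergent subsequence, turns the
        Cauchy estimate into an estimate for the limit.\<close>
      have "(\<integral>\<^sup>+x. ennreal ((g i x - h x) \<bullet> (g i x - h x)) \<partial>lborel) =
        (\<integral>\<^sup>+x. liminf (\<lambda>j. ennreal ((g i x - g (r j) x) \<bullet> (g i x - g (r j) x))) \<partial>lborel)"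
      proof (rule nn_integral_cong_AE, use conv in eventually_elim)
        case (elim x)
        have "(\<lambda>j. ennreal ((g i x - g (r j) x) \<bullet> (g i x - g (r j) x))) \<longlonglongrightarrow>
            ennreal ((g i x - h x) \<bullet> (g i x - h x))"
          by (intro tendsto_ennrealI tendsto_intros elim)
        then show ?case by (intro lim_imp_Liminf[symmetric]) simp_all
      qed
      also have "\<dots> \<le> liminf (\<lambda>j. \<integral>\<^sup>+x. ennreal ((g i x - g (r j) x) \<bullet> (g i x - g (r j) x)) \<partial>lborel)"
        by (rule nn_integral_liminf) measurable
      also have "\<dots> \<le> ennreal e"
      proof (rule order_trans[OF Liminf_mono])
        show "\<forall>\<^sub>F j in sequentially.
            (\<integral>\<^sup>+x. ennreal ((g i x - g (r j) x) \<bullet> (g i x - g (r j) x)) \<partial>lborel) \<le> ennreal e"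
          using eventually_ge_at_top[of N]
        proof eventually_elim
          case (elim j)
          have "r j \<ge> N" using seq_suble[OF r, of j] elim by simp
          from N[OF i this]
          have "ennreal (nsq (\<lambda>x. g i x - g (r j) x)) \<le> ennreal e"
            by (rule ennreal_leI)
          then show ?case
            using diff[of i "r j"] by (subst nn_integral_eq_integral) (auto simp: square_int_def ip_def)
        qed
        show "liminf (\<lambda>j. ennreal e) \<le> ennreal e" by (simp add: Liminf_const)
      qed
      finally have le: "(\<integral>\<^sup>+x. ennreal ((g i x - h x) \<bullet> (g i x - h x)) \<partial>lborel) \<le> ennreal e" .
      then have int: "integrable lborel (\<lambda>x. (g i x - h x) \<bullet> (g i x - h x))"
        by (intro integrableI_nonneg) (auto intro: le_less_trans)
      have "ennreal (nsq (\<lambda>x. g i x - h x)) \<le> ennreal e"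
        using le unfolding ip_def by (subst nn_integral_eq_integral[OF int, symmetric]) auto
      then have "nsq (\<lambda>x. g i x - h x) \<le> e"
        using e by (simp add: ennreal_le_iff)
      with int show "square_int (\<lambda>x. g i x - h x) \<and> nsq (\<lambda>x. g i x - h x) \<le> e"
        by (simp add: square_int_def)
    qed
  qed
  obtain N where "square_int (\<lambda>x. g N x - h x)" using bound[of 1] by auto
  from square_int_diff[OF g[of N] this] have "square_int h" by simp
  moreover have "(\<lambda>n. nsq (\<lambda>x. g n x - h x)) \<longlonglongrightarrow> 0"
  proof (rule LIMSEQ_I)
    fix e :: real assume "e > 0"
    then obtain N where "\<And>i. i \<ge> N \<Longrightarrow> nsq (\<lambda>x. g i x - h x) \<le> e/2"
      using bound[of "e/2"] by auto
    with \<open>e > 0\<close> have "\<forall>n\<ge>N. norm (nsq (\<lambda>x. g n x - h x) - 0) < e"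
      by (force simp: ip_self_nonneg)
    then show "\<exists>no. \<forall>n\<ge>no. norm (nsq (\<lambda>x. g n x - h x) - 0) < e" by blast
  qed
  ultimately show ?thesis by (rule that)
qed

text \<open>A stand-in for the convex hull of a tail of the sequence; the parallelogram law involves
  midpoints only.\<close>

inductive_set midhull :: "(nat \<Rightarrow> real \<Rightarrow> 'a::real_vector) \<Rightarrow> nat \<Rightarrow> (real \<Rightarrow> 'a) set"
  for h :: "nat \<Rightarrow> real \<Rightarrow> 'a::real_vector" and n :: nat where
  base: "k \<ge> n \<Longrightarrow> h k \<in> midhull h n"
| mid: "f \<in> midhull h n \<Longrightarrow> g \<in> midhull h n \<Longrightarrow> (\<lambda>x. (1/2) *\<^sub>R (f x + g x)) \<in> midhull h n"

lemma midhull_antimono: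
  assumes "f \<in> midhull h m" "n \<le> m"
  shows "f \<in> midhull h n"
  using assms(1)
proof induction
  case (base k)
  then show ?case using assms(2) by (intro midhull.base) simp
qed (rule midhull.mid)

lemma midhull_square_int:
  assumes "f \<in> midhull h n" "\<And>k. square_int (h k)"
  shows "square_int f"
  using assms(1)
proof induction
  case (base k)
  then show ?case by (intro assms(2))
next
  case (mid f g)
  then show ?case by (intro square_int_scaleR square_int_add)
qed

text \<open>A slab of the form |ip \<open>\<phi>\<close> f - l| <= e is convex, so it contains all
  midpoints of its elements.\<close>

lemma midhull_ip_close:
  assumes "f \<in> midhull h n" and h: "\<And>k. square_int (h k)" and \<phi>: "square_int \<phi>"
    and close: "\<And>k. k \<ge> n \<Longrightarrow> \<bar>ip \<phi> (h k) - l\<bar> \<le> e"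
  shows "\<bar>ip \<phi> f - l\<bar> \<le> e"
  using assms(1)
proof induction
  case (base k)
  then show ?case by (rule close)
next
  case (mid f g)
  have "square_int f" "square_int g" using mid h by (auto intro: midhull_square_int)
  then have "ip \<phi> (\<lambda>x. (1/2) *\<^sub>R (f x + g x)) - l = ((ip \<phi> f - l) + (ip \<phi> g - l)) / 2"
    using \<phi> by (simp only: ip_scaleR_right ip_add_right) (simp add: field_simps)
  with mid.IH show ?case by (auto simp: abs_le_iff)
qed

lemma parallelogram_ip:
  assumes f: "square_int f" and g: "square_int g"
  shows "nsq (\<lambda>x. f x - g x) =
    2 * nsq f + 2 * nsq g - 4 * nsq (\<lambda>x. (1/2) *\<^sub>R (f x + g x))"
proof -
  note i = integrable_inner_square_int[OF f f] integrable_inner_square_int[OF f g]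
    integrable_inner_square_int[OF g g] integrable_inner_square_int[OF g f]
  show ?thesis
    using i by (simp add: ip_def inner_add_left inner_add_right inner_diff_left inner_diff_right field_simps)
qed

text \<open>Nearly minimal elements of the shrinking midpoint hulls form a Cauchy sequence by the
  parallelogram law; their limit is the only possible weak limit of the sequence.\<close>
lemma weak_limit_candidate:
  fixes h :: "nat \<Rightarrow> real \<Rightarrow> 'a::euclidean_space"
  assumes h: "\<And>n. square_int (h n)" and bd: "\<And>n. nsq (h n) \<le> M"
  obtains h0 where "square_int h0"
    "\<And>\<phi> l. square_int \<phi> \<Longrightarrow> (\<lambda>n. ip \<phi> (h n)) \<longlonglongrightarrow> l \<Longrightarrow> ip \<phi> h0 = l"
proof -
  define d where "d n = Inf ((\<lambda>f. nsq f) ` midhull h n)" for n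
  have bdd: "bdd_below ((\<lambda>f. nsq f) ` midhull h n)" for n
    by (rule bdd_belowI[of _ 0]) (auto simp: ip_self_nonneg)
  have ne: "(\<lambda>f. nsq f) ` midhull h n \<noteq> {}" for n by (auto intro: midhull.base)
  have d_le: "d n \<le> nsq f" if "f \<in> midhull h n" for f n
    unfolding d_def using that by (intro cInf_lower bdd) auto
  have d_mono: "d n \<le> d m" if "n \<le> m" for n m
    unfolding d_def using that by (intro cInf_superset_mono bdd ne) (auto intro: midhull_antimono)
  have d_M: "d n \<le> M" for n using d_le[OF midhull.base[of n n h]] bd[of n] by simp
  have "convergent d"
  proof (intro Bseq_mono_convergent BseqI'[of _ "\<bar>d 0\<bar> + \<bar>M\<bar>"])
    show "norm (d n) \<le> \<bar>d 0\<bar> + \<bar>M\<bar>" for n using d_mono[of 0 n] d_M[of n] by auto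
  qed (use d_mono in auto)
  then have d_cauchy: "Cauchy d" by (rule convergent_Cauchy)
  have "\<exists>f. f \<in> midhull h n \<and> nsq f < d n + 1 / real (Suc n)" for n
  proof -
    have "Inf ((\<lambda>f. nsq f) ` midhull h n) < d n + 1 / real (Suc n)" by (simp add: d_def)
    from cInf_lessD[OF ne this] show ?thesis by auto
  qed
  then obtain g where g_in: "\<And>n. g n \<in> midhull h n"
    and g_lt: "\<And>n. nsq (g n) < d n + 1 / real (Suc n)" by metis
  have g: "square_int (g n)" for n using midhull_square_int[OF g_in h] .
  have est: "nsq (\<lambda>x. g n x - g m x) \<le>
      2 * \<bar>d m - d n\<bar> + 2 / real (Suc n) + 2 / real (Suc m)" if "n \<le> m" for n m
  proof -
    have "d n \<le> nsq (\<lambda>x. (1/2) *\<^sub>R (g n x + g m x))"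
      by (intro d_le midhull.mid g_in midhull_antimono[OF g_in that])
    moreover have "d m - d n \<le> \<bar>d m - d n\<bar>" by simp
    ultimately show ?thesis
      using g_lt[of n] g_lt[of m] unfolding parallelogram_ip[OF g g]
      by (simp add: add_divide_distrib)
  qed
  obtain h0 where h0: "square_int h0"
    and lim: "(\<lambda>n. nsq (\<lambda>x. g n x - h0 x)) \<longlonglongrightarrow> 0"
  proof (rule square_int_complete[of g, OF g])
    fix e :: real assume e: "e > 0"
    obtain N1 where N1: "\<And>m n. m \<ge> N1 \<Longrightarrow> n \<ge> N1 \<Longrightarrow> \<bar>d m - d n\<bar> < e / 6"
      using CauchyD[OF d_cauchy, of "e / 6"] e by auto
    obtain N2 where N2: "1 / real (Suc N2) < e / 6"
      using e nat_approx_posE[of "e/6"] by auto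
    have small: "2 / real (Suc n) \<le> e / 3" if "n \<ge> N2" for n
    proof -
      have "1 / real (Suc n) \<le> 1 / real (Suc N2)" using that by (intro divide_left_mono) auto
      with N2 show ?thesis by simp
    qed
    have ord: "nsq (\<lambda>x. g i x - g j x) \<le> e"
      if "i \<ge> max N1 N2" "j \<ge> i" for i j
      using est[OF that(2)] N1[of j i] small[of i] small[of j] that by simp
    have "nsq (\<lambda>x. g i x - g j x) \<le> e" if "i \<ge> max N1 N2" "j \<ge> max N1 N2" for i j
    proof (cases "i \<le> j")
      case False
      have "nsq (\<lambda>x. g i x - g j x) = nsq (\<lambda>x. g j x - g i x)"
        by (simp add: ip_def inner_diff_left inner_diff_right inner_commute algebra_simps)
      then show ?thesis using ord[of j i] that False by simp
    qed (use ord that in auto)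
    then show "\<exists>N. \<forall>i\<ge>N. \<forall>j\<ge>N. nsq (\<lambda>x. g i x - g j x) \<le> e" by blast
  qed
  have "ip \<phi> h0 = l" if \<phi>: "square_int \<phi>" and conv: "(\<lambda>n. ip \<phi> (h n)) \<longlonglongrightarrow> l" for \<phi> l
  proof -
    have "(\<lambda>n. ip \<phi> (g n)) \<longlonglongrightarrow> l"
    proof (rule LIMSEQ_I)
      fix e :: real assume e: "e > 0"
      then obtain N where N: "\<And>n. n \<ge> N \<Longrightarrow> norm (ip \<phi> (h n) - l) < e / 2"
        using LIMSEQ_D[OF conv, of "e/2"] by auto
      have "norm (ip \<phi> (g n) - l) < e" if "n \<ge> N" for n
      proof -
        have "\<bar>ip \<phi> (g n) - l\<bar> \<le> e / 2"
          by (rule midhull_ip_close[OF midhull_antimono[OF g_in that] h \<phi>]) (use N in force)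
        with e show ?thesis by simp
      qed
      then show "\<exists>no. \<forall>n\<ge>no. norm (ip \<phi> (g n) - l) < e" by blast
    qed
    moreover have "(\<lambda>n. ip \<phi> (g n)) \<longlonglongrightarrow> ip \<phi> h0"
    proof (rule LIM_zero_cancel, rule Lim_null_comparison)
      show "\<forall>\<^sub>F n in sequentially. norm (ip \<phi> (g n) - ip \<phi> h0) \<le>
          sqrt (nsq \<phi>) * sqrt (nsq (\<lambda>x. g n x - h0 x))"
        using abs_ip_le[OF \<phi> square_int_diff[OF g h0]] by (simp add: ip_diff_right[OF \<phi> g h0])
      show "(\<lambda>n. sqrt (nsq \<phi>) * sqrt (nsq (\<lambda>x. g n x - h0 x))) \<longlonglongrightarrow> 0"
        using tendsto_mult[OF tendsto_const tendsto_real_sqrt[OF lim]] by simp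
    qed
    ultimately show ?thesis using LIMSEQ_unique by blast
  qed
  with h0 show ?thesis by (rule that)
qed

text \<open>A diagonal sequence makes the pairings with the countably many functions
  \<open>h m\<close> converge. Two weak limit points then differ by a function orthogonal to every
  \<open>h m\<close>, hence to the limit points themselves, hence to its own value: the limit is
  unique and the whole subsequence converges.\<close>

lemma weakly_convergent_subsequence:
  fixes h :: "nat \<Rightarrow> real \<Rightarrow> 'a::euclidean_space"
  assumes h: "\<And>n. square_int (h n)" and bd: "\<And>n. nsq (h n) \<le> M"
  obtains r h0 where "strict_mono r" "square_int h0"
    "\<And>\<phi>. square_int \<phi> \<Longrightarrow> (\<lambda>n. ip \<phi> (h (r n))) \<longlonglongrightarrow> ip \<phi> h0"
proof -
  have ip_bd: "\<bar>ip \<phi> (h n)\<bar> \<le> sqrt (nsq \<phi>) * sqrt M" if "square_int \<phi>" for \<phi> n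
    by (rule order_trans[OF abs_ip_le[OF that h] mult_left_mono]) (use bd in \<open>auto simp: ip_self_nonneg\<close>)
  obtain r where r: "strict_mono r"
    and conv: "\<And>m. \<exists>l. (\<lambda>n. ip (h m) (h (r n))) \<longlonglongrightarrow> l"
  proof (rule function_convergent_subsequence[of "UNIV :: nat set" "\<lambda>n m. ip (h m) (h n)" "sqrt M * sqrt M"])
    show "norm (ip (h m) (h n)) \<le> sqrt M * sqrt M" for m n
    proof -
      have "norm (ip (h m) (h n)) \<le> sqrt (nsq (h m)) * sqrt M" using ip_bd[OF h] by simp
      also have "\<dots> \<le> sqrt M * sqrt M" 
        using bd[of m] ip_self_nonneg[of "h m"] by (intro mult_right_mono) auto
      finally show ?thesis .
    qed
  qed auto
  obtain h0 where h0: "square_int h0"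
    and lim0: "\<And>\<phi> l. square_int \<phi> \<Longrightarrow> (\<lambda>n. ip \<phi> (h (r n))) \<longlonglongrightarrow> l \<Longrightarrow> ip \<phi> h0 = l"
    using weak_limit_candidate[of "\<lambda>n. h (r n)" M] h bd by auto
  have "(\<lambda>n. ip \<phi> (h (r n))) \<longlonglongrightarrow> ip \<phi> h0" if \<phi>: "square_int \<phi>" for \<phi>
  proof (rule ccontr)
    assume "\<not> ?thesis"
    then obtain e where e: "e > 0" and far: "\<And>N. \<exists>n\<ge>N. e \<le> \<bar>ip \<phi> (h (r n)) - ip \<phi> h0\<bar>"
      unfolding LIMSEQ_iff not_all not_ex not_imp not_less real_norm_def by blast
    define S where "S = {n. e \<le> \<bar>ip \<phi> (h (r n)) - ip \<phi> h0\<bar>}"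
    have "infinite S"
      unfolding infinite_nat_iff_unbounded_le S_def using far by auto
    then obtain s :: "nat \<Rightarrow> nat" where s: "strict_mono s" and "\<forall>n. s n \<in> S"
      using infinite_enumerate[of S] by auto
    then have s_far: "e \<le> \<bar>ip \<phi> (h (r (s n))) - ip \<phi> h0\<bar>" for n by (simp add: S_def)
    have "bounded (range (\<lambda>n. ip \<phi> (h (r (s n)))))"
      using ip_bd[OF \<phi>] by (auto simp: bounded_iff)
    \<comment> \<open>Along \<open>s\<close> the pairings with \<open>\<phi>\<close> stay away from
      the expected value; a further subsequence has convergent pairings, and its candidate limit
      \<open>h1\<close> is compared with \<open>h0\<close>.\<close>
    then obtain l t where t: "strict_mono t"
      and l: "((\<lambda>n. ip \<phi> (h (r (s n)))) \<circ> t) \<longlonglongrightarrow> l"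
      using bounded_imp_convergent_subsequence by blast
    define u where "u n = s (t n)" for n
    have u: "strict_mono u" using s t by (auto simp: strict_mono_def u_def)
    obtain h1 where h1: "square_int h1"
      and lim1: "\<And>\<phi> l. square_int \<phi> \<Longrightarrow> (\<lambda>n. ip \<phi> (h (r (u n)))) \<longlonglongrightarrow> l \<Longrightarrow> ip \<phi> h1 = l"
      using weak_limit_candidate[of "\<lambda>n. h (r (u n))" M] h bd by auto
    define \<delta> where "\<delta> x = h0 x - h1 x" for x
    have \<delta>: "square_int \<delta>" unfolding \<delta>_def by (intro square_int_diff h0 h1)
    have orth: "ip \<delta> (h m) = 0" for m
    proof -
      obtain l' where l': "(\<lambda>n. ip (h m) (h (r n))) \<longlonglongrightarrow> l'" using conv by blast
      have "ip (h m) h0 = l'" "ip (h m) h1 = l'"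
        using lim0[OF h l'] lim1[OF h, of m l'] LIMSEQ_subseq_LIMSEQ[OF l' u] by (auto simp: o_def)
      then show ?thesis
        unfolding \<delta>_def by (subst ip_commute) (simp add: ip_diff_right[OF h h0 h1])
    qed
    \<comment> \<open>\<open>\<delta>\<close> pairs to the constant sequence 0, so 0 is the value
      that both candidates must return.\<close>
    have "ip \<delta> h0 = 0" "ip \<delta> h1 = 0" using lim0[OF \<delta>, of 0] lim1[OF \<delta>, of 0] orth by auto
    then have "nsq \<delta> = 0" using ip_diff_right[OF \<delta> h0 h1] by (simp add: \<delta>_def[abs_def])
    then have "ip \<phi> \<delta> = 0" using abs_ip_le[OF \<phi> \<delta>] by simp
    then have "ip \<phi> h0 = ip \<phi> h1" using ip_diff_right[OF \<phi> h0 h1] by (simp add: \<delta>_def[abs_def])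
    also have "\<dots> = l" using lim1[OF \<phi>, of l] l by (simp add: o_def u_def)
    finally have "(\<lambda>n. ip \<phi> (h (r (s (t n))))) \<longlonglongrightarrow> ip \<phi> h0" using l by (simp add: o_def)
    from LIMSEQ_D[OF this e] obtain N where "\<bar>ip \<phi> (h (r (s (t N)))) - ip \<phi> h0\<bar> < e" by auto
    with s_far[of "t N"] show False by simp
  qed
  with r h0 show ?thesis by (rule that)
qed

section \<open>A smooth step\<close>

text \<open>The polynomial parameter makes the family closed under differentiation, so smoothness of
  exp(-1/x) extended by 0 needs only a first derivative.\<close>

definition flat_fun :: "real poly \<Rightarrow> real \<Rightarrow> real" where
  "flat_fun p x = (if x > 0 then poly p (1 / x) * exp (- (1 / x)) else 0)"

lemma flat_fun_tendsto_0: "(flat_fun p \<longlongrightarrow> 0) (at 0)"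
proof -
  have "((\<lambda>t. \<Sum>i\<le>degree p. coeff p i * (t ^ i / exp t)) \<longlongrightarrow> (\<Sum>i\<le>degree p. coeff p i * 0)) at_top"
    by (intro tendsto_intros tendsto_power_div_exp_0)
  then have "((\<lambda>t. poly p t * exp (- t)) \<longlongrightarrow> 0) at_top"
    by (simp add: poly_altdef sum_distrib_right exp_minus divide_inverse mult.assoc)
  then have lim: "((\<lambda>x. poly p (inverse x) * exp (- inverse x)) \<longlongrightarrow> 0) (at_right 0)"
    by (rule filterlim_compose[OF _ filterlim_inverse_at_top_right])
  have "(flat_fun p \<longlongrightarrow> 0) (at_right 0)"
    by (rule Lim_transform_eventually[OF lim])
      (auto simp: eventually_at_filter flat_fun_def inverse_eq_divide)
  moreover have "(flat_fun p \<longlongrightarrow> 0) (at_left 0)"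
    by (rule Lim_transform_eventually[OF tendsto_const])
      (auto simp: eventually_at_filter flat_fun_def)
  ultimately show ?thesis by (simp add: filterlim_split_at)
qed

text \<open>With t = 1/x one has dt/dx = -t^2, which turns p(t) exp(-t) into t^2 (p - p')(t)
  exp(-t).\<close>

lemma flat_fun_deriv:
  "(flat_fun p has_real_derivative flat_fun ([:0, 0, 1:] * (p - pderiv p)) x) (at x)"
proof (cases x "0 :: real" rule: linorder_cases)
  case less
  have "((\<lambda>x. 0) has_real_derivative 0) (at x)" by simp
  then have "(flat_fun p has_real_derivative 0) (at x)"
    by (rule has_field_derivative_transform_within_open[of _ _ _ "{..<0}"])
      (use less in \<open>auto simp: flat_fun_def\<close>)
  then show ?thesis using less by (simp add: flat_fun_def)
next
  case equal
  have "((\<lambda>y. (flat_fun p y - flat_fun p 0) / (y - 0)) \<longlongrightarrow> 0) (at 0)"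
    \<comment> \<open>The difference quotient at 0 is itself a flat function: dividing by y
      multiplies the polynomial by t.\<close>
    by (rule Lim_transform_eventually[OF flat_fun_tendsto_0[of "pCons 0 p"]])
      (auto simp: eventually_at_filter flat_fun_def)
  then show ?thesis unfolding equal has_field_derivative_iff by (simp add: flat_fun_def)
next
  case greater
  have "((\<lambda>x. poly p (1 / x) * exp (- (1 / x))) has_real_derivative
      flat_fun ([:0, 0, 1:] * (p - pderiv p)) x) (at x)"
    using greater by (auto intro!: derivative_eq_intros DERIV_chain2[of "poly p" _ "\<lambda>x. 1 / x"] poly_DERIV 
      simp: flat_fun_def power2_eq_square field_simps)
  then show ?thesis
    by (rule has_field_derivative_transform_within_open[of _ _ _ "{0<..}"])
      (use greater in \<open>auto simp: flat_fun_def\<close>)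
qed

text \<open>Reflected functions occur with both signs because each differentiation of
  \<open>flat_fun p (1 - x)\<close> changes the sign; this closes the set under derivatives.\<close>

inductive_set flat_ring :: "(real \<Rightarrow> real) set" where
  left: "flat_fun p \<in> flat_ring"
| right: "(\<lambda>x. - flat_fun p (1 - x)) \<in> flat_ring"
| right': "(\<lambda>x. flat_fun p (1 - x)) \<in> flat_ring"
| add: "f \<in> flat_ring \<Longrightarrow> g \<in> flat_ring \<Longrightarrow> (\<lambda>x. f x + g x) \<in> flat_ring"
| mult: "f \<in> flat_ring \<Longrightarrow> g \<in> flat_ring \<Longrightarrow> (\<lambda>x. f x * g x) \<in> flat_ring"

lemma flat_fun_deriv_reflect:
  "((\<lambda>x. flat_fun p (1 - x)) has_real_derivative - flat_fun ([:0, 0, 1:] * (p - pderiv p)) (1 - x)) (at x)"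
proof -
  have "((\<lambda>x. 1 - x) has_real_derivative -1) (at x)" by (auto intro!: derivative_eq_intros)
  from DERIV_chain2[where f = "flat_fun p" and g = "\<lambda>x. 1 - x", OF flat_fun_deriv this]
  show ?thesis by simp
qed

lemma flat_ring_deriv:
  assumes "f \<in> flat_ring"
  shows "\<exists>f'\<in>flat_ring. \<forall>x. (f has_real_derivative f' x) (at x)"
  using assms
proof induction
  case (left p)
  show ?case using flat_fun_deriv flat_ring.left by blast
next
  case (right p)
  show ?case
    by (rule bexI[OF _ flat_ring.right'[of "[:0, 0, 1:] * (p - pderiv p)"]])
      (use DERIV_minus[OF flat_fun_deriv_reflect[of p]] in simp)
next
  case (right' p)
  show ?case using flat_fun_deriv_reflect flat_ring.right by fast
next
  case (add f g)
  then obtain f' g' where d: "f' \<in> flat_ring" "g' \<in> flat_ring" "\<And>x. (f has_real_derivative f' x) (at x)"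
    "\<And>x. (g has_real_derivative g' x) (at x)" by blast
  show ?case
    by (rule bexI[OF _ flat_ring.add[OF d(1,2)]]) (auto intro!: DERIV_add d)
next
  case (mult f g)
  then obtain f' g' where d: "f' \<in> flat_ring" "g' \<in> flat_ring" "\<And>x. (f has_real_derivative f' x) (at x)"
    "\<And>x. (g has_real_derivative g' x) (at x)" by blast
  show ?case
    by (rule bexI[OF _ flat_ring.add[OF flat_ring.mult[OF d(1) mult(2)] flat_ring.mult[OF d(2) mult(1)]]])
      (auto intro!: DERIV_mult d)
qed

lemma antiderivative_vanishing_left:
  fixes f :: "real \<Rightarrow> real"
  assumes cont: "continuous_on UNIV f" and zero: "\<And>x. x \<le> 0 \<Longrightarrow> f x = 0"
  obtains A where "\<And>x. (A has_real_derivative f x) (at x)" "\<And>x. x \<le> 0 \<Longrightarrow> A x = 0"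
proof -
  \<comment> \<open>The base point -1 leaves room to the left of 0, so that every x >= 0 is interior
    to the interval of integration.\<close>
  define A where "A x = integral {-1..x} f" for x
  have A0: "A x = 0" if "x \<le> 0" for x
    unfolding A_def using that zero by (subst integral_cong[of _ f "\<lambda>x. 0"]) auto
  have "(A has_real_derivative f x) (at x)" for x
  proof (cases "x < 0")
    case True
    have "((\<lambda>x. 0) has_real_derivative 0) (at x)" by simp
    then have "(A has_real_derivative 0) (at x)"
      by (rule has_field_derivative_transform_within_open[of _ _ _ "{..<0}"])
        (use True A0 in auto)
    then show ?thesis using True zero by simp
  next
    case False
    have "(A has_real_derivative f x) (at x within {-1..x+1})"
      unfolding A_def using False cont
      by (intro integral_has_real_derivative) (auto intro: continuous_on_subset)
    then show ?thesis using False by (subst (asm) at_within_interior) (auto simp: interior_atLeastAtMost_real)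
  qed
  with A0 show ?thesis using that by blast
qed

text \<open>\<open>D 2\<close> is a normalised bump on (0,1), \<open>D 1\<close> its antiderivative,
  a step from 0 to 1, and \<open>D 0\<close> the antiderivative of the step, a ramp. The result is
  one sequence of successive derivatives because \<open>test_fun\<close> asks for exactly
  that.\<close>

lemma smooth_ramp:
  obtains D :: "nat \<Rightarrow> real \<Rightarrow> real" and \<kappa> :: real where
    "\<And>k x. (D k has_real_derivative D (Suc k) x) (at x)"
    "\<And>x. x \<le> 0 \<Longrightarrow> D 0 x = 0" "\<And>x. x \<ge> 1 \<Longrightarrow> D 0 x = x - \<kappa>"
    "\<And>x. x \<le> 0 \<Longrightarrow> D 1 x = 0" "\<And>x. x \<ge> 1 \<Longrightarrow> D 1 x = 1" "\<And>x. 0 \<le> D 1 x" "\<And>x. D 1 x \<le> 1"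
    "\<And>x. x \<le> 0 \<Longrightarrow> D 2 x = 0" "\<And>x. x \<ge> 1 \<Longrightarrow> D 2 x = 0"
proof -
  obtain d where d: "\<And>f. f \<in> flat_ring \<Longrightarrow> d f \<in> flat_ring"
    "\<And>f x. f \<in> flat_ring \<Longrightarrow> (f has_real_derivative d f x) (at x)"
    using flat_ring_deriv by metis
  \<comment> \<open>The bump: the first factor vanishes to the left of 0, the second to the right of
    1.\<close>
  define \<beta> where "\<beta> x = flat_fun 1 x * flat_fun 1 (1 - x)" for x
  have \<beta>: "\<beta> \<in> flat_ring"
    unfolding \<beta>_def[abs_def] by (intro flat_ring.mult flat_ring.left flat_ring.right')
  have \<beta>k: "(d ^^ k) \<beta> \<in> flat_ring" for k by (induction k) (auto simp: \<beta> d)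
  have \<beta>_deriv: "((d ^^ k) \<beta> has_real_derivative (d ^^ Suc k) \<beta> x) (at x)" for k x
    using d(2)[OF \<beta>k[of k]] by simp
  have \<beta>_pos: "\<beta> x > 0" if "0 < x" "x < 1" for x using that by (simp add: \<beta>_def flat_fun_def)
  have \<beta>_zero: "\<beta> x = 0" if "x \<le> 0 \<or> x \<ge> 1" for x using that by (auto simp: \<beta>_def flat_fun_def)
  have \<beta>_nonneg: "\<beta> x \<ge> 0" for x using \<beta>_pos[of x] \<beta>_zero[of x] by (cases "0 < x \<and> x < 1") auto
  have "continuous_on UNIV \<beta>"
    using d(2)[OF \<beta>] by (intro DERIV_continuous_on) auto
  then obtain A where A: "\<And>x. (A has_real_derivative \<beta> x) (at x)" "\<And>x. x \<le> 0 \<Longrightarrow> A x = 0"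
    using antiderivative_vanishing_left[of \<beta>] \<beta>_zero by auto
  have A_mono: "A x \<le> A y" if "x \<le> y" for x y
    using that by (rule DERIV_nonneg_imp_nondecreasing) (use A \<beta>_nonneg in blast)
  have contA: "continuous_on UNIV A" using A by (intro DERIV_continuous_on) auto
  have "A 0 < A 1"
    by (rule DERIV_pos_imp_increasing_open) (use A \<beta>_pos contA in \<open>auto intro: continuous_on_subset\<close>)
  then have c: "A 1 > 0" using A by simp
  have A1: "A x = A 1" if "x \<ge> 1" for x
  proof (cases "x = 1")
    case False
    then have "1 < x" using that by simp
    then obtain z where "1 < z" "A x - A 1 = (x - 1) * \<beta> z"
      using MVT2[of 1 x A \<beta>] A by auto
    then show ?thesis using \<beta>_zero by simp
  qed simp
  obtain B where B: "\<And>x. (B has_real_derivative A x) (at x)" "\<And>x. x \<le> 0 \<Longrightarrow> B x = 0"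
    using antiderivative_vanishing_left[of A] A contA by auto
  have B1: "B x = B 1 + A 1 * (x - 1)" if "x \<ge> 1" for x
  proof (cases "x = 1")
    case False
    then have "1 < x" using that by simp
    then obtain z where z: "1 < z" "B x - B 1 = (x - 1) * A z"
      using MVT2[of 1 x B A] B by auto
    then have "A z = A 1" by (intro A1) simp
    with z show ?thesis by (simp add: algebra_simps)
  qed simp
  define D where "D k x = (case k of 0 \<Rightarrow> B x / A 1 | Suc 0 \<Rightarrow> A x / A 1 | Suc (Suc j) \<Rightarrow> (d ^^ j) \<beta> x / A 1)"
    for k x
  show ?thesis
  proof (rule that[of D "1 - B 1 / A 1"])
    show "(D k has_real_derivative D (Suc k) x) (at x)" for k x
    proof (cases k)
      case 0
      then show ?thesis using DERIV_cdivide[OF B(1)[of x], of "A 1"] by (simp add: D_def[abs_def])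
    next
      case (Suc j)
      then show ?thesis
        using DERIV_cdivide[OF A(1)[of x], of "A 1"]
          DERIV_cdivide[OF \<beta>_deriv[of "j - 1" x], of "A 1"]
        by (cases j) (simp_all add: D_def[abs_def])
    qed
    show "D 0 x = 0" "D 1 x = 0" "D 2 x = 0" if "x \<le> 0" for x
      using that A B \<beta>_zero by (auto simp: D_def numeral_2_eq_2)
    show "D 0 x = x - (1 - B 1 / A 1)" "D 1 x = 1" "D 2 x = 0" if "x \<ge> 1" for x
      using that A1[OF that] B1[OF that] \<beta>_zero c by (auto simp: D_def numeral_2_eq_2 field_simps)
    show "0 \<le> D 1 x" for x
      using A_mono[of 0 x] A(2) c by (cases "x \<le> 0") (auto simp: D_def)
    show "D 1 x \<le> 1" for x
      using A_mono[of x 1] A1[of x] c by (cases "x \<le> 1") (auto simp: D_def)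
  qed
qed

section \<open>Weak derivatives on the line\<close>

text \<open>A common bound and a common compact support of the factors \<open>k n\<close> give the
  majorant K |f| on [-R, R], so local integrability of f is enough.\<close>

lemma local_dominated_convergence:
  fixes f k0 :: "real \<Rightarrow> real" and k :: "nat \<Rightarrow> real \<Rightarrow> real"
  assumes f: "f \<in> borel_measurable lborel" "set_integrable lborel {-R..R} f"
    and k [measurable]: "\<And>n. k n \<in> borel_measurable borel"
    and bound: "\<And>n x. \<bar>k n x\<bar> \<le> K" and supp: "\<And>n x. \<bar>x\<bar> > R \<Longrightarrow> k n x = 0"
    and lim: "\<And>x. (\<lambda>n. k n x) \<longlonglongrightarrow> k0 x"
  shows "(\<lambda>n. LBINT x. f x * k n x) \<longlonglongrightarrow> (LBINT x. f x * k0 x)"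
    and "integrable lborel (\<lambda>x. f x * k0 x)"
proof -
  note [measurable] = f(1)
  have k0 [measurable]: "k0 \<in> borel_measurable borel"
    by (rule borel_measurable_LIMSEQ_real[OF lim k])
  let ?w = "\<lambda>x. K * norm (indicator {-R..R} x *\<^sub>R f x)"
  have w: "integrable lborel ?w"
    using f(2) unfolding set_integrable_def by (intro integrable_mult_right integrable_norm)
  have "K \<ge> 0" using bound[of 0 0] by simp
  have dom: "AE x in lborel. norm (f x * k n x) \<le> ?w x" for n
  proof (rule AE_I2)
    fix x
    show "norm (f x * k n x) \<le> ?w x"
    proof (cases "\<bar>x\<bar> > R")
      case True
      then show ?thesis using supp[OF True] \<open>K \<ge> 0\<close> by simp
    next
      case False
      then have "indicator {-R..R} x = (1::real)" by (simp add: indicator_def abs_le_iff not_less)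
      then show ?thesis
        using mult_left_mono[OF bound[of n x] abs_ge_zero[of "f x"]] by (simp add: abs_mult mult.commute)
    qed
  qed
  have lim': "AE x in lborel. (\<lambda>n. f x * k n x) \<longlonglongrightarrow> f x * k0 x"
    by (intro AE_I2 tendsto_mult tendsto_const lim)
  show "(\<lambda>n. LBINT x. f x * k n x) \<longlonglongrightarrow> (LBINT x. f x * k0 x)"
    by (rule integral_dominated_convergence[OF _ _ w lim' dom]) measurable
  show "integrable lborel (\<lambda>x. f x * k0 x)"
    by (rule integrable_dominated_convergence[OF _ _ w lim' dom]) measurable
qed

lemma local_integrable_mult:
  fixes f k :: "real \<Rightarrow> real"
  assumes "f \<in> borel_measurable lborel" "set_integrable lborel {-R..R} f"
    and "k \<in> borel_measurable borel" "\<And>x. \<bar>k x\<bar> \<le> K" "\<And>x. \<bar>x\<bar> > R \<Longrightarrow> k x = 0"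
  shows "integrable lborel (\<lambda>x. f x * k x)"
  by (rule local_dominated_convergence(2)[where k = "\<lambda>_. k" and R = R and K = K]) (fact assms tendsto_const)+

definition smooth_step :: "(real \<Rightarrow> real) \<Rightarrow> bool" where
  "smooth_step \<theta> \<longleftrightarrow> \<theta> \<in> borel_measurable borel \<and> (\<forall>x\<le>0. \<theta> x = 0) \<and> (\<forall>x\<ge>1. \<theta> x = 1) \<and>
     (\<forall>x. 0 \<le> \<theta> x \<and> \<theta> x \<le> 1)"

text \<open>The weak formulation tested against smooth approximations, as \<open>\<epsilon> \<rightarrow> 0\<close>, of the function
  rising linearly from \<open>0\<close> at \<open>r\<close> to \<open>s - r\<close> at \<open>s\<close>, cut off by a fixed smooth step.\<close>
lemma weak_deriv_tested:
  obtains \<theta> \<eta> :: "real \<Rightarrow> real" where "smooth_step \<theta>"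
    "\<And>f. f \<in> borel_measurable lborel \<Longrightarrow> set_integrable lborel {-1..1} f \<Longrightarrow> integrable lborel (\<lambda>x. f x * \<eta> x)"
    "\<And>f g r s. weak_deriv f g \<Longrightarrow> r < s \<Longrightarrow>
      (LBINT x. f x * (indicator {r<..s} x - (s - r) * \<eta> x)) =
      - (LBINT x. g x * (max 0 (x - r) - max 0 (x - s) - (s - r) * \<theta> x))"
proof -
  obtain D :: "nat \<Rightarrow> real \<Rightarrow> real" and \<kappa> :: real where D: "\<And>k x. (D k has_real_derivative D (Suc k) x) (at x)"
    "\<And>x. x \<le> 0 \<Longrightarrow> D 0 x = 0" "\<And>x. x \<ge> 1 \<Longrightarrow> D 0 x = x - \<kappa>"
    "\<And>x. x \<le> 0 \<Longrightarrow> D 1 x = 0" "\<And>x. x \<ge> 1 \<Longrightarrow> D 1 x = 1" "\<And>x. 0 \<le> D 1 x" "\<And>x. D 1 x \<le> 1"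
    "\<And>x. x \<le> 0 \<Longrightarrow> D 2 x = 0" "\<And>x. x \<ge> 1 \<Longrightarrow> D 2 x = 0"
    by (rule smooth_ramp) (rule that)
  define \<rho> \<theta> \<eta> where "\<rho> = D 0" and "\<theta> = D 1" and "\<eta> = D 2"
  note \<rho> = D(2,3)[folded \<rho>_def] and \<theta> = D(4-7)[folded \<theta>_def] and \<eta> = D(8,9)[folded \<eta>_def]
  have D_meas [measurable]: "D k \<in> borel_measurable borel" for k
    by (intro borel_measurable_continuous_onI DERIV_continuous_on[OF D(1)])
  have \<eta>_cont: "continuous_on UNIV \<eta>"
    unfolding \<eta>_def by (intro DERIV_continuous_on[OF D(1)])
  have meas: "\<theta> \<in> borel_measurable borel" "\<eta> \<in> borel_measurable borel"
    by (simp_all add: \<theta>_def \<eta>_def)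
  have "compact (\<eta> ` {0..1})"
    by (intro compact_continuous_image continuous_on_subset[OF \<eta>_cont]) auto
  then have "bounded (\<eta> ` {0..1})" by (rule compact_imp_bounded)
  then obtain L where "\<forall>y\<in>\<eta> ` {0..1}. norm y \<le> L" by (auto simp only: bounded_iff)
  then have L: "\<bar>\<eta> x\<bar> \<le> L" if "x \<in> {0..1}" for x using that by auto
  have \<eta>_bound: "\<bar>\<eta> x\<bar> \<le> L" for x
  proof (cases "x \<in> {0..1}")
    case False
    then have "\<eta> x = 0" using \<eta>[of x] by auto
    then show ?thesis using L[of 0] by auto
  qed (rule L)
  have int2: "integrable lborel (\<lambda>x. f x * \<eta> x)"
    if "f \<in> borel_measurable lborel" "set_integrable lborel {-1..1} f" for f
  proof (rule local_integrable_mult[OF that meas(2) \<eta>_bound])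
    show "\<eta> x = 0" if "1 < \<bar>x\<bar>" for x using \<eta>[of x] that by (cases "x \<ge> 1") auto
  qed
  have \<rho>_lip: "\<bar>\<rho> x - \<rho> y\<bar> \<le> \<bar>x - y\<bar>" for x y
  proof -
    have "(\<rho> has_real_derivative \<theta> x) (at x)" for x
      using D(1)[of 0 x] by (simp add: \<rho>_def \<theta>_def)
    then have "norm (\<rho> x - \<rho> y) \<le> 1 * norm (x - y)"
      by (intro field_differentiable_bound[of UNIV \<rho> \<theta>]) (use \<theta>(3,4) in auto)
    then show ?thesis by simp
  qed
  have key: "(LBINT x. f x * (indicator {r<..s} x - (s - r) * \<eta> x)) =
      - (LBINT x. g x * (max 0 (x - r) - max 0 (x - s) - (s - r) * \<theta> x))"
    if wd: "weak_deriv f g" and rs: "r < s" for f g r s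
  proof -
    define e where "e n = inverse (real (Suc n))" for n
    have e: "0 < e n" "e n \<le> 1" for n by (auto simp: e_def field_simps)
    have e_lim: "e \<longlonglongrightarrow> 0" unfolding e_def[abs_def] by (rule LIMSEQ_inverse_real_of_nat)
    \<comment> \<open>Two ramps of slope 1 starting at r and s, smoothed on scale
      \<open>e n\<close>. To the right their difference is the constant s - r (the shift
      \<open>\<kappa>\<close> cancels), and subtracting s - r times the fixed step restores compact
      support. The powers of 1 / \<open>e n\<close> come from the chain rule.\<close>
    define \<phi> where "\<phi> n k x = e n * (1 / e n) ^ k * D k ((x - r) / e n)
      - e n * (1 / e n) ^ k * D k ((x - s) / e n) - (s - r) * D (Suc k) x" for n k x
    have \<phi>0: "\<phi> n 0 x = e n * \<rho> ((x - r) / e n) - e n * \<rho> ((x - s) / e n) - (s - r) * \<theta> x" for n x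
      by (simp add: \<phi>_def \<rho>_def \<theta>_def)
    have \<phi>1: "\<phi> n 1 x = \<theta> ((x - r) / e n) - \<theta> ((x - s) / e n) - (s - r) * \<eta> x" for n x
      using e[of n] by (simp add: \<phi>_def \<theta>_def \<eta>_def numeral_2_eq_2)
    \<comment> \<open>Since \<open>e n\<close> is at most 1, beyond this radius all three arguments
      lie on the same side of the transition interval [0,1].\<close>
    define R where "R = \<bar>r\<bar> + \<bar>s\<bar> + 2"
    have far: "(x - r) / e n \<ge> 1 \<and> (x - s) / e n \<ge> 1 \<and> x \<ge> 1 \<or> (x - r) / e n \<le> 0 \<and> (x - s) / e n \<le> 0 \<and> x \<le> 0"
      if "\<bar>x\<bar> > R" for x n
      using that e[of n] by (cases "x > 0") (auto simp: R_def field_simps abs_if split: if_splits)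
    have \<phi>_deriv: "(\<phi> n k has_real_derivative \<phi> n (Suc k) x) (at x)" for n k x
    proof -
      have c: "((\<lambda>x. D k ((x - a) / e n)) has_real_derivative D (Suc k) ((x - a) / e n) * (1 / e n)) (at x)" for a
      proof -
        have "((\<lambda>x. (x - a) / e n) has_real_derivative 1 / e n) (at x)"
          using e[of n] by (auto intro!: derivative_eq_intros)
        from DERIV_chain2[where f = "D k" and g = "\<lambda>x. (x - a) / e n", OF D(1) this] show ?thesis .
      qed
      show ?thesis
        unfolding \<phi>_def[abs_def]
        by (rule derivative_eq_intros DERIV_cmult[OF c] D(1) refl | simp)+
    qed
    have \<phi>_zero: "\<phi> n 0 x = 0" "\<phi> n 1 x = 0" if xR: "\<bar>x\<bar> > R" for n x
    proof -
      consider "(x - r) / e n \<ge> 1" "(x - s) / e n \<ge> 1" "x \<ge> 1"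
        | "(x - r) / e n \<le> 0" "(x - s) / e n \<le> 0" "x \<le> 0" using far[OF xR, of n] by blast
      then have "\<phi> n 0 x = 0 \<and> \<phi> n 1 x = 0"
      proof cases
        case 1
        show ?thesis
          using e[of n] unfolding \<phi>0 \<phi>1 \<rho>(2)[OF 1(1)] \<rho>(2)[OF 1(2)] \<theta>(2)[OF 1(1)] \<theta>(2)[OF 1(2)]
            \<theta>(2)[OF 1(3)] \<eta>(2)[OF 1(3)] by (simp add: field_simps)
      next
        case 2
        show ?thesis
          unfolding \<phi>0 \<phi>1 \<rho>(1)[OF 2(1)] \<rho>(1)[OF 2(2)] \<theta>(1)[OF 2(1)] \<theta>(1)[OF 2(2)]
            \<theta>(1)[OF 2(3)] \<eta>(1)[OF 2(3)] by simp
      qed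
      then show "\<phi> n 0 x = 0" "\<phi> n 1 x = 0" by auto
    qed
    have test: "test_fun (\<phi> n 0)" for n
      unfolding test_fun_def using \<phi>_deriv \<phi>_zero by blast
    have deriv: "deriv (\<phi> n 0) x = \<phi> n 1 x" for n x
      using DERIV_imp_deriv[OF \<phi>_deriv[of n 0 x]] by simp
    have f: "f \<in> borel_measurable lborel" "set_integrable lborel {-R..R} f"
      and g: "g \<in> borel_measurable lborel" "set_integrable lborel {-R..R} g"
      and eq: "\<And>\<phi>. test_fun \<phi> \<Longrightarrow> (LBINT x. f x * deriv \<phi> x) = - (LBINT x. g x * \<phi> x)"
      using wd by (auto simp: weak_deriv_def)
    have \<phi>_meas: "\<phi> n k \<in> borel_measurable borel" for n k
      unfolding \<phi>_def[abs_def] by measurable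
    have ev: "\<forall>\<^sub>F n in sequentially. (x - a) / e n \<ge> 1" if "x > a" for x a
    proof -
      have "\<forall>\<^sub>F n in sequentially. e n < x - a" using order_tendstoD(2)[OF e_lim, of "x - a"] that by simp
      then show ?thesis by eventually_elim (use e in \<open>auto simp: field_simps\<close>)
    qed
    have nonpos: "(x - a) / e n \<le> 0" if "x \<le> a" for x a n
      using that e[of n] by (simp add: divide_nonpos_pos)
    have l1: "(\<lambda>n. \<theta> ((x - a) / e n)) \<longlonglongrightarrow> indicator {a<..} x" for x a
    proof (cases "x > a")
      case True
      have "\<forall>\<^sub>F n in sequentially. 1 = \<theta> ((x - a) / e n)"
        using ev[OF True] by eventually_elim (simp add: \<theta>(2))
      from Lim_transform_eventually[OF tendsto_const this] show ?thesis using True by simp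
    next
      case False
      then show ?thesis using nonpos[of x a] by (simp add: \<theta>(1))
    qed
    have l0: "(\<lambda>n. e n * \<rho> ((x - a) / e n)) \<longlonglongrightarrow> max 0 (x - a)" for x a
    proof (cases "x > a")
      case True
      have "\<forall>\<^sub>F n in sequentially. x - a - e n * \<kappa> = e n * \<rho> ((x - a) / e n)"
        using ev[OF True] 
      proof eventually_elim
        case (elim n)
        have "e n * \<rho> ((x - a) / e n) = e n * ((x - a) / e n) - e n * \<kappa>"
          unfolding \<rho>(2)[OF elim] by (rule right_diff_distrib)
        then show ?case using e[of n] by simp
      qed
      moreover have "(\<lambda>n. x - a - e n * \<kappa>) \<longlonglongrightarrow> x - a - 0 * \<kappa>" by (intro tendsto_intros e_lim)
      ultimately show ?thesis using True by (simp add: Lim_transform_eventually)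
    next
      case False
      then show ?thesis using nonpos[of x a] by (simp add: \<rho>(1))
    qed
    have "(\<lambda>n. LBINT x. f x * \<phi> n 1 x) \<longlonglongrightarrow>
        (LBINT x. f x * (indicator {r<..s} x - (s - r) * \<eta> x))"
    proof (rule local_dominated_convergence(1)[OF f \<phi>_meas _ \<phi>_zero(2), where K = "2 + (s - r) * L"])
      fix n x
      have "\<bar>\<phi> n 1 x\<bar> \<le> \<bar>\<theta> ((x - r) / e n)\<bar> + \<bar>\<theta> ((x - s) / e n)\<bar> + \<bar>(s - r) * \<eta> x\<bar>"
        unfolding \<phi>1 by simp
      also have "\<dots> \<le> 1 + 1 + (s - r) * L"
        using \<theta>(3,4) \<eta>_bound[of x] rs by (intro add_mono) (auto simp: abs_mult)
      finally show "\<bar>\<phi> n 1 x\<bar> \<le> 2 + (s - r) * L" by simp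
    next
      fix x
      have "(\<lambda>n. \<theta> ((x - r) / e n) - \<theta> ((x - s) / e n) - (s - r) * \<eta> x) \<longlonglongrightarrow>
        indicator {r<..} x - indicator {s<..} x - (s - r) * \<eta> x"
        by (intro tendsto_intros l1)
      moreover have "indicator {r<..} x - indicator {s<..} x = (indicator {r<..s} x :: real)"
        using rs by (auto simp: indicator_def)
      ultimately show "(\<lambda>n. \<phi> n 1 x) \<longlonglongrightarrow> indicator {r<..s} x - (s - r) * \<eta> x"
        unfolding \<phi>1 by simp
    qed auto
    moreover have "(\<lambda>n. LBINT x. g x * \<phi> n 0 x) \<longlonglongrightarrow>
        (LBINT x. g x * (max 0 (x - r) - max 0 (x - s) - (s - r) * \<theta> x))"
    proof (rule local_dominated_convergence(1)[OF g \<phi>_meas _ \<phi>_zero(1), where K = "2 * (s - r)"])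
      fix n x
      have "\<bar>e n * \<rho> ((x - r) / e n) - e n * \<rho> ((x - s) / e n)\<bar> = e n * \<bar>\<rho> ((x - r) / e n) - \<rho> ((x - s) / e n)\<bar>"
        using e[of n] by (simp add: abs_mult right_diff_distrib[symmetric])
      also have "\<dots> \<le> e n * \<bar>(x - r) / e n - (x - s) / e n\<bar>"
        using e[of n] by (intro mult_left_mono \<rho>_lip) auto
      also have "\<dots> = s - r" using e[of n] rs by (simp add: diff_divide_distrib[symmetric])
      finally have "\<bar>e n * \<rho> ((x - r) / e n) - e n * \<rho> ((x - s) / e n)\<bar> \<le> s - r" .
      moreover have "\<bar>(s - r) * \<theta> x\<bar> \<le> s - r" using \<theta>(3,4)[of x] rs by (simp add: abs_mult mult_left_le)
      ultimately show "\<bar>\<phi> n 0 x\<bar> \<le> 2 * (s - r)"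
        unfolding \<phi>0 mult_2 by (rule order_trans[OF abs_triangle_ineq4 add_mono])
    next
      fix x
      show "(\<lambda>n. \<phi> n 0 x) \<longlonglongrightarrow> max 0 (x - r) - max 0 (x - s) - (s - r) * \<theta> x"
        unfolding \<phi>0 by (intro tendsto_diff l0 tendsto_const)
    qed auto
    moreover have "(LBINT x. f x * \<phi> n 1 x) = - (LBINT x. g x * \<phi> n 0 x)" for n
      using eq[OF test[of n]] by (simp add: deriv)
    ultimately show ?thesis using LIMSEQ_unique[OF _ tendsto_minus] by simp
  qed
  show ?thesis
    by (rule that[of \<theta> \<eta>]) (use \<theta> meas int2 key in \<open>auto simp: smooth_step_def\<close>)
qed

section \<open>Translations, Lebesgue points and the primitive of a weak derivative\<close>

lemma AE_lborel_shift:
  fixes P :: "real \<Rightarrow> bool"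
  assumes "AE x in lborel. P x"
  shows "AE x in lborel. P (x + c)"
proof -
  from assms have "AE x in distr lborel borel ((+) c). P x" unfolding lborel_distr_plus .
  then have "AE x in lborel. P (c + x)" by (rule AE_distrD[rotated]) simp
  then show ?thesis by (simp add: add.commute)
qed

lemma lborel_integral_shift:
  fixes f :: "real \<Rightarrow> 'a::euclidean_space"
  shows "(LBINT x. f (x + c)) = (LBINT x. f x)"
  using lborel_integral_real_affine[of 1 f c] by (simp add: add.commute)

lemma lborel_integrable_shift_iff:
  fixes f :: "real \<Rightarrow> 'a::euclidean_space"
  shows "integrable lborel (\<lambda>x. f (x + c)) \<longleftrightarrow> integrable lborel f"
  using lborel_integrable_real_affine_iff[of 1 f c] by (simp add: add.commute)

text \<open>Lebesgue differentiation along one-sided intervals of length 1/(n+1), in the indicator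
  form that occurs in the tested identity.\<close>

lemma AE_averages_tendsto:
  fixes f :: "real \<Rightarrow> real"
  assumes f [measurable]: "f \<in> borel_measurable lborel" and int: "\<And>r s. set_integrable lborel {r..s} f"
  shows "AE x in lborel.
    (\<lambda>n. real (Suc n) * (LBINT y. f y * indicator {x<..x + inverse (real (Suc n))} y)) \<longlonglongrightarrow> f x"
proof -
  have "f integrable_on cbox a b" for a b
    using set_borel_integral_eq_integral(1)[OF int[of a b]] by simp
  then obtain N where N: "negligible N" and lim: "\<And>x e. x \<notin> N \<Longrightarrow> 0 < e \<Longrightarrow>
      \<exists>d>0. \<forall>h. 0 < h \<and> h < d \<longrightarrow> norm (integral (cbox x (x + h *\<^sub>R One)) f /\<^sub>R h ^ DIM(real) - f x) < e"
    using integrable_ccontinuous_explicit[of f] by metis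
  have "AE x in lebesgue. x \<notin> N"
    using N by (auto simp: negligible_iff_null_sets intro: AE_not_in)
  then have "AE x in lborel. x \<notin> N" by (simp add: AE_completion_iff)
  then show ?thesis
  proof eventually_elim
    case (elim x)
    have eq: "(LBINT y. f y * indicator {x<..x + h} y) = integral {x..x + h} f" for h
    proof -
      have "(LBINT y. f y * indicator {x<..x + h} y) = (LINT y:{x..x + h}|lborel. f y)"
        unfolding set_lebesgue_integral_def
      proof (rule integral_cong_AE)
        show "AE y in lborel. f y * indicator {x<..x + h} y = indicator {x..x + h} y *\<^sub>R f y"
          using AE_lborel_singleton[of x] by eventually_elim (auto simp: indicator_def)
      qed measurable
      then show ?thesis using set_borel_integral_eq_integral(2)[OF int[of x "x + h"]] by simp
    qed
    show ?case
    proof (rule LIMSEQ_I)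
      fix e :: real assume "e > 0"
      then obtain d where d: "d > 0"
        "\<And>h. 0 < h \<Longrightarrow> h < d \<Longrightarrow> \<bar>integral {x..x + h} f /\<^sub>R h - f x\<bar> < e"
        using lim[OF elim, of e] by auto
      obtain M where M: "inverse (real (Suc M)) < d" using reals_Archimedean[OF d(1)] by blast
      have "\<bar>integral {x..x + inverse (real (Suc n))} f /\<^sub>R inverse (real (Suc n)) - f x\<bar> < e" if "n \<ge> M" for n
      proof (rule d(2))
        have "inverse (real (Suc n)) \<le> inverse (real (Suc M))" using that by (intro le_imp_inverse_le) auto
        with M show "inverse (real (Suc n)) < d" by linarith
      qed simp
      then show "\<exists>no. \<forall>n\<ge>no. norm (real (Suc n) *
          (LBINT y. f y * indicator {x<..x + inverse (real (Suc n))} y) - f x) < e"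
        unfolding eq by (intro exI[of _ M]) (simp del: of_nat_Suc)
    qed
  qed
qed

text \<open>The tested identity on (r, r + h], divided by h: the left side tends to f r minus a
  constant at almost every r, and the right side to an explicit integral of g. The right side is the
  representative \<open>\<Phi>\<close>, and differences of \<open>\<Phi>\<close> are integrals of
  g.\<close>

lemma weak_deriv_primitive:
  assumes wd: "weak_deriv f g"
  obtains \<Phi> where "AE x in lborel. f x = \<Phi> x"
    "\<And>x y. x \<le> y \<Longrightarrow> \<Phi> y - \<Phi> x = (LBINT z. g z * indicator {x<..y} z)"
proof -
  obtain \<theta> \<eta> where \<theta>: "smooth_step \<theta>"
    and int\<eta>: "\<And>f. f \<in> borel_measurable lborel \<Longrightarrow> set_integrable lborel {-1..1} f \<Longrightarrow> integrable lborel (\<lambda>x. f x * \<eta> x)"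
    and tested: "\<And>f g r s. weak_deriv f g \<Longrightarrow> r < s \<Longrightarrow>
      (LBINT x. f x * (indicator {r<..s} x - (s - r) * \<eta> x)) =
      - (LBINT x. g x * (max 0 (x - r) - max 0 (x - s) - (s - r) * \<theta> x))"
    by (rule weak_deriv_tested) (rule that)
  have [measurable]: "\<theta> \<in> borel_measurable borel" and \<theta>0: "\<And>x. x \<le> 0 \<Longrightarrow> \<theta> x = 0"
    and \<theta>1: "\<And>x. x \<ge> 1 \<Longrightarrow> \<theta> x = 1" and \<theta>_bd: "\<And>x. 0 \<le> \<theta> x" "\<And>x. \<theta> x \<le> 1"
    using \<theta> by (auto simp: smooth_step_def)
  have fm: "f \<in> borel_measurable lborel" and gm: "g \<in> borel_measurable lborel"
    and fi: "\<And>r s. set_integrable lborel {r..s} f" and gi: "\<And>r s. set_integrable lborel {r..s} g"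
    using wd by (auto simp: weak_deriv_def)
  define C where "C = (LBINT x. f x * \<eta> x)"
  \<comment> \<open>g is only locally integrable, so its integral over (r, infinity) may not exist;
    subtracting the step leaves a kernel of bounded support.\<close>
  define \<Phi> where "\<Phi> r = C - (LBINT z. g z * (indicator {r<..} z - \<theta> z))" for r
  have int_step: "integrable lborel (\<lambda>z. g z * (indicator {r<..} z - \<theta> z))" for r
  proof (rule local_integrable_mult[OF gm gi[of "-(\<bar>r\<bar> + 1)"], where K = 1])
    show "\<bar>indicator {r<..} x - \<theta> x\<bar> \<le> 1" for x
      using \<theta>_bd[of x] by (auto simp: indicator_def)
    show "indicator {r<..} x - \<theta> x = 0" if "\<bar>x\<bar> > \<bar>r\<bar> + 1" for x
      using that \<theta>0[of x] \<theta>1[of x] by (auto simp: indicator_def)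
  qed measurable
  have "\<Phi> y - \<Phi> x = (LBINT z. g z * indicator {x<..y} z)" if "x \<le> y" for x y
  proof -
    have "\<Phi> y - \<Phi> x = (LBINT z. g z * (indicator {x<..} z - \<theta> z) - g z * (indicator {y<..} z - \<theta> z))"
      unfolding \<Phi>_def by (simp add: int_step)
    also have "\<dots> = (LBINT z. g z * indicator {x<..y} z)"
      using that by (intro Bochner_Integration.integral_cong refl) (auto simp: indicator_def algebra_simps)
    finally show ?thesis .
  qed
  moreover have "AE x in lborel. f x = \<Phi> x"
    using AE_averages_tendsto[OF fm fi]
  proof eventually_elim
    case (elim r)
    define h where "h n = inverse (real (Suc n))" for n
    have h: "0 < h n" "h n \<le> 1" for n by (auto simp: h_def field_simps)
    have h_lim: "h \<longlonglongrightarrow> 0" unfolding h_def[abs_def] by (rule LIMSEQ_inverse_real_of_nat)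
    define A where "A n = (LBINT y. f y * indicator {r<..r + h n} y)" for n
    \<comment> \<open>A ramp rising from 0 to 1 on (r, r + h n], minus the step. As h n tends to 0
      it becomes the kernel in \<open>\<Phi>\<close>.\<close>
    define k where "k n z = (max 0 (z - r) - max 0 (z - (r + h n))) / h n - \<theta> z" for n z
    have int_ind: "integrable lborel (\<lambda>y. f y * indicator {r<..r + h n} y)" for n
    proof (rule local_integrable_mult[OF fm fi[of "-(\<bar>r\<bar> + 1)"], where K = 1])
      show "indicator {r<..r + h n} x = (0::real)" if "\<bar>x\<bar> > \<bar>r\<bar> + 1" for x
        using that h[of n] by (auto simp: indicator_def)
    qed (auto simp: indicator_def)
    have eq: "A n / h n - C = - (LBINT z. g z * k n z)" for n
    proof -
      have "A n - h n * C = (LBINT x. f x * indicator {r<..r + h n} x - h n * (f x * \<eta> x))"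
        unfolding A_def C_def using int_ind int\<eta>[OF fm fi] by simp
      also have "\<dots> = (LBINT x. f x * (indicator {r<..r + h n} x - (r + h n - r) * \<eta> x))"
        by (intro Bochner_Integration.integral_cong) (auto simp: algebra_simps)
      also have "\<dots> = - (LBINT x. g x * (max 0 (x - r) - max 0 (x - (r + h n)) - (r + h n - r) * \<theta> x))"
        by (rule tested[OF wd]) (use h in simp)
      also have "\<dots> = - (LBINT x. h n * (g x * k n x))"
        using h[of n] by (intro arg_cong[of _ _ uminus] Bochner_Integration.integral_cong)
          (auto simp: k_def field_simps)
      also have "\<dots> = h n * - (LBINT z. g z * k n z)" by simp
      finally show ?thesis using h[of n] by (simp add: field_simps)
    qed
    have "(\<lambda>n. LBINT z. g z * k n z) \<longlonglongrightarrow> (LBINT z. g z * (indicator {r<..} z - \<theta> z))"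
    proof (rule local_dominated_convergence(1)[OF gm gi[of "-(\<bar>r\<bar> + 2)"], where K = 1])
      show "k n \<in> borel_measurable borel" for n unfolding k_def[abs_def] by measurable
      show "\<bar>k n x\<bar> \<le> 1" for n x
      proof -
        have "0 \<le> (max 0 (x - r) - max 0 (x - (r + h n))) / h n"
          using h[of n] by (auto simp: max_def)
        moreover have "(max 0 (x - r) - max 0 (x - (r + h n))) / h n \<le> 1"
          using h[of n] by (auto simp: max_def field_simps)
        ultimately show ?thesis using \<theta>_bd[of x] unfolding k_def by linarith
      qed
      show "k n x = 0" if "\<bar>x\<bar> > \<bar>r\<bar> + 2" for n x
      proof (cases "x > 0")
        case True
        then have "max 0 (x - r) - max 0 (x - (r + h n)) = h n" "x \<ge> 1"
          using that h[of n] by (auto simp: max_def)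
        then show ?thesis using h[of n] \<theta>1 by (simp add: k_def)
      next
        case False
        then have "max 0 (x - r) - max 0 (x - (r + h n)) = 0" "x \<le> 0"
          using that h[of n] by (auto simp: max_def)
        then show ?thesis using \<theta>0 by (simp add: k_def)
      qed
      show "(\<lambda>n. k n x) \<longlonglongrightarrow> indicator {r<..} x - \<theta> x" for x
      proof (cases "x > r")
        case True
        have "\<forall>\<^sub>F n in sequentially. h n < x - r" using order_tendstoD(2)[OF h_lim, of "x - r"] True by simp
        then have "\<forall>\<^sub>F n in sequentially. 1 - \<theta> x = k n x"
        proof eventually_elim
          case (elim n)
          then have "max 0 (x - r) - max 0 (x - (r + h n)) = h n" using True by (auto simp: max_def)
          then show ?case using h[of n] by (simp add: k_def)
        qed
        from Lim_transform_eventually[OF tendsto_const this] show ?thesis using True by simp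
      next
        case False
        then have "k n x = - \<theta> x" for n using h[of n] by (simp add: k_def max_def)
        with False show ?thesis by simp
      qed
    qed
    then have "(\<lambda>n. A n / h n - C) \<longlonglongrightarrow> - (LBINT z. g z * (indicator {r<..} z - \<theta> z))"
      unfolding eq by (rule tendsto_minus)
    moreover have "(\<lambda>n. A n / h n - C) \<longlonglongrightarrow> f r - C"
      using elim by (intro tendsto_diff tendsto_const) (simp add: A_def h_def divide_inverse mult.commute)
    ultimately have "f r - C = - (LBINT z. g z * (indicator {r<..} z - \<theta> z))"
      using LIMSEQ_unique by blast
    then show ?case by (simp add: \<Phi>_def)
  qed
  ultimately show ?thesis using that by blast
qed

text \<open>Recovers g from f pointwise, which yields uniqueness of the weak derivative.\<close>

lemma weak_deriv_AE_quotients: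
  assumes wd: "weak_deriv f g"
  shows "AE x in lborel. (\<lambda>n. real (Suc n) * (f (x + inverse (real (Suc n))) - f x)) \<longlonglongrightarrow> g x"
proof -
  obtain \<Phi> where \<Phi>: "AE x in lborel. f x = \<Phi> x"
    "\<And>x y. x \<le> y \<Longrightarrow> \<Phi> y - \<Phi> x = (LBINT z. g z * indicator {x<..y} z)"
    by (rule weak_deriv_primitive[OF wd]) (rule that)
  \<comment> \<open>Only countably many translates of the exceptional set are discarded; this is why
    the increments run through a sequence.\<close>
  have "AE x in lborel. \<forall>n. f (x + inverse (real (Suc n))) = \<Phi> (x + inverse (real (Suc n)))"
    unfolding AE_all_countable using AE_lborel_shift[OF \<Phi>(1)] by blast
  moreover have "AE x in lborel.
    (\<lambda>n. real (Suc n) * (LBINT y. g y * indicator {x<..x + inverse (real (Suc n))} y)) \<longlonglongrightarrow> g x"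
    using wd by (intro AE_averages_tendsto) (auto simp: weak_deriv_def)
  ultimately show ?thesis using \<Phi>(1)
  proof eventually_elim
    case (elim x)
    have "f (x + inverse (real (Suc n))) - f x = (LBINT y. g y * indicator {x<..x + inverse (real (Suc n))} y)" for n
      using elim(1,3) \<Phi>(2)[of x "x + inverse (real (Suc n))"] by simp
    then show ?case using elim(2) by (simp del: of_nat_Suc)
  qed
qed

lemma weak_deriv_unique:
  assumes "weak_deriv f g" "weak_deriv f g'"
  shows "AE x in lborel. g x = g' x"
  using weak_deriv_AE_quotients[OF assms(1)] weak_deriv_AE_quotients[OF assms(2)]
  by eventually_elim (rule LIMSEQ_unique)

lemma ip_indicator: "ip (indicator {r<..s}) g = (LBINT x. g x * indicator {r<..s} x)"
  for g :: "real \<Rightarrow> real"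
  by (simp add: ip_def mult.commute)

lemma square_int_indicator: "square_int (indicator {r<..s} :: real \<Rightarrow> real)"
proof -
  have "integrable lborel (indicator {r<..s} :: real \<Rightarrow> real)"
    by (cases "r \<le> s") (auto intro!: integrable_real_indicator)
  moreover have "(\<lambda>x. (indicator {r<..s} x :: real) \<bullet> indicator {r<..s} x) = indicator {r<..s}"
    by (rule ext) (simp add: indicator_def)
  ultimately show ?thesis by (simp only: square_int_def) simp
qed

lemma ip_indicator_self:
  assumes "r \<le> s"
  shows "ip (indicator {r<..s}) (indicator {r<..s} :: real \<Rightarrow> real) = s - r"
proof -
  have "ip (indicator {r<..s}) (indicator {r<..s} :: real \<Rightarrow> real) = (LBINT x. indicator {r<..s} x)"
    unfolding ip_def by (intro Bochner_Integration.integral_cong) (auto simp: indicator_def)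
  then show ?thesis using assms by simp
qed

text \<open>Cauchy-Schwarz for the primitive gives Hoelder continuity of exponent 1/2, and averaging
  over (x, x + d] keeps the bound. The exceptional set does not depend on d, so d may be chosen
  after x.\<close>

lemma weak_deriv_average_close:
  assumes wd: "weak_deriv f g" and g: "square_int g"
  shows "AE x in lborel. \<forall>d>0. \<bar>f x - ip (indicator {x<..x + d}) f / d\<bar> \<le> sqrt d * sqrt (nsq g)"
proof -
  obtain \<Phi> where \<Phi>: "AE x in lborel. f x = \<Phi> x"
    "\<And>x y. x \<le> y \<Longrightarrow> \<Phi> y - \<Phi> x = (LBINT z. g z * indicator {x<..y} z)"
    by (rule weak_deriv_primitive[OF wd]) (rule that)
  have hoelder: "\<bar>\<Phi> x - \<Phi> y\<bar> \<le> sqrt (y - x) * sqrt (nsq g)" if "x \<le> y" for x y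
    using abs_ip_le[OF square_int_indicator[of x y] g] 
    unfolding ip_indicator_self[OF that] ip_indicator[of x y g] \<Phi>(2)[OF that, symmetric]
      abs_minus_commute[of "\<Phi> y"] .
  have fm: "f \<in> borel_measurable lborel" and fi: "\<And>r s. set_integrable lborel {r..s} f"
    using wd by (auto simp: weak_deriv_def)
  show ?thesis
    using \<Phi>(1)
  proof eventually_elim
    case (elim x)
    show ?case
    proof (intro allI impI)
      fix d :: real assume d: "d > 0"
      let ?i = "indicator {x<..x + d} :: real \<Rightarrow> real"
      have int_f: "integrable lborel (\<lambda>y. f y * ?i y)"
      proof (rule local_integrable_mult[OF fm fi[of "-(\<bar>x\<bar> + d)"], where K = 1])
        show "?i z = 0" if "\<bar>z\<bar> > \<bar>x\<bar> + d" for z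
          using that d by (auto simp: indicator_def)
      qed (auto simp: indicator_def)
      have int_i: "integrable lborel (\<lambda>y. c * ?i y)" for c
        using d by (intro integrable_mult_right integrable_real_indicator) auto
      have eq: "f x * d - ip ?i f = (LBINT y. f x * ?i y - f y * ?i y)"
        unfolding ip_indicator Bochner_Integration.integral_diff[OF int_i int_f] using d by simp
      have "\<bar>f x * d - ip ?i f\<bar> \<le> (LBINT y. norm (f x * ?i y - f y * ?i y))"
        unfolding eq using integral_norm_bound[of lborel "\<lambda>y. f x * ?i y - f y * ?i y"] by simp
      also have "\<dots> \<le> (LBINT y. (sqrt d * sqrt (nsq g)) * ?i y)"
      proof (rule integral_mono_AE)
        show "AE y in lborel. norm (f x * ?i y - f y * ?i y) \<le> (sqrt d * sqrt (nsq g)) * ?i y"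
          using \<Phi>(1)
        proof eventually_elim
          case (elim y)
          show ?case
          proof (cases "y \<in> {x<..x + d}")
            case True
            then have "\<bar>\<Phi> x - \<Phi> y\<bar> \<le> sqrt (y - x) * sqrt (nsq g)" by (intro hoelder) simp
            also have "\<dots> \<le> sqrt d * sqrt (nsq g)"
              using True by (intro mult_right_mono) (auto simp: ip_self_nonneg)
            finally show ?thesis using True elim \<open>f x = \<Phi> x\<close> by simp
          qed (simp add: ip_self_nonneg)
        qed
      qed (intro integrable_norm Bochner_Integration.integrable_diff int_f int_i)+
      also have "\<dots> = (sqrt d * sqrt (nsq g)) * d" using d by simp
      finally have le: "\<bar>f x * d - ip ?i f\<bar> \<le> (sqrt d * sqrt (nsq g)) * d" .
      have "f x - ip ?i f / d = (f x * d - ip ?i f) / d" using d by (simp add: field_simps)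
      then have "\<bar>f x - ip ?i f / d\<bar> = \<bar>f x * d - ip ?i f\<bar> / d" using d by (simp only: abs_divide abs_of_pos)
      with le show "\<bar>f x - ip ?i f / d\<bar> \<le> sqrt d * sqrt (nsq g)"
        using d by (simp only: pos_divide_le_eq)
    qed
  qed
qed

section \<open>Test functions and the stability of weak derivatives\<close>

lemma test_fun_bounds:
  assumes "test_fun \<phi>"
  obtains R K where "\<phi> \<in> borel_measurable borel" "deriv \<phi> \<in> borel_measurable borel"
    "\<And>x. \<bar>\<phi> x\<bar> \<le> K" "\<And>x. \<bar>deriv \<phi> x\<bar> \<le> K"
    "\<And>x. \<bar>x\<bar> > R \<Longrightarrow> \<phi> x = 0" "\<And>x. \<bar>x\<bar> > R \<Longrightarrow> deriv \<phi> x = 0"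
proof -
  obtain D :: "nat \<Rightarrow> real \<Rightarrow> real" and R where D: "D 0 = \<phi>"
    "\<And>k x. (D k has_real_derivative D (Suc k) x) (at x)" and R: "\<And>x. \<bar>x\<bar> > R \<Longrightarrow> \<phi> x = 0"
    using assms by (auto simp: test_fun_def)
  have deriv_eq: "deriv \<phi> = D 1"
    using D(2)[of 0] by (auto simp: D(1) intro!: ext DERIV_imp_deriv)
  have cont: "continuous_on UNIV (D k)" for k by (intro DERIV_continuous_on[OF D(2)])
  have cont': "continuous_on UNIV \<phi>" "continuous_on UNIV (deriv \<phi>)"
    using cont[of 0] cont[of 1] by (auto simp: D(1) deriv_eq)
  have zero': "deriv \<phi> x = 0" if "\<bar>x\<bar> > R" for x
  proof -
    have "open {x. \<bar>x\<bar> > R}" by (intro open_Collect_less continuous_intros)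
    then have "(\<phi> has_real_derivative 0) (at x)"
      using that R by (intro has_field_derivative_transform_within_open[OF DERIV_const, of "{x. \<bar>x\<bar> > R}" x 0 \<phi>]) auto
    then show ?thesis by (rule DERIV_imp_deriv)
  qed
  have bounded: "\<exists>K. \<forall>x. \<bar>f x\<bar> \<le> K" if "continuous_on UNIV f" "\<And>x. \<bar>x\<bar> > R \<Longrightarrow> f x = 0"
    for f :: "real \<Rightarrow> real"
  proof -
    have "compact (f ` {-R..R})"
      by (intro compact_continuous_image continuous_on_subset[OF that(1)]) auto
    then have "bounded (f ` {-R..R})" by (rule compact_imp_bounded)
    then obtain K where K: "\<forall>y\<in>f ` {-R..R}. norm y \<le> K" by (auto simp only: bounded_iff)
    have "\<bar>f x\<bar> \<le> max K 0" for x
    proof (cases "\<bar>x\<bar> > R")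
      case False
      then have "x \<in> {-R..R}" by auto
      with K have "\<bar>f x\<bar> \<le> K" by auto
      then show ?thesis by simp
    qed (simp add: that)
    then show ?thesis by blast
  qed
  obtain K1 where K1: "\<And>x. \<bar>\<phi> x\<bar> \<le> K1" using bounded[OF cont'(1) R] by blast
  obtain K2 where K2: "\<And>x. \<bar>deriv \<phi> x\<bar> \<le> K2" using bounded[OF cont'(2) zero'] by blast
  show ?thesis
  proof (rule that[of "max K1 K2" R])
    show "\<bar>\<phi> x\<bar> \<le> max K1 K2" for x using K1[of x] by simp
    show "\<bar>deriv \<phi> x\<bar> \<le> max K1 K2" for x using K2[of x] by simp
  qed (use R zero' cont' in \<open>auto intro: borel_measurable_continuous_onI\<close>)
qed

lemma test_fun_integrable:
  assumes "f \<in> borel_measurable lborel" "\<And>r s. set_integrable lborel {r..s} f" "test_fun \<phi>"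
  shows "integrable lborel (\<lambda>x. f x * \<phi> x)" "integrable lborel (\<lambda>x. f x * deriv \<phi> x)"
proof -
  obtain R K where \<phi>: "\<phi> \<in> borel_measurable borel" "deriv \<phi> \<in> borel_measurable borel"
    "\<And>x. \<bar>\<phi> x\<bar> \<le> K" "\<And>x. \<bar>deriv \<phi> x\<bar> \<le> K"
    "\<And>x. \<bar>x\<bar> > R \<Longrightarrow> \<phi> x = 0" "\<And>x. \<bar>x\<bar> > R \<Longrightarrow> deriv \<phi> x = 0"
    by (rule test_fun_bounds[OF assms(3)]) (rule that)
  show "integrable lborel (\<lambda>x. f x * \<phi> x)"
    by (rule local_integrable_mult[OF assms(1) assms(2)[of "-R" R] \<phi>(1,3,5)])
  show "integrable lborel (\<lambda>x. f x * deriv \<phi> x)"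
    by (rule local_integrable_mult[OF assms(1) assms(2)[of "-R" R] \<phi>(2,4,6)])
qed

lemma test_fun_square_int:
  assumes "test_fun \<phi>"
  shows "square_int \<phi>" "square_int (deriv \<phi>)"
proof -
  obtain R K where \<phi>: "\<phi> \<in> borel_measurable borel" "deriv \<phi> \<in> borel_measurable borel"
    "\<And>x. \<bar>\<phi> x\<bar> \<le> K" "\<And>x. \<bar>deriv \<phi> x\<bar> \<le> K"
    "\<And>x. \<bar>x\<bar> > R \<Longrightarrow> \<phi> x = 0" "\<And>x. \<bar>x\<bar> > R \<Longrightarrow> deriv \<phi> x = 0"
    by (rule test_fun_bounds[OF assms(1)]) (rule that)
  have loc: "set_integrable lborel {-R..R} f" if "f \<in> borel_measurable borel" "\<And>x. \<bar>f x\<bar> \<le> K" for f :: "real \<Rightarrow> real"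
    unfolding set_integrable_def
  proof (rule Bochner_Integration.integrable_bound[of _ "\<lambda>x. K * indicator {-R..R} x"])
    show "integrable lborel (\<lambda>x. K * indicator {-R..R} x)"
      by (intro integrable_mult_right integrable_real_indicator) (cases "-R \<le> R"; simp)+
  qed (use that in \<open>auto simp: indicator_def intro: order_trans[OF _ abs_ge_self]\<close>)
  show "square_int \<phi>"
    unfolding square_int_def inner_real_def
    using local_integrable_mult[OF _ loc[OF \<phi>(1,3)] \<phi>(1,3,5)] \<phi>(1) by simp
  show "square_int (deriv \<phi>)"
    unfolding square_int_def inner_real_def
    using local_integrable_mult[OF _ loc[OF \<phi>(2,4)] \<phi>(2,4,6)] \<phi>(2) by simp
qed

lemma weak_deriv_lincomb:
  assumes "weak_deriv f g" "weak_deriv f' g'"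
  shows "weak_deriv (\<lambda>x. a * f x + b * f' x) (\<lambda>x. a * g x + b * g' x)"
proof -
  have m: "f \<in> borel_measurable lborel" "g \<in> borel_measurable lborel"
     "f' \<in> borel_measurable lborel" "g' \<in> borel_measurable lborel"
    and i: "\<And>r s. set_integrable lborel {r..s} f" "\<And>r s. set_integrable lborel {r..s} g"
     "\<And>r s. set_integrable lborel {r..s} f'" "\<And>r s. set_integrable lborel {r..s} g'"
    and eq: "\<And>\<phi>. test_fun \<phi> \<Longrightarrow> (LBINT x. f x * deriv \<phi> x) = - (LBINT x. g x * \<phi> x)"
     "\<And>\<phi>. test_fun \<phi> \<Longrightarrow> (LBINT x. f' x * deriv \<phi> x) = - (LBINT x. g' x * \<phi> x)"
    using assms by (auto simp: weak_deriv_def)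
  note [measurable] = m
  have lin: "(LBINT x. (a * u x + b * u' x) * k x) = a * (LBINT x. u x * k x) + b * (LBINT x. u' x * k x)"
    if "integrable lborel (\<lambda>x. u x * k x)" "integrable lborel (\<lambda>x. u' x * k x)" for u u' k :: "real \<Rightarrow> real"
  proof -
    have "(LBINT x. (a * u x + b * u' x) * k x) = (LBINT x. a * (u x * k x) + b * (u' x * k x))"
      by (simp add: algebra_simps)
    then show ?thesis using that by simp
  qed
  show ?thesis
    unfolding weak_deriv_def
  proof (intro conjI allI impI)
    fix r s :: real
    show "set_integrable lborel {r..s} (\<lambda>x. a * f x + b * f' x)"
      using i by (intro set_integral_add set_integrable_mult_right) auto
    show "set_integrable lborel {r..s} (\<lambda>x. a * g x + b * g' x)"
      using i by (intro set_integral_add set_integrable_mult_right) auto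
  next
    fix \<phi> assume t: "test_fun \<phi>"
    show "(LBINT x. (a * f x + b * f' x) * deriv \<phi> x) = - (LBINT x. (a * g x + b * g' x) * \<phi> x)"
      using eq[OF t] lin[OF test_fun_integrable(2)[OF m(1) i(1) t] test_fun_integrable(2)[OF m(3) i(3) t]]
        lin[OF test_fun_integrable(1)[OF m(2) i(2) t] test_fun_integrable(1)[OF m(4) i(4) t]] by simp
  qed measurable
qed

text \<open>A translate of a test function is a test function, so the shift is moved from f and g
  onto \<open>\<phi>\<close>.\<close>

lemma weak_deriv_shift:
  assumes "weak_deriv f g"
  shows "weak_deriv (\<lambda>x. f (x + y)) (\<lambda>x. g (x + y))"
proof -
  have m [measurable]: "f \<in> borel_measurable borel" "g \<in> borel_measurable borel"
    and i: "\<And>r s. set_integrable lborel {r..s} f" "\<And>r s. set_integrable lborel {r..s} g"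
    and eq: "\<And>\<phi>. test_fun \<phi> \<Longrightarrow> (LBINT x. f x * deriv \<phi> x) = - (LBINT x. g x * \<phi> x)"
    using assms by (auto simp: weak_deriv_def)
  have si: "set_integrable lborel {r..s} (\<lambda>x. u (x + y))" if "\<And>r s. set_integrable lborel {r..s} u" for u :: "real \<Rightarrow> real" and r s
  proof -
    have "integrable lborel (\<lambda>x. indicator {r + y..s + y} (x + y) *\<^sub>R u (x + y))"
      using that[of "r + y" "s + y"] lborel_integrable_shift_iff[of "\<lambda>x. indicator {r + y..s + y} x *\<^sub>R u x" y]
      by (simp add: set_integrable_def)
    moreover have "indicator {r + y..s + y} (x + y) = (indicator {r..s} x :: real)" for x
      by (auto simp: indicator_def)
    ultimately show ?thesis by (simp add: set_integrable_def)
  qed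
  show ?thesis
    unfolding weak_deriv_def
  proof (intro conjI allI impI)
    fix \<phi> assume t: "test_fun \<phi>"
    then obtain D :: "nat \<Rightarrow> real \<Rightarrow> real" and R where D: "D 0 = \<phi>"
      "\<And>k x. (D k has_real_derivative D (Suc k) x) (at x)" and R: "\<And>x. \<bar>x\<bar> > R \<Longrightarrow> \<phi> x = 0"
      by (auto simp: test_fun_def)
    have D': "((\<lambda>x. D k (x - y)) has_real_derivative D (Suc k) (x - y)) (at x)" for k x
      using D(2)[of k "x - y"] DERIV_shift[of "D k" "D (Suc k) (x - y)" x "- y"] by simp
    have t': "test_fun (\<lambda>x. \<phi> (x - y))"
      unfolding test_fun_def
    proof (intro conjI exI allI impI)
      show "(\<lambda>x. D 0 (x - y)) = (\<lambda>x. \<phi> (x - y))" by (simp add: D(1))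
      show "((\<lambda>x. D k (x - y)) has_real_derivative D (Suc k) (x - y)) (at x)" for k x by (rule D')
      show "\<phi> (x - y) = 0" if "\<bar>x\<bar> > R + \<bar>y\<bar>" for x using that by (intro R) auto
    qed
    have d: "deriv \<phi> x = D 1 x" "deriv (\<lambda>x. \<phi> (x - y)) x = D 1 (x - y)" for x
      using DERIV_imp_deriv[OF D(2)[of 0 x]] DERIV_imp_deriv[OF D'[of 0 x]] by (auto simp: D(1))
    have "(LBINT x. f (x + y) * deriv \<phi> x) = (LBINT x. f x * deriv (\<lambda>x. \<phi> (x - y)) x)"
      using lborel_integral_shift[of "\<lambda>x. f x * deriv (\<lambda>x. \<phi> (x - y)) x" y] by (simp add: d)
    also have "\<dots> = - (LBINT x. g x * \<phi> (x - y))" by (rule eq[OF t'])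
    also have "\<dots> = - (LBINT x. g (x + y) * \<phi> x)"
      using lborel_integral_shift[of "\<lambda>x. g x * \<phi> (x - y)" y] by simp
    finally show "(LBINT x. f (x + y) * deriv \<phi> x) = - (LBINT x. g (x + y) * \<phi> x)" .
  qed (auto intro: si i)
qed

lemma weak_deriv_cong_AE:
  assumes "weak_deriv f g" "AE x in lborel. f x = f' x" "AE x in lborel. g x = g' x"
    and [measurable]: "f' \<in> borel_measurable lborel" "g' \<in> borel_measurable lborel"
  shows "weak_deriv f' g'"
proof -
  have m [measurable]: "f \<in> borel_measurable borel" "g \<in> borel_measurable borel"
    and i: "\<And>r s. set_integrable lborel {r..s} f" "\<And>r s. set_integrable lborel {r..s} g"
    and eq: "\<And>\<phi>. test_fun \<phi> \<Longrightarrow> (LBINT x. f x * deriv \<phi> x) = - (LBINT x. g x * \<phi> x)"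
    using assms by (auto simp: weak_deriv_def)
  show ?thesis
    unfolding weak_deriv_def
  proof (intro conjI allI impI)
    fix r s :: real
    show "set_integrable lborel {r..s} f'"
      using i(1)[of r s] assms(2) unfolding set_integrable_def
      by (subst integrable_cong_AE[of _ _ "\<lambda>x. indicator {r..s} x *\<^sub>R f x"]) auto
    show "set_integrable lborel {r..s} g'"
      using i(2)[of r s] assms(3) unfolding set_integrable_def
      by (subst integrable_cong_AE[of _ _ "\<lambda>x. indicator {r..s} x *\<^sub>R g x"]) auto
  next
    fix \<phi> assume t: "test_fun \<phi>"
    have [measurable]: "\<phi> \<in> borel_measurable borel" "deriv \<phi> \<in> borel_measurable borel"
      using test_fun_square_int[OF t] by (auto simp: square_int_def)
    have "(LBINT x. f' x * deriv \<phi> x) = (LBINT x. f x * deriv \<phi> x)"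
      using assms(2) by (intro integral_cong_AE) auto
    moreover have "(LBINT x. g' x * \<phi> x) = (LBINT x. g x * \<phi> x)"
      using assms(3) by (intro integral_cong_AE) auto
    ultimately show "(LBINT x. f' x * deriv \<phi> x) = - (LBINT x. g' x * \<phi> x)"
      using eq[OF t] by simp
  qed auto
qed

lemma square_int_set_integrable:
  fixes f :: "real \<Rightarrow> real"
  assumes f: "square_int f"
  shows "set_integrable lborel {r..s} f"
proof -
  have "integrable lborel (\<lambda>x. norm (indicator {r - 1<..s} x :: real) * norm (f x))"
    by (rule integrable_norm_mult_square_int[OF square_int_indicator f])
  then show ?thesis
    unfolding set_integrable_def
  proof (rule Bochner_Integration.integrable_bound)
    have [measurable]: "f \<in> borel_measurable lborel" using f by (rule square_int_measurable)
    show "(\<lambda>x. indicator {r..s} x *\<^sub>R f x) \<in> borel_measurable lborel" by measurable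
  qed (auto simp: indicator_def)
qed

text \<open>Both sides of the weak formulation are L2 pairings with a test function or its
  derivative, so they pass to weak limits.\<close>

lemma weak_deriv_weak_limit:
  fixes f g :: "real \<Rightarrow> real"
  assumes wd: "\<And>n. weak_deriv (fs n) (gs n)"
    and f: "square_int f" "\<And>\<phi>. square_int \<phi> \<Longrightarrow> (\<lambda>n. ip \<phi> (fs n)) \<longlonglongrightarrow> ip \<phi> f"
    and g: "square_int g" "\<And>\<phi>. square_int \<phi> \<Longrightarrow> (\<lambda>n. ip \<phi> (gs n)) \<longlonglongrightarrow> ip \<phi> g"
  shows "weak_deriv f g"
  unfolding weak_deriv_def
proof (intro conjI allI impI)
  fix \<phi> assume t: "test_fun \<phi>"
  have "ip (deriv \<phi>) (fs n) = - ip \<phi> (gs n)" for n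
    using wd[of n] t by (simp add: weak_deriv_def ip_def mult.commute)
  then have "(\<lambda>n. - ip \<phi> (gs n)) \<longlonglongrightarrow> ip (deriv \<phi>) f"
    using f(2)[OF test_fun_square_int(2)[OF t]] by simp
  moreover have "(\<lambda>n. - ip \<phi> (gs n)) \<longlonglongrightarrow> - ip \<phi> g"
    using g(2)[OF test_fun_square_int(1)[OF t]] by (rule tendsto_minus)
  ultimately have "ip (deriv \<phi>) f = - ip \<phi> g" by (rule LIMSEQ_unique)
  then show "(LBINT x. f x * deriv \<phi> x) = - (LBINT x. g x * \<phi> x)"
    by (simp add: ip_def mult.commute)
qed (rule square_int_measurable[OF f(1)] square_int_measurable[OF g(1)]
    square_int_set_integrable[OF f(1)] square_int_set_integrable[OF g(1)])+

text \<open>The derivatives are arguments because \<open>wd\<close> is a choice among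
  representatives: a sum, translate or limit of chosen derivatives need not be the chosen derivative
  of the sum, translate or limit.\<close>

definition H2_triple :: "(real \<Rightarrow> real) \<Rightarrow> (real \<Rightarrow> real) \<Rightarrow> (real \<Rightarrow> real) \<Rightarrow> bool" where
  "H2_triple f g h \<longleftrightarrow> square_int f \<and> square_int g \<and> square_int h \<and> weak_deriv f g \<and> weak_deriv g h"

lemma H2_triple_imp_H2: "H2_triple f g h \<Longrightarrow> H2 f"
  by (auto simp: H2_triple_def H2_def L2_iff_square_int)

lemma wd_properties:
  assumes "square_int g" "weak_deriv f g"
  shows "square_int (wd f)" "weak_deriv f (wd f)" "AE x in lborel. wd f x = g x"
proof -
  have "L2 (wd f) \<and> weak_deriv f (wd f)"
    unfolding wd_def by (rule someI[of _ g]) (use assms in \<open>simp add: L2_iff_square_int\<close>)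
  then show 1: "square_int (wd f)" and 2: "weak_deriv f (wd f)" by (auto simp: L2_iff_square_int)
  show "AE x in lborel. wd f x = g x" by (rule weak_deriv_unique[OF 2 assms(2)])
qed

text \<open>\<open>wd2\<close> iterates the choice, so h must first be recognised as a weak
  derivative of \<open>wd f\<close>, which agrees with g almost everywhere.\<close>

lemma H2_triple_wd:
  assumes "H2_triple f g h"
  shows "H2_triple f (wd f) (wd2 f)" "AE x in lborel. wd f x = g x" "AE x in lborel. wd2 f x = h x"
proof -
  have a: "square_int f" "square_int g" "square_int h" "weak_deriv f g" "weak_deriv g h"
    using assms by (auto simp: H2_triple_def)
  note w = wd_properties[OF a(2,4)]
  have "weak_deriv (wd f) h"
    by (rule weak_deriv_cong_AE[OF a(5)]) (use w(1,3) a(3) in \<open>auto simp: square_int_def\<close>)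
  note w2 = wd_properties[OF a(3) this]
  show "H2_triple f (wd f) (wd2 f)" "AE x in lborel. wd f x = g x" "AE x in lborel. wd2 f x = h x"
    using a w w2 by (auto simp: H2_triple_def wd2_def)
qed

lemma H2_iff_triple: "H2 f \<longleftrightarrow> H2_triple f (wd f) (wd2 f)"
proof
  assume "H2 f"
  then obtain g h where "H2_triple f g h" by (auto simp: H2_def H2_triple_def L2_iff_square_int)
  then show "H2_triple f (wd f) (wd2 f)" by (rule H2_triple_wd)
qed (rule H2_triple_imp_H2)

lemma H2_triple_lincomb:
  assumes "H2_triple f g h" "H2_triple f' g' h'"
  shows "H2_triple (\<lambda>x. a * f x + b * f' x) (\<lambda>x. a * g x + b * g' x) (\<lambda>x. a * h x + b * h' x)"
proof -
  have "square_int (\<lambda>x. a * u x + b * u' x)" if "square_int u" "square_int u'" for u u' :: "real \<Rightarrow> real"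
    using square_int_add[OF square_int_scaleR[OF that(1), of a] square_int_scaleR[OF that(2), of b]] by simp
  with assms show ?thesis
    unfolding H2_triple_def by (intro conjI weak_deriv_lincomb) auto
qed

lemma square_int_shift:
  assumes "square_int f"
  shows "square_int (\<lambda>x. f (x + y))"
  using assms lborel_integrable_shift_iff[of "\<lambda>x. f x \<bullet> f x" y] by (auto simp: square_int_def)

lemma H2_triple_shift:
  "H2_triple f g h \<Longrightarrow> H2_triple (\<lambda>x. f (x + y)) (\<lambda>x. g (x + y)) (\<lambda>x. h (x + y))"
  unfolding H2_triple_def by (intro conjI weak_deriv_shift square_int_shift) auto

lemma H2_triple_weak_limit:
  assumes "\<And>n. H2_triple (fs n) (gs n) (hs n)" "square_int f" "square_int g" "square_int h"
    "\<And>\<phi>. square_int \<phi> \<Longrightarrow> (\<lambda>n. ip \<phi> (fs n)) \<longlonglongrightarrow> ip \<phi> f"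
    "\<And>\<phi>. square_int \<phi> \<Longrightarrow> (\<lambda>n. ip \<phi> (gs n)) \<longlonglongrightarrow> ip \<phi> g"
    "\<And>\<phi>. square_int \<phi> \<Longrightarrow> (\<lambda>n. ip \<phi> (hs n)) \<longlonglongrightarrow> ip \<phi> h"
  shows "H2_triple f g h"
proof -
  have wd: "\<And>n. weak_deriv (fs n) (gs n)" "\<And>n. weak_deriv (gs n) (hs n)"
    using assms(1) by (auto simp: H2_triple_def)
  show ?thesis
    unfolding H2_triple_def
    using weak_deriv_weak_limit[OF wd(1) assms(2,5,3,6)] weak_deriv_weak_limit[OF wd(2) assms(3,6,4,7)] assms(2-4)
    by blast
qed

section \<open>Pairs of functions of class $H^2$\<close>

text \<open>The jet (psi, psi', v, v') followed by psi'' and v''. The nonlinearity sees the first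
  factor only, the quadratic form all six components.\<close>

type_synonym state = "(real^4) \<times> real \<times> real"

definition H2_states :: "(real \<Rightarrow> state) set" where
  "H2_states = {Z. H2_triple (\<lambda>x. fst (Z x) $ 1) (\<lambda>x. fst (Z x) $ 2) (\<lambda>x. fst (snd (Z x))) \<and>
                   H2_triple (\<lambda>x. fst (Z x) $ 3) (\<lambda>x. fst (Z x) $ 4) (\<lambda>x. snd (snd (Z x)))}"

definition state :: "(real \<Rightarrow> real) \<Rightarrow> (real \<Rightarrow> real) \<Rightarrow> real \<Rightarrow> state" where
  "state \<psi> v x = (jet \<psi> v x, wd2 \<psi> x, wd2 v x)"

lemma jet_nth: "jet \<psi> v x $ 1 = \<psi> x" "jet \<psi> v x $ 2 = wd \<psi> x" "jet \<psi> v x $ 3 = v x" "jet \<psi> v x $ 4 = wd v x"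
  unfolding jet_def vector_def by simp_all

lemma state_in_H2_states: "H2 \<psi> \<Longrightarrow> H2 v \<Longrightarrow> state \<psi> v \<in> H2_states"
  by (simp add: H2_states_def state_def jet_nth H2_iff_triple)

lemma state_eqI:
  fixes z z' :: state
  assumes "fst z $ 1 = fst z' $ 1" "fst z $ 2 = fst z' $ 2" "fst z $ 3 = fst z' $ 3" "fst z $ 4 = fst z' $ 4"
    "fst (snd z) = fst (snd z')" "snd (snd z) = snd (snd z')"
  shows "z = z'"
  using assms by (simp add: prod_eq_iff vec_eq_iff forall_4)

lemma H2_states_representative:
  assumes "Z \<in> H2_states"
  shows "H2 (\<lambda>x. fst (Z x) $ 1)" "H2 (\<lambda>x. fst (Z x) $ 3)"
    "AE x in lborel. state (\<lambda>x. fst (Z x) $ 1) (\<lambda>x. fst (Z x) $ 3) x = Z x"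
proof -
  have t: "H2_triple (\<lambda>x. fst (Z x) $ 1) (\<lambda>x. fst (Z x) $ 2) (\<lambda>x. fst (snd (Z x)))"
    "H2_triple (\<lambda>x. fst (Z x) $ 3) (\<lambda>x. fst (Z x) $ 4) (\<lambda>x. snd (snd (Z x)))"
    using assms by (auto simp: H2_states_def)
  show "H2 (\<lambda>x. fst (Z x) $ 1)" "H2 (\<lambda>x. fst (Z x) $ 3)" using t by (auto intro: H2_triple_imp_H2)
  show "AE x in lborel. state (\<lambda>x. fst (Z x) $ 1) (\<lambda>x. fst (Z x) $ 3) x = Z x"
    using H2_triple_wd(2,3)[OF t(1)] H2_triple_wd(2,3)[OF t(2)]
    by eventually_elim (rule state_eqI, simp_all add: state_def jet_nth)
qed

lemma H2_states_lincomb: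
  assumes "Z \<in> H2_states" "Z' \<in> H2_states"
  shows "(\<lambda>x. a *\<^sub>R Z x + b *\<^sub>R Z' x) \<in> H2_states"
  using assms unfolding H2_states_def mem_Collect_eq
  by (simp add: H2_triple_lincomb)

lemma H2_states_scaleR: "Z \<in> H2_states \<Longrightarrow> (\<lambda>x. a *\<^sub>R Z x) \<in> H2_states"
  using H2_states_lincomb[of Z Z a 0] by simp

lemma H2_states_diff: "Z \<in> H2_states \<Longrightarrow> Z' \<in> H2_states \<Longrightarrow> (\<lambda>x. Z x - Z' x) \<in> H2_states"
  using H2_states_lincomb[of Z Z' 1 "-1"] by simp

lemma H2_states_shift: "Z \<in> H2_states \<Longrightarrow> (\<lambda>x. Z (x + y)) \<in> H2_states"
  unfolding H2_states_def mem_Collect_eq by (intro conjI H2_triple_shift) auto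

text \<open>Components as inner products with fixed vectors: pairing a component with a scalar
  function is then pairing the whole state with a vector-valued one, so weak convergence of states
  gives it for components.\<close>

lemma state_nth_inner:
  fixes z :: state
  shows "fst z $ i = z \<bullet> (axis i 1, 0, 0)" "fst (snd z) = z \<bullet> (0, 1, 0)" "snd (snd z) = z \<bullet> (0, 0, 1)"
  by (simp_all add: inner_prod_def inner_axis)

lemma H2_states_square_int:
  assumes "Z \<in> H2_states"
  shows "square_int Z"
proof -
  have c: "square_int (\<lambda>x. fst (Z x) $ 1)" "square_int (\<lambda>x. fst (Z x) $ 2)" "square_int (\<lambda>x. fst (Z x) $ 3)"
    "square_int (\<lambda>x. fst (Z x) $ 4)" "square_int (\<lambda>x. fst (snd (Z x)))" "square_int (\<lambda>x. snd (snd (Z x)))"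
    using assms by (auto simp: H2_states_def H2_triple_def)
  have s: "square_int (\<lambda>x. f x *\<^sub>R b)" if "square_int f" for f and b :: state
    by (rule square_int_bounded_linear[OF bounded_linear_scaleR_left that])
  have "Z x = (((((fst (Z x) $ 1) *\<^sub>R (axis 1 1, 0, 0) + (fst (Z x) $ 2) *\<^sub>R (axis 2 1, 0, 0))
      + (fst (Z x) $ 3) *\<^sub>R (axis 3 1, 0, 0)) + (fst (Z x) $ 4) *\<^sub>R (axis 4 1, 0, 0))
      + fst (snd (Z x)) *\<^sub>R (0, 1, 0)) + snd (snd (Z x)) *\<^sub>R (0, 0, 1)" for x
    by (rule state_eqI) (simp_all add: axis_def)
  then show ?thesis
    using square_int_add[OF square_int_add[OF square_int_add[OF square_int_add[OF square_int_add[OF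
      s[OF c(1)] s[OF c(2)]] s[OF c(3)]] s[OF c(4)]] s[OF c(5)]] s[OF c(6)],
      of "(axis 1 1, 0, 0)" "(axis 2 1, 0, 0)" "(axis 3 1, 0, 0)" "(axis 4 1, 0, 0)" "(0, 1, 0)" "(0, 0, 1)"]
    by simp
qed

lemma ip_inner_const:
  fixes \<phi> :: "real \<Rightarrow> real"
  shows "ip \<phi> (\<lambda>x. Z x \<bullet> b) = ip (\<lambda>x. \<phi> x *\<^sub>R b) Z"
  by (simp add: ip_def inner_commute)

lemma square_int_inner_const: "square_int Z \<Longrightarrow> square_int (\<lambda>x. Z x \<bullet> b)"
  by (rule square_int_bounded_linear[OF bounded_linear_inner_left])

lemma ip_inner_const_tendsto:
  fixes \<phi> :: "real \<Rightarrow> real"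
  assumes "\<And>\<phi>. square_int \<phi> \<Longrightarrow> (\<lambda>n. ip \<phi> (Zs n)) \<longlonglongrightarrow> ip \<phi> Z" "square_int \<phi>"
  shows "(\<lambda>n. ip \<phi> (\<lambda>x. Zs n x \<bullet> b)) \<longlonglongrightarrow> ip \<phi> (\<lambda>x. Z x \<bullet> b)"
  unfolding ip_inner_const
  by (rule assms(1)[OF square_int_bounded_linear[OF bounded_linear_scaleR_left assms(2)]])

lemma H2_states_weak_limit:
  assumes Zs: "\<And>n. Zs n \<in> H2_states" and Z: "square_int Z"
    and lim: "\<And>\<phi>. square_int \<phi> \<Longrightarrow> (\<lambda>n. ip \<phi> (Zs n)) \<longlonglongrightarrow> ip \<phi> Z"
  shows "Z \<in> H2_states"
proof -
  have t: "\<And>n. H2_triple (\<lambda>x. fst (Zs n x) $ 1) (\<lambda>x. fst (Zs n x) $ 2) (\<lambda>x. fst (snd (Zs n x)))"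
    "\<And>n. H2_triple (\<lambda>x. fst (Zs n x) $ 3) (\<lambda>x. fst (Zs n x) $ 4) (\<lambda>x. snd (snd (Zs n x)))"
    using Zs by (auto simp: H2_states_def)
  note c = square_int_inner_const[OF Z] and l = ip_inner_const_tendsto[OF lim]
  show ?thesis
    unfolding H2_states_def mem_Collect_eq state_nth_inner
    by (intro conjI H2_triple_weak_limit[OF t(1)[unfolded state_nth_inner] c c c l l l]
        H2_triple_weak_limit[OF t(2)[unfolded state_nth_inner] c c c l l l])
qed

lemma ip_inner_const_self_le:
  assumes Z: "square_int Z" and b: "norm b \<le> 1"
  shows "nsq (\<lambda>x. Z x \<bullet> b) \<le> nsq Z"
  unfolding ip_def
proof (rule integral_mono)
  show "integrable lborel (\<lambda>x. (Z x \<bullet> b) \<bullet> (Z x \<bullet> b))" "integrable lborel (\<lambda>x. Z x \<bullet> Z x)"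
    by (intro integrable_inner_square_int square_int_inner_const Z)+
  fix x
  have "\<bar>Z x \<bullet> b\<bar> \<le> norm (Z x) * norm b" by (rule Cauchy_Schwarz_ineq2)
  also have "\<dots> \<le> norm (Z x) * 1" using b by (intro mult_left_mono) auto
  finally have "\<bar>Z x \<bullet> b\<bar>\<^sup>2 \<le> (norm (Z x))\<^sup>2" by (intro power_mono) auto
  then show "(Z x \<bullet> b) \<bullet> (Z x \<bullet> b) \<le> Z x \<bullet> Z x" unfolding power2_norm_eq_inner power2_abs by (simp add: power2_eq_square)
qed

section \<open>Pointwise control of jets by averages\<close>

definition jet_average :: "real \<Rightarrow> (real \<Rightarrow> state) \<Rightarrow> real \<Rightarrow> real^4" where
  "jet_average d Z x = (\<chi> i. ip (indicator {x<..x + d}) (\<lambda>y. fst (Z y) $ i) / d)"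

text \<open>The derivative of each jet component is again a component of the state; the vector b
  selects it. The factor 4 is the l1 bound over the four components.\<close>

lemma jet_average_close:
  assumes "Z \<in> H2_states"
  shows "AE x in lborel. \<forall>d>0. norm (fst (Z x) - jet_average d Z x) \<le> 4 * sqrt d * sqrt (nsq Z)"
proof -
  have Z: "square_int Z" using assms by (rule H2_states_square_int)
  have close: "AE x in lborel. \<forall>d>0. \<bar>(fst (Z x) - jet_average d Z x) $ i\<bar> \<le> sqrt d * sqrt (nsq Z)"
    if "weak_deriv (\<lambda>x. fst (Z x) $ i) (\<lambda>x. Z x \<bullet> b)" "norm b \<le> 1" for i b
    using weak_deriv_average_close[OF that(1) square_int_inner_const[OF Z]]
  proof eventually_elim
    case (elim x)
    show ?case
    proof (intro allI impI)
      fix d :: real assume d: "d > 0"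
      then have "\<bar>(fst (Z x) - jet_average d Z x) $ i\<bar> \<le> sqrt d * sqrt (nsq (\<lambda>x. Z x \<bullet> b))"
        using elim by (simp add: jet_average_def)
      also have "\<dots> \<le> sqrt d * sqrt (nsq Z)"
        using ip_inner_const_self_le[OF Z that(2)] d by (intro mult_left_mono) auto
      finally show "\<bar>(fst (Z x) - jet_average d Z x) $ i\<bar> \<le> sqrt d * sqrt (nsq Z)" .
    qed
  qed
  have w: "weak_deriv (\<lambda>x. fst (Z x) $ 1) (\<lambda>x. fst (Z x) $ 2)"
    "weak_deriv (\<lambda>x. fst (Z x) $ 2) (\<lambda>x. fst (snd (Z x)))"
    "weak_deriv (\<lambda>x. fst (Z x) $ 3) (\<lambda>x. fst (Z x) $ 4)"
    "weak_deriv (\<lambda>x. fst (Z x) $ 4) (\<lambda>x. snd (snd (Z x)))"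
    using assms by (auto simp: H2_states_def H2_triple_def)
  have "AE x in lborel. \<forall>i. \<forall>d>0. \<bar>(fst (Z x) - jet_average d Z x) $ i\<bar> \<le> sqrt d * sqrt (nsq Z)"
    unfolding forall_4 AE_conj_iff
    using close[of 1 "(axis 2 1, 0, 0)"] close[of 2 "(0, 1, 0)"] close[of 3 "(axis 4 1, 0, 0)"]
      close[of 4 "(0, 0, 1)"] w
    by (simp add: state_nth_inner[symmetric] norm_Pair)
  then show ?thesis
  proof eventually_elim
    case (elim x)
    show ?case
    proof (intro allI impI)
      fix d :: real assume d: "d > 0"
      have "norm (fst (Z x) - jet_average d Z x) \<le> (\<Sum>i\<in>UNIV. \<bar>(fst (Z x) - jet_average d Z x) $ i\<bar>)"
        by (rule norm_le_l1_cart)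
      also have "\<dots> \<le> (\<Sum>i\<in>(UNIV :: 4 set). sqrt d * sqrt (nsq Z))" using elim d by (intro sum_mono) blast
      finally show "norm (fst (Z x) - jet_average d Z x) \<le> 4 * sqrt d * sqrt (nsq Z)" by simp
    qed
  qed
qed

text \<open>The indicator has L2 norm sqrt d, and the average divides by d.\<close>

lemma jet_average_bound:
  assumes Z: "square_int Z" and d: "d > 0"
  shows "norm (jet_average d Z x) \<le> 4 / sqrt d * sqrt (nsq Z)"
proof -
  have "\<bar>jet_average d Z x $ i\<bar> \<le> 1 / sqrt d * sqrt (nsq Z)" for i
  proof -
    have "\<bar>ip (indicator {x<..x + d}) (\<lambda>y. Z y \<bullet> (axis i 1, 0, 0))\<bar> \<le>
        sqrt d * sqrt (nsq (\<lambda>y. Z y \<bullet> (axis i 1, 0, 0)))"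
      using abs_ip_le[OF square_int_indicator square_int_inner_const[OF Z], of x "x + d"]
        ip_indicator_self[of x "x + d"] d by simp
    also have "\<dots> \<le> sqrt d * sqrt (nsq Z)"
      using d by (intro mult_left_mono real_sqrt_le_mono ip_inner_const_self_le[OF Z]) (auto simp: norm_Pair)
    finally have "\<bar>ip (indicator {x<..x + d}) (\<lambda>y. Z y \<bullet> (axis i 1, 0, 0))\<bar> \<le> sqrt d * sqrt (nsq Z)" .
    then have "\<bar>ip (indicator {x<..x + d}) (\<lambda>y. Z y \<bullet> (axis i 1, 0, 0))\<bar> / d \<le> sqrt d * sqrt (nsq Z) / d"
      using d by (intro divide_right_mono) auto
    moreover have "sqrt d * sqrt (nsq Z) / d = 1 / sqrt d * sqrt (nsq Z)" using d by (simp add: field_simps)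
    ultimately show ?thesis using d by (simp add: jet_average_def state_nth_inner abs_divide)
  qed
  then have "(\<Sum>i\<in>UNIV. \<bar>jet_average d Z x $ i\<bar>) \<le> (\<Sum>i\<in>(UNIV :: 4 set). 1 / sqrt d * sqrt (nsq Z))"
    by (intro sum_mono)
  with norm_le_l1_cart[of "jet_average d Z x"] show ?thesis by simp
qed

lemma jet_average_shift: "jet_average d (\<lambda>x. Z (x + y)) 0 = jet_average d Z y"
proof -
  have "ip (indicator {0<..0 + d}) (\<lambda>x. fst (Z (x + y)) $ i) = ip (indicator {y<..y + d}) (\<lambda>x. fst (Z x) $ i)" for i
  proof -
    have "indicator {0<..0 + d} x = (indicator {y<..y + d} (x + y) :: real)" for x by (auto simp: indicator_def)
    then show ?thesis
      unfolding ip_def using lborel_integral_shift[of "\<lambda>x. indicator {y<..y + d} x \<bullet> fst (Z x) $ i" y] by simp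
  qed
  then show ?thesis by (simp add: jet_average_def)
qed

text \<open>The embedding of H^2 into bounded functions with bounded derivative: d = 1, with 4 for
  the distance to the average and 4 for the average itself.\<close>

lemma jet_bound:
  assumes "Z \<in> H2_states"
  shows "AE x in lborel. norm (fst (Z x)) \<le> 8 * sqrt (nsq Z)"
  using jet_average_close[OF assms]
proof eventually_elim
  case (elim x)
  then have "norm (fst (Z x) - jet_average 1 Z x) \<le> 4 * sqrt (nsq Z)" by (auto dest: spec[of _ 1])
  moreover have "norm (jet_average 1 Z x) \<le> 4 * sqrt (nsq Z)"
    using jet_average_bound[OF H2_states_square_int[OF assms], of 1 x] by simp
  ultimately show ?case using norm_triangle_sub[of "fst (Z x)" "jet_average 1 Z x"] by linarith
qed

lemma jet_average_tendsto:
  assumes lim: "\<And>\<phi>. square_int \<phi> \<Longrightarrow> (\<lambda>n. ip \<phi> (Zs n)) \<longlonglongrightarrow> ip \<phi> Z" and d: "d > 0"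
  shows "(\<lambda>n. jet_average d (Zs n) x) \<longlonglongrightarrow> jet_average d Z x"
proof (rule vec_tendstoI)
  fix i
  show "(\<lambda>n. jet_average d (Zs n) x $ i) \<longlonglongrightarrow> jet_average d Z x $ i"
    unfolding jet_average_def state_nth_inner(1) vec_lambda_beta
    using d by (intro tendsto_divide ip_inner_const_tendsto[OF lim] square_int_indicator tendsto_const) auto
qed

text \<open>For fixed d the averages converge by weak convergence, and replacing a jet by its
  average costs an error that is small with d uniformly in n.\<close>

lemma jet_tendsto_AE:
  assumes Zs: "\<And>n. Zs n \<in> H2_states" and bd: "\<And>n. nsq (Zs n) \<le> B" and Z: "Z \<in> H2_states"
    and lim: "\<And>\<phi>. square_int \<phi> \<Longrightarrow> (\<lambda>n. ip \<phi> (Zs n)) \<longlonglongrightarrow> ip \<phi> Z"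
  shows "AE x in lborel. (\<lambda>n. fst (Zs n x)) \<longlonglongrightarrow> fst (Z x)"
proof -
  have "AE x in lborel. \<forall>n. \<forall>d>0. norm (fst (Zs n x) - jet_average d (Zs n) x) \<le> 4 * sqrt d * sqrt (nsq (Zs n))"
    unfolding AE_all_countable using jet_average_close[OF Zs] by blast
  then show ?thesis using jet_average_close[OF Z]
  proof eventually_elim
    case (elim x)
    show ?case
    proof (rule LIMSEQ_I)
      fix e :: real assume e: "e > 0"
      define K where "K = sqrt \<bar>B\<bar> + sqrt (nsq Z) + 1"
      have K: "K > 0" "sqrt (nsq Z) \<le> K" using ip_self_nonneg[of Z] by (auto simp: K_def add_nonneg_pos)
      have K': "sqrt (nsq (Zs n)) \<le> K" for n
      proof -
        have "sqrt (nsq (Zs n)) \<le> sqrt \<bar>B\<bar>" using bd[of n] by (intro real_sqrt_le_mono) simp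
        then show ?thesis using ip_self_nonneg[of Z] unfolding K_def
          using real_sqrt_ge_zero[OF ip_self_nonneg[of Z]] by linarith
      qed
      \<comment> \<open>Chosen so that 4 sqrt d K = e / 3: two thirds of e for the two replacements,
        one third for the averages.\<close>
      define d where "d = (e / (12 * K))\<^sup>2"
      have d: "d > 0" using e K by (simp add: d_def)
      have sd: "4 * sqrt d * K = e / 3" using e K by (simp add: d_def)
      have close: "norm (fst (Zs n x) - jet_average d (Zs n) x) \<le> e / 3" for n
      proof -
        have "norm (fst (Zs n x) - jet_average d (Zs n) x) \<le> 4 * sqrt d * sqrt (nsq (Zs n))"
          using elim(1) d by blast
        also have "\<dots> \<le> 4 * sqrt d * K" using K' d by (intro mult_left_mono) auto
        finally show ?thesis using sd by simp
      qed
      have close0: "norm (fst (Z x) - jet_average d Z x) \<le> e / 3"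
      proof -
        have "norm (fst (Z x) - jet_average d Z x) \<le> 4 * sqrt d * sqrt (nsq Z)"
          using elim(2) d by blast
        also have "\<dots> \<le> 4 * sqrt d * K" using K d by (intro mult_left_mono) auto
        finally show ?thesis using sd by simp
      qed
      obtain N where N: "\<And>n. n \<ge> N \<Longrightarrow> norm (jet_average d (Zs n) x - jet_average d Z x) < e / 3"
        using LIMSEQ_D[OF jet_average_tendsto[where Zs = Zs and Z = Z, OF lim d], of "e / 3" x] e by auto
      have "norm (fst (Zs n x) - fst (Z x)) < e" if "n \<ge> N" for n
      proof -
        have "fst (Zs n x) - fst (Z x) = (fst (Zs n x) - jet_average d (Zs n) x)
          + (jet_average d (Zs n) x - jet_average d Z x) - (fst (Z x) - jet_average d Z x)" by simp
        then have "norm (fst (Zs n x) - fst (Z x)) \<le> norm (fst (Zs n x) - jet_average d (Zs n) x)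
          + norm (jet_average d (Zs n) x - jet_average d Z x) + norm (fst (Z x) - jet_average d Z x)"
          by (metis (no_types, lifting) add_right_mono norm_triangle_ineq norm_triangle_ineq4 order_trans)
        then show ?thesis using close[of n] close0 N[OF that] by linarith
      qed
      then show "\<exists>no. \<forall>n\<ge>no. norm (fst (Zs n x) - fst (Z x)) < e" by blast
    qed
  qed
qed

section \<open>Integral functionals with quadratically bounded integrand\<close>

text \<open>A local form of "C^1 with Lipschitz gradient, vanishing to second order at 0", stated
  without derivatives so that it covers F and G alike. L depends on the radius M, which suffices
  because jets of bounded states are uniformly bounded.\<close>

definition quad_bounded :: "('a::euclidean_space \<Rightarrow> real) \<Rightarrow> bool" where
  "quad_bounded f \<longleftrightarrow> continuous_on UNIV f \<and>
     (\<forall>M. \<exists>L\<ge>0. \<forall>u v. norm u \<le> M \<longrightarrow> norm v \<le> M \<longrightarrow>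
        \<bar>f (u + v) - f u - f v\<bar> \<le> L * (norm u * norm v) \<and> \<bar>f u\<bar> \<le> L * (norm u * norm u))"

lemma quad_boundedE:
  assumes "quad_bounded f"
  obtains L where "L \<ge> 0"
    "\<And>u v. norm u \<le> M \<Longrightarrow> norm v \<le> M \<Longrightarrow> \<bar>f (u + v) - f u - f v\<bar> \<le> L * (norm u * norm v)"
    "\<And>u. norm u \<le> M \<Longrightarrow> \<bar>f u\<bar> \<le> L * (norm u * norm u)"
proof -
  have "\<exists>L\<ge>0. \<forall>u v. norm u \<le> M \<longrightarrow> norm v \<le> M \<longrightarrow>
        \<bar>f (u + v) - f u - f v\<bar> \<le> L * (norm u * norm v) \<and> \<bar>f u\<bar> \<le> L * (norm u * norm u)"
    using assms unfolding quad_bounded_def by (elim conjE) (erule allE)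
  then show ?thesis using that by blast
qed

definition bounded_L2 :: "real \<Rightarrow> (real \<Rightarrow> 'a::euclidean_space) \<Rightarrow> bool" where
  "bounded_L2 M U \<longleftrightarrow> square_int U \<and> (AE x in lborel. norm (U x) \<le> M)"

lemma integrable_norm_square: "square_int U \<Longrightarrow> integrable lborel (\<lambda>x. norm (U x) * norm (U x))"
  by (rule integrable_norm_mult_square_int)

lemma integral_norm_square: "(LBINT x. norm (U x) * norm (U x)) = nsq U"
  by (simp add: ip_def power2_norm_eq_inner[symmetric] power2_eq_square)

lemma quad_bounded_measurable:
  assumes "quad_bounded f" "square_int U"
  shows "(\<lambda>x. f (U x)) \<in> borel_measurable lborel"
proof (rule measurable_compose[OF square_int_measurable[OF assms(2)]])
  show "f \<in> borel_measurable borel"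
    using assms(1) by (intro borel_measurable_continuous_onI) (simp add: quad_bounded_def)
qed

lemma quad_bounded_integral:
  assumes f: "quad_bounded f" and U: "bounded_L2 M U"
  shows "integrable lborel (\<lambda>x. f (U x))"
proof -
  obtain L where L: "L \<ge> 0" "\<And>u. norm u \<le> M \<Longrightarrow> \<bar>f u\<bar> \<le> L * (norm u * norm u)"
    by (rule quad_boundedE[OF f, of M]) (rule that)
  have sq: "square_int U" and bd: "AE x in lborel. norm (U x) \<le> M" using U by (auto simp: bounded_L2_def)
  show ?thesis
  proof (rule Bochner_Integration.integrable_bound)
    show "integrable lborel (\<lambda>x. L * (norm (U x) * norm (U x)))"
      by (intro integrable_mult_right integrable_norm_square sq)
    show "(\<lambda>x. f (U x)) \<in> borel_measurable lborel" by (rule quad_bounded_measurable[OF f sq])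
    show "AE x in lborel. norm (f (U x)) \<le> norm (L * (norm (U x) * norm (U x)))"
      using bd by eventually_elim (use L in \<open>auto intro: order_trans[OF _ abs_ge_self]\<close>)
  qed
qed

lemma quad_bounded_integral_le:
  assumes f: "quad_bounded f"
  obtains L where "L \<ge> 0" "\<And>U. bounded_L2 M U \<Longrightarrow> \<bar>LBINT x. f (U x)\<bar> \<le> L * nsq U"
proof -
  obtain L where L: "L \<ge> 0" "\<And>u. norm u \<le> M \<Longrightarrow> \<bar>f u\<bar> \<le> L * (norm u * norm u)"
    by (rule quad_boundedE[OF f, of M]) (rule that)
  have "\<bar>LBINT x. f (U x)\<bar> \<le> L * nsq U" if U: "bounded_L2 M U" for U
  proof -
    have sq: "square_int U" and bd: "AE x in lborel. norm (U x) \<le> M" using U by (auto simp: bounded_L2_def)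
    have "\<bar>LBINT x. f (U x)\<bar> \<le> (LBINT x. norm (f (U x)))"
      using integral_norm_bound[of lborel "\<lambda>x. f (U x)"] by simp
    also have "\<dots> \<le> (LBINT x. L * (norm (U x) * norm (U x)))"
    proof (rule integral_mono_AE)
      show "AE x in lborel. norm (f (U x)) \<le> L * (norm (U x) * norm (U x))"
        using bd by eventually_elim (use L in auto)
    qed (intro integrable_norm quad_bounded_integral[OF f U] integrable_mult_right integrable_norm_square sq)+
    also have "\<dots> = L * nsq U" by (simp add: integral_norm_square)
    finally show ?thesis .
  qed
  with L(1) show ?thesis by (rule that)
qed

text \<open>Up to \<open>\<epsilon> |V\<^sub>n|\<^sup>2\<close>, whose integral is at most \<open>\<epsilon> B\<close>, the integrand is dominated by \<open>|U|\<^sup>2 / \<epsilon>\<close>.\<close>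
lemma integral_norm_mult_tendsto_0:
  fixes U :: "real \<Rightarrow> 'a::euclidean_space" and V :: "nat \<Rightarrow> real \<Rightarrow> 'b::euclidean_space"
  assumes U: "square_int U" and V: "\<And>n. square_int (V n)" and bd: "\<And>n. nsq (V n) \<le> B"
    and lim: "AE x in lborel. (\<lambda>n. V n x) \<longlonglongrightarrow> 0"
  shows "(\<lambda>n. LBINT x. norm (U x) * norm (V n x)) \<longlonglongrightarrow> 0"
proof (rule LIMSEQ_I)
  fix e :: real assume e: "e > 0"
  have "B \<ge> 0" using bd[of 0] ip_self_nonneg[of "V 0"] by linarith
  define \<epsilon> where "\<epsilon> = e / (2 * (B + 1))"
  have \<epsilon>: "\<epsilon> > 0" "\<epsilon> * B \<le> e / 2" using e \<open>B \<ge> 0\<close> by (auto simp: \<epsilon>_def field_simps)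
  define w where "w n x = max 0 (norm (U x) * norm (V n x) - \<epsilon> * (norm (V n x) * norm (V n x)))" for n x
  have w_int: "integrable lborel (w n)" for n
    unfolding w_def[abs_def]
    by (intro integrable_max integrable_zero Bochner_Integration.integrable_diff integrable_mult_right
        integrable_norm_mult_square_int U V)
  have "(\<lambda>n. LBINT x. w n x) \<longlonglongrightarrow> (LINT x|(lborel :: real measure). (0::real))"
  proof (rule integral_dominated_convergence[where w = "\<lambda>x. 1 / \<epsilon> * (norm (U x) * norm (U x))"])
    show "integrable lborel (\<lambda>x. 1 / \<epsilon> * (norm (U x) * norm (U x)))"
      by (intro integrable_mult_right integrable_norm_square U)
    show "w n \<in> borel_measurable lborel" for n using w_int by (rule borel_measurable_integrable)
    have "norm (w n x) \<le> 1 / \<epsilon> * (norm (U x) * norm (U x))" for n x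
    proof (cases "norm (U x) \<le> \<epsilon> * norm (V n x)")
      case True
      from mult_right_mono[OF this norm_ge_zero[of "V n x"]] have "w n x = 0"
        by (simp add: w_def mult.assoc)
      then show ?thesis using \<epsilon> by simp
    next
      case False
      then have V_le: "norm (V n x) \<le> 1 / \<epsilon> * norm (U x)" using \<epsilon> by (simp add: field_simps)
      have "norm (w n x) \<le> norm (U x) * norm (V n x)" using \<epsilon> by (simp add: w_def)
      also have "\<dots> \<le> norm (U x) * (1 / \<epsilon> * norm (U x))" by (intro mult_left_mono V_le) simp
      finally show ?thesis by simp
    qed
    then show "AE x in lborel. norm (w n x) \<le> 1 / \<epsilon> * (norm (U x) * norm (U x))" for n by simp
    show "AE x in lborel. (\<lambda>n. w n x) \<longlonglongrightarrow> 0"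
      using lim
    proof eventually_elim
      case (elim x)
      have "(\<lambda>n. max 0 (norm (U x) * norm (V n x) - \<epsilon> * (norm (V n x) * norm (V n x)))) \<longlonglongrightarrow>
          max 0 (norm (U x) * norm (0::'b) - \<epsilon> * (norm (0::'b) * norm (0::'b)))"
        by (intro tendsto_intros elim)
      then show ?case by (simp add: w_def)
    qed
  qed simp
  then have "(\<lambda>n. LBINT x. w n x) \<longlonglongrightarrow> 0" by simp
  from LIMSEQ_D[OF this, of "e/2"] e obtain N where
    N: "\<And>n. n \<ge> N \<Longrightarrow> \<bar>LBINT x. w n x\<bar> < e / 2" by auto
  have "norm (LBINT x. norm (U x) * norm (V n x)) < e" if "n \<ge> N" for n
  proof -
    have "(LBINT x. norm (U x) * norm (V n x)) \<le>
        (LBINT x. w n x + \<epsilon> * (norm (V n x) * norm (V n x)))"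
      by (intro integral_mono Bochner_Integration.integrable_add integrable_mult_right w_int
          integrable_norm_mult_square_int U V) (simp add: w_def)
    also have "\<dots> = (LBINT x. w n x) + \<epsilon> * nsq (V n)"
      by (simp add: w_int integrable_norm_square[OF V] integral_norm_square)
    also have "\<dots> < e / 2 + e / 2"
      using N[OF that] mult_left_mono[OF bd[of n], of \<epsilon>] \<epsilon> by linarith
    finally show ?thesis by simp
  qed
  then show "\<exists>no. \<forall>n\<ge>no. norm ((LBINT x. norm (U x) * norm (V n x)) - 0) < e" by auto
qed

lemma bounded_L2_add:
  "bounded_L2 M U \<Longrightarrow> bounded_L2 M' V \<Longrightarrow> bounded_L2 (M + M') (\<lambda>x. U x + V x)"
  unfolding bounded_L2_def
proof (elim conjE, intro conjI)
  assume "AE x in lborel. norm (U x) \<le> M" "AE x in lborel. norm (V x) \<le> M'"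
  then show "AE x in lborel. norm (U x + V x) \<le> M + M'"
    by eventually_elim (rule norm_triangle_le, simp)
qed (rule square_int_add)

lemma bounded_L2_scaleR:
  assumes "bounded_L2 M U"
  shows "bounded_L2 (\<bar>t\<bar> * M) (\<lambda>x. t *\<^sub>R U x)"
  using assms unfolding bounded_L2_def
proof (elim conjE, intro conjI)
  assume "AE x in lborel. norm (U x) \<le> M"
  then show "AE x in lborel. norm (t *\<^sub>R U x) \<le> \<bar>t\<bar> * M"
    by eventually_elim (simp add: mult_left_mono)
qed (rule square_int_scaleR)

text \<open>A Brezis-Lieb splitting: the defect is pointwise at most L |U| |V n|, whose integral
  vanishes since U is fixed while V n is bounded in L2 and tends to 0 almost everywhere.\<close>

lemma quad_bounded_splitting:
  fixes U :: "real \<Rightarrow> 'a::euclidean_space"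
  assumes f: "quad_bounded f" and U: "bounded_L2 M U" and V: "\<And>n. bounded_L2 M (V n)"
    and bd: "\<And>n. nsq (V n) \<le> B" and lim: "AE x in lborel. (\<lambda>n. V n x) \<longlonglongrightarrow> 0"
  shows "(\<lambda>n. (LBINT x. f (U x + V n x)) - (LBINT x. f (U x)) - (LBINT x. f (V n x))) \<longlonglongrightarrow> 0"
proof -
  obtain L where L: "L \<ge> 0"
    "\<And>u v. norm u \<le> M \<Longrightarrow> norm v \<le> M \<Longrightarrow> \<bar>f (u + v) - f u - f v\<bar> \<le> L * (norm u * norm v)"
    by (rule quad_boundedE[OF f, of M]) (rule that)
  have Us: "square_int U" and Ub: "AE x in lborel. norm (U x) \<le> M" using U by (auto simp: bounded_L2_def)
  have Vs: "square_int (V n)" and Vb: "AE x in lborel. norm (V n x) \<le> M" for n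
    using V[of n] by (auto simp: bounded_L2_def)
  have i1: "integrable lborel (\<lambda>x. f (U x + V n x))" for n
    by (rule quad_bounded_integral[OF f bounded_L2_add[OF U V]])
  have i2: "integrable lborel (\<lambda>x. f (U x))" "integrable lborel (\<lambda>x. f (V n x))" for n
    by (rule quad_bounded_integral[OF f U] quad_bounded_integral[OF f V])+
  have "\<bar>(LBINT x. f (U x + V n x)) - (LBINT x. f (U x)) - (LBINT x. f (V n x))\<bar> \<le>
      L * (LBINT x. norm (U x) * norm (V n x))" for n
  proof -
    have eq: "(LBINT x. f (U x + V n x)) - (LBINT x. f (U x)) - (LBINT x. f (V n x)) =
        (LBINT x. f (U x + V n x) - f (U x) - f (V n x))"
      using i1 i2 by simp
    have "\<bar>LBINT x. f (U x + V n x) - f (U x) - f (V n x)\<bar> \<le>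
        (LBINT x. norm (f (U x + V n x) - f (U x) - f (V n x)))"
      using integral_norm_bound[of lborel "\<lambda>x. f (U x + V n x) - f (U x) - f (V n x)"] by simp
    also have "\<dots> \<le> (LBINT x. L * (norm (U x) * norm (V n x)))"
    proof (rule integral_mono_AE)
      show "AE x in lborel. norm (f (U x + V n x) - f (U x) - f (V n x)) \<le> L * (norm (U x) * norm (V n x))"
        using Ub Vb[of n] by eventually_elim (use L in auto)
    qed (intro integrable_norm Bochner_Integration.integrable_diff i1 i2 integrable_mult_right
        integrable_norm_mult_square_int Us Vs)+
    finally show ?thesis unfolding eq by simp
  qed
  moreover have "(\<lambda>n. L * (LBINT x. norm (U x) * norm (V n x))) \<longlonglongrightarrow> 0"
    by (rule tendsto_mult_right_zero[OF integral_norm_mult_tendsto_0[OF Us Vs bd lim]])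
  ultimately show ?thesis
    by (intro Lim_null_comparison[where f = "\<lambda>n. (LBINT x. f (U x + V n x)) - (LBINT x. f (U x)) - (LBINT x. f (V n x))"]
        always_eventually) auto
qed

text \<open>For t in [0,1] the scaled argument stays in the ball of radius M, so one majorant L
  |U|^2 serves for all t. This feeds the intermediate value argument on the Nehari
  constraint.\<close>

lemma quad_bounded_scale_continuous:
  assumes f: "quad_bounded f" and U: "bounded_L2 M U"
  shows "continuous_on {0..1} (\<lambda>t. LBINT x. f (t *\<^sub>R U x))"
proof (rule continuous_on_sequentiallyI)
  fix X :: "nat \<Rightarrow> real" and t assume X: "\<forall>n. X n \<in> {0..1}" and t: "t \<in> {0..1}" and lim: "X \<longlonglongrightarrow> t"
  obtain L where L: "L \<ge> 0" "\<And>u. norm u \<le> M \<Longrightarrow> \<bar>f u\<bar> \<le> L * (norm u * norm u)"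
    by (rule quad_boundedE[OF f, of M]) (rule that)
  have Us: "square_int U" and Ub: "AE x in lborel. norm (U x) \<le> M" using U by (auto simp: bounded_L2_def)
  show "(\<lambda>n. LBINT x. f (X n *\<^sub>R U x)) \<longlonglongrightarrow> (LBINT x. f (t *\<^sub>R U x))"
  proof (rule integral_dominated_convergence[where w = "\<lambda>x. L * (norm (U x) * norm (U x))"])
    show "integrable lborel (\<lambda>x. L * (norm (U x) * norm (U x)))"
      by (intro integrable_mult_right integrable_norm_square Us)
    show "(\<lambda>x. f (t *\<^sub>R U x)) \<in> borel_measurable lborel"
      by (rule quad_bounded_measurable[OF f square_int_scaleR[OF Us]])
    show "(\<lambda>x. f (X n *\<^sub>R U x)) \<in> borel_measurable lborel" for n
      by (rule quad_bounded_measurable[OF f square_int_scaleR[OF Us]])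
    show "AE x in lborel. (\<lambda>n. f (X n *\<^sub>R U x)) \<longlonglongrightarrow> f (t *\<^sub>R U x)"
    proof (rule AE_I2)
      fix x
      have "isCont f (t *\<^sub>R U x)" using f by (simp add: quad_bounded_def continuous_on_eq_continuous_at)
      then show "(\<lambda>n. f (X n *\<^sub>R U x)) \<longlonglongrightarrow> f (t *\<^sub>R U x)"
        by (rule isCont_tendsto_compose) (intro tendsto_scaleR lim tendsto_const)
    qed
    show "AE x in lborel. norm (f (X n *\<^sub>R U x)) \<le> L * (norm (U x) * norm (U x))" for n
      using Ub
    proof eventually_elim
      case (elim x)
      have n1: "norm (X n *\<^sub>R U x) \<le> norm (U x)" using X by (simp add: mult_left_le_one_le)
      then have "\<bar>f (X n *\<^sub>R U x)\<bar> \<le> L * (norm (X n *\<^sub>R U x) * norm (X n *\<^sub>R U x))"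
        using elim by (intro L(2)) linarith
      also have "\<dots> \<le> L * (norm (U x) * norm (U x))"
        by (intro mult_left_mono mult_mono n1 L) auto
      finally show ?case by simp
    qed
  qed
qed

text \<open>f(U + tV) - f(U) is the interaction defect plus f(tV); both carry a factor t, so for |t|
  <= 1 the difference quotients have a majorant independent of t.\<close>

lemma quad_bounded_gateaux:
  fixes U V :: "real \<Rightarrow> 'a::euclidean_space"
  assumes f: "quad_bounded f" and U: "bounded_L2 M U" and V: "bounded_L2 M V"
    and deriv: "\<And>w. (f has_derivative f' w) (at w)"
  shows "((\<lambda>t. LBINT x. f (U x + t *\<^sub>R V x)) has_real_derivative (LBINT x. f' (U x) (V x))) (at 0)"
    and "integrable lborel (\<lambda>x. f' (U x) (V x))"
proof -
  obtain L where L: "L \<ge> 0"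
    "\<And>u v. norm u \<le> M \<Longrightarrow> norm v \<le> M \<Longrightarrow> \<bar>f (u + v) - f u - f v\<bar> \<le> L * (norm u * norm v)"
    "\<And>u. norm u \<le> M \<Longrightarrow> \<bar>f u\<bar> \<le> L * (norm u * norm u)"
    by (rule quad_boundedE[OF f, of M]) (rule that)
  have Us: "square_int U" and Ub: "AE x in lborel. norm (U x) \<le> M" using U by (auto simp: bounded_L2_def)
  have Vs: "square_int V" and Vb: "AE x in lborel. norm (V x) \<le> M" using V by (auto simp: bounded_L2_def)
  let ?w = "\<lambda>x. L * (norm (U x) * norm (V x)) + L * (norm (V x) * norm (V x))"
  have w: "integrable lborel ?w"
    by (intro Bochner_Integration.integrable_add integrable_mult_right integrable_norm_mult_square_int Us Vs)
  have meas: "(\<lambda>x. f (U x + t *\<^sub>R V x)) \<in> borel_measurable lborel" for t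
    by (rule quad_bounded_measurable[OF f square_int_add[OF Us square_int_scaleR[OF Vs]]])
  have i: "integrable lborel (\<lambda>x. f (U x + t *\<^sub>R V x))" for t
    by (rule quad_bounded_integral[OF f bounded_L2_add[OF U bounded_L2_scaleR[OF V]]])
  have quot: "((\<lambda>t. (f (u + t *\<^sub>R v) - f u) / t) \<longlongrightarrow> f' u v) (at 0)" for u v
  proof -
    have "((\<lambda>t. u + t *\<^sub>R v) has_derivative (\<lambda>t. t *\<^sub>R v)) (at 0)"
      by (auto intro!: derivative_eq_intros)
    from has_derivative_compose[OF this, of f "f' u"] deriv[of u]
    have "((\<lambda>t. f (u + t *\<^sub>R v)) has_derivative (\<lambda>t. f' u (t *\<^sub>R v))) (at 0)" by simp
    moreover have "f' u (t *\<^sub>R v) = f' u v * t" for t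
      using linear_scale[OF has_derivative_linear[OF deriv[of u]]] by simp
    ultimately have "((\<lambda>t. f (u + t *\<^sub>R v)) has_real_derivative f' u v) (at 0)"
      by (simp add: has_field_derivative_def)
    then show ?thesis by (simp add: has_field_derivative_iff)
  qed
  have dom: "AE x in lborel. norm ((f (U x + t *\<^sub>R V x) - f (U x)) / t) \<le> ?w x" if t: "t \<noteq> 0" "\<bar>t\<bar> \<le> 1" for t
    using Ub Vb
  proof eventually_elim
    case (elim x)
    have n: "norm (t *\<^sub>R V x) = \<bar>t\<bar> * norm (V x)" by simp
    have tM: "norm (t *\<^sub>R V x) \<le> M"
      using elim(2) mult_left_le_one_le[OF norm_ge_zero[of "V x"] abs_ge_zero t(2)] by (simp add: order_trans)
    have "\<bar>f (U x + t *\<^sub>R V x) - f (U x)\<bar> \<le> \<bar>f (U x + t *\<^sub>R V x) - f (U x) - f (t *\<^sub>R V x)\<bar> + \<bar>f (t *\<^sub>R V x)\<bar>"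
      by linarith
    also have "\<dots> \<le> L * (norm (U x) * norm (t *\<^sub>R V x)) + L * (norm (t *\<^sub>R V x) * norm (t *\<^sub>R V x))"
      by (intro add_mono L elim tM)
    also have "\<dots> = \<bar>t\<bar> * (L * (norm (U x) * norm (V x)) + \<bar>t\<bar> * (L * (norm (V x) * norm (V x))))"
      unfolding n by (simp add: algebra_simps)
    also have "\<dots> \<le> \<bar>t\<bar> * ?w x"
      using t L(1) by (intro mult_left_mono add_left_mono mult_left_le_one_le) auto
    finally have "\<bar>f (U x + t *\<^sub>R V x) - f (U x)\<bar> \<le> \<bar>t\<bar> * ?w x" .
    then show ?case using t by (simp add: abs_divide pos_divide_le_eq mult.commute)
  qed
  \<comment> \<open>No regularity of f' in its base point is assumed; measurability comes from the
    pointwise limit of quotients.\<close>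
  have measf': "(\<lambda>x. f' (U x) (V x)) \<in> borel_measurable lborel"
  proof (rule borel_measurable_LIMSEQ_real)
    show "(\<lambda>n. (f (U x + inverse (real (Suc n)) *\<^sub>R V x) - f (U x)) / inverse (real (Suc n))) \<longlonglongrightarrow> f' (U x) (V x)" for x
      by (rule filterlim_compose[OF quot])
        (use LIMSEQ_inverse_real_of_nat in \<open>auto simp: filterlim_at simp del: of_nat_Suc\<close>)
    show "(\<lambda>x. (f (U x + inverse (real (Suc n)) *\<^sub>R V x) - f (U x)) / inverse (real (Suc n))) \<in> borel_measurable lborel" for n
      using meas[of "inverse (real (Suc n))"] meas[of 0] by simp
  qed
  have seq: "(\<lambda>n. LBINT x. (f (U x + X n *\<^sub>R V x) - f (U x)) / X n) \<longlonglongrightarrow> (LBINT x. f' (U x) (V x))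
      \<and> integrable lborel (\<lambda>x. f' (U x) (V x))"
    if X: "\<And>n. X n \<noteq> 0 \<and> \<bar>X n\<bar> \<le> 1" and Xlim: "X \<longlonglongrightarrow> 0" for X :: "nat \<Rightarrow> real"
  proof -
    have l: "AE x in lborel. (\<lambda>n. (f (U x + X n *\<^sub>R V x) - f (U x)) / X n) \<longlonglongrightarrow> f' (U x) (V x)"
      by (intro AE_I2 filterlim_compose[OF quot]) (use X Xlim in \<open>auto simp: filterlim_at\<close>)
    have m: "(\<lambda>x. (f (U x + X n *\<^sub>R V x) - f (U x)) / X n) \<in> borel_measurable lborel" for n
      using meas[of "X n"] meas[of 0] by simp
    have d: "AE x in lborel. norm ((f (U x + X n *\<^sub>R V x) - f (U x)) / X n) \<le> ?w x" for n
      using X by (intro dom) auto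
    show ?thesis
      using integral_dominated_convergence[OF measf' m w l d] integrable_dominated_convergence[OF measf' m w l d]
      by blast
  qed
  show "integrable lborel (\<lambda>x. f' (U x) (V x))"
    using seq[of "\<lambda>n. inverse (real (Suc n))"] LIMSEQ_inverse_real_of_nat by (auto simp: field_simps)
  show "((\<lambda>t. LBINT x. f (U x + t *\<^sub>R V x)) has_real_derivative (LBINT x. f' (U x) (V x))) (at 0)"
    unfolding has_field_derivative_iff
  proof (subst tendsto_at_iff_sequentially, intro allI impI)
    fix X :: "nat \<Rightarrow> real" assume X: "\<forall>i. X i \<in> UNIV - {0}" "X \<longlonglongrightarrow> 0"
    then have "\<forall>\<^sub>F n in sequentially. \<bar>X n\<bar> < 1" using order_tendstoD[OF tendsto_rabs_zero[OF X(2)]] by auto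
    \<comment> \<open>The majorant requires |t| <= 1, which holds only from N on; hence the shift of
      the sequence.\<close>
    then obtain N where N: "\<And>n. n \<ge> N \<Longrightarrow> \<bar>X n\<bar> \<le> 1" by (force simp: eventually_sequentially)
    have "(\<lambda>n. LBINT x. (f (U x + X (n + N) *\<^sub>R V x) - f (U x)) / X (n + N)) \<longlonglongrightarrow> (LBINT x. f' (U x) (V x))"
      using seq[of "\<lambda>n. X (n + N)"] X N LIMSEQ_ignore_initial_segment[OF X(2), of N] by auto
    then have "(\<lambda>n. LBINT x. (f (U x + X n *\<^sub>R V x) - f (U x)) / X n) \<longlonglongrightarrow> (LBINT x. f' (U x) (V x))"
      by (rule LIMSEQ_offset)
    moreover have eq: "(LBINT x. (f (U x + t *\<^sub>R V x) - f (U x)) / t) =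
        ((LBINT x. f (U x + t *\<^sub>R V x)) - (LBINT x. f (U x + 0 *\<^sub>R V x))) / (t - 0)" for t
      using i[of t] i[of 0] by simp
    ultimately show "((\<lambda>y. ((LBINT x. f (U x + y *\<^sub>R V x)) - (LBINT x. f (U x + 0 *\<^sub>R V x))) / (y - 0)) \<circ> X)
        \<longlonglongrightarrow> (LBINT x. f' (U x) (V x))"
      unfolding o_def eq by blast
  qed
qed

section \<open>The nonlinearity\<close>

lemma norm_matrix_vector_mult_le:
  fixes A :: "real^'n^'m"
  shows "norm (A *v h) \<le> norm A * norm h"
proof -
  have "norm (A *v h) = L2_set (\<lambda>i. norm ((A *v h) $ i)) UNIV" by (simp add: norm_vec_def)
  also have "\<dots> \<le> L2_set (\<lambda>i. norm (A $ i) * norm h) UNIV"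
    by (rule L2_set_mono) (auto simp: matrix_vector_mul_component Cauchy_Schwarz_ineq2)
  also have "\<dots> = norm A * norm h"
    by (simp add: norm_vec_def[of A] L2_set_left_distrib)
  finally show ?thesis .
qed

text \<open>\<open>superquad\<close> is condition (a), since the derivative of G at w in direction w
  is the inner product of w with the gradient of G. \<open>Hess_0\<close> is condition (b) at the
  origin.\<close>

locale nonlinearity =
  fixes F :: "real^4 \<Rightarrow> real" and gradF :: "real^4 \<Rightarrow> real^4" and HessF :: "real^4 \<Rightarrow> real^4^4" and p :: real
  assumes F_deriv: "(F has_derivative (\<lambda>h. gradF w \<bullet> h)) (at w)"
    and grad_deriv: "(gradF has_derivative (\<lambda>h. HessF w *v h)) (at w)"
    and Hess_cont: "continuous_on UNIV HessF"
    and F_0: "F 0 = 0"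
    and p_pos: "p > 0"
    and superquad: "frechet_derivative (Gf gradF) (at w) w \<ge> (p + 2) * Gf gradF w"
    and Hess_0: "HessF 0 = 0"
begin

definition DG :: "real^4 \<Rightarrow> real^4 \<Rightarrow> real" where
  "DG w h = w \<bullet> (HessF w *v h) + h \<bullet> gradF w"

lemma G_deriv: "(Gf gradF has_derivative DG w) (at w)"
  unfolding Gf_def[abs_def] DG_def[abs_def]
  by (rule has_derivative_inner[OF has_derivative_ident grad_deriv])

text \<open>By the product rule the derivative of G at w along w is the Hessian term plus G w;
  cancelling that one G turns p + 2 into p + 1.\<close>

lemma superquad': "w \<bullet> (HessF w *v w) \<ge> (p + 1) * (w \<bullet> gradF w)"
  using superquad[of w] frechet_derivative_at[OF G_deriv[of w], symmetric]
  by (simp add: DG_def Gf_def algebra_simps)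

lemma grad_cont: "continuous_on UNIV gradF"
  using grad_deriv by (intro has_derivative_continuous_on) auto

text \<open>The superquadraticity condition at \<open>t \<nabla>F(0)\<close> reads
  \<open>O(t\<^sup>2) \<ge> (p + 1) t |\<nabla>F(0)|\<^sup>2 + o(t)\<close>.\<close>
lemma grad_0: "gradF 0 = 0"
proof -
  define g where "g = gradF 0"
  define t where "t n = inverse (real (Suc n))" for n
  have t_pos: "t n > 0" for n by (simp add: t_def)
  have t: "(\<lambda>n. t n *\<^sub>R g) \<longlonglongrightarrow> 0 *\<^sub>R g"
    unfolding t_def by (intro tendsto_scaleR LIMSEQ_inverse_real_of_nat tendsto_const)
  have t0: "t \<longlonglongrightarrow> 0" unfolding t_def[abs_def] by (rule LIMSEQ_inverse_real_of_nat)
  have ineq: "(p + 1) * (g \<bullet> gradF (t n *\<^sub>R g)) \<le> t n * (norm g * (norm (HessF (t n *\<^sub>R g)) * norm g))" for n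
  proof -
    have "t n * ((p + 1) * (g \<bullet> gradF (t n *\<^sub>R g))) \<le> t n * (t n * (g \<bullet> (HessF (t n *\<^sub>R g) *v g)))"
      using superquad'[of "t n *\<^sub>R g"]
      by (simp add: matrix_vector_mult_scaleR algebra_simps)
    then have "(p + 1) * (g \<bullet> gradF (t n *\<^sub>R g)) \<le> t n * (g \<bullet> (HessF (t n *\<^sub>R g) *v g))"
      using t_pos[of n] by simp
    also have "\<dots> \<le> t n * (norm g * (norm (HessF (t n *\<^sub>R g)) * norm g))"
      using t_pos[of n] by (intro mult_left_mono order_trans[OF norm_cauchy_schwarz] norm_matrix_vector_mult_le) auto
    finally show ?thesis .
  qed
  have "(\<lambda>n. (p + 1) * (g \<bullet> gradF (t n *\<^sub>R g))) \<longlonglongrightarrow> (p + 1) * (g \<bullet> gradF (0 *\<^sub>R g))"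
    using grad_cont by (intro tendsto_intros isCont_tendsto_compose[OF _ t, of gradF])
      (simp add: continuous_on_eq_continuous_at)
  moreover have "(\<lambda>n. t n * (norm g * (norm (HessF (t n *\<^sub>R g)) * norm g))) \<longlonglongrightarrow>
      0 * (norm g * (norm (HessF (0 *\<^sub>R g)) * norm g))"
    using Hess_cont by (intro tendsto_intros isCont_tendsto_compose[OF _ t, of HessF] t0)
      (simp add: continuous_on_eq_continuous_at)
  ultimately have "(p + 1) * (g \<bullet> gradF (0 *\<^sub>R g)) \<le> 0 * (norm g * (norm (HessF (0 *\<^sub>R g)) * norm g))"
    by (rule LIMSEQ_le) (use ineq in blast)
  then have "(p + 1) * (g \<bullet> g) \<le> 0" by (simp add: g_def)
  then have "g \<bullet> g \<le> 0" using p_pos by (simp add: mult_le_0_iff)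
  then have "g \<bullet> g = 0" using inner_ge_zero[of g] by linarith
  then show ?thesis by (simp add: g_def)
qed

lemma grad_lipschitz:
  assumes "\<And>w. norm w \<le> M \<Longrightarrow> norm (HessF w) \<le> L" "norm u \<le> M" "norm v \<le> M"
  shows "norm (gradF u - gradF v) \<le> L * norm (u - v)"
proof (rule differentiable_bound[of "cball 0 M"])
  show "(gradF has_derivative (\<lambda>h. HessF w *v h)) (at w within cball 0 M)" for w
    using grad_deriv by (rule has_derivative_at_withinI)
  show "onorm (\<lambda>h. HessF w *v h) \<le> L" if "w \<in> cball 0 M" for w
  proof (rule onorm_le)
    fix h
    show "norm (HessF w *v h) \<le> L * norm h"
      by (rule order_trans[OF norm_matrix_vector_mult_le mult_right_mono[OF assms(1)]]) (use that in auto)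
  qed
qed (use assms in auto)

lemma Hess_bound: "\<exists>L\<ge>0. \<forall>w. norm w \<le> M \<longrightarrow> norm (HessF w) \<le> L"
proof -
  have "compact (HessF ` cball 0 M)"
    by (intro compact_continuous_image continuous_on_subset[OF Hess_cont]) auto
  then have "bounded (HessF ` cball 0 M)" by (rule compact_imp_bounded)
  then obtain L where L: "\<forall>y\<in>HessF ` cball 0 M. norm y \<le> L" by (auto simp only: bounded_iff)
  show ?thesis
    by (rule exI[of _ "max L 0"]) (use L in \<open>auto simp: le_max_iff_disj\<close>)
qed

lemma grad_local_bounds:
  obtains L where "L \<ge> 0" "\<And>u v. norm u \<le> M \<Longrightarrow> norm v \<le> M \<Longrightarrow> norm (gradF u - gradF v) \<le> L * norm (u - v)"
    "\<And>u. norm u \<le> M \<Longrightarrow> norm (gradF u) \<le> L * norm u"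
proof -
  obtain L where L: "L \<ge> 0" "\<And>w. norm w \<le> M \<Longrightarrow> norm (HessF w) \<le> L" using Hess_bound by blast
  have "norm (gradF u) \<le> L * norm u" if "norm u \<le> M" for u
  proof -
    have "norm (0 :: real^4) \<le> M" using that norm_ge_zero[of u] unfolding norm_zero by linarith
    from grad_lipschitz[OF L(2) that this] show ?thesis by (simp add: grad_0)
  qed
  with L grad_lipschitz[OF L(2)] show ?thesis using that by blast
qed

text \<open>Mean value theorem along segments plus a local Lipschitz bound for the gradient. The
  bound is taken on radius 2M to contain u + t v.\<close>

lemma quad_bounded_F: "quad_bounded F"
  unfolding quad_bounded_def
proof (intro conjI allI)
  show "continuous_on UNIV F" using F_deriv by (intro has_derivative_continuous_on) auto
  fix M :: real
  obtain L where L: "L \<ge> 0" 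
    "\<And>u v. norm u \<le> 2 * M \<Longrightarrow> norm v \<le> 2 * M \<Longrightarrow> norm (gradF u - gradF v) \<le> L * norm (u - v)"
    "\<And>u. norm u \<le> 2 * M \<Longrightarrow> norm (gradF u) \<le> L * norm u"
    by (rule grad_local_bounds[of "2 * M"]) (rule that)
  have line: "((\<lambda>t. F (u + t *\<^sub>R v)) has_real_derivative gradF (u + t *\<^sub>R v) \<bullet> v) (at t)" for u v t
  proof -
    have "((\<lambda>t. u + t *\<^sub>R v) has_derivative (\<lambda>t. t *\<^sub>R v)) (at t)"
      by (auto intro!: derivative_eq_intros)
    from has_derivative_compose[OF this F_deriv]
    show ?thesis by (simp add: has_field_derivative_def mult_commute_abs)
  qed
  show "\<exists>L\<ge>0. \<forall>u v. norm u \<le> M \<longrightarrow> norm v \<le> M \<longrightarrow>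
      \<bar>F (u + v) - F u - F v\<bar> \<le> L * (norm u * norm v) \<and> \<bar>F u\<bar> \<le> L * (norm u * norm u)"
  proof (intro exI[of _ L] conjI allI impI L(1))
    fix u v :: "real^4" assume uv: "norm u \<le> M" "norm v \<le> M"
    have sc: "norm (t *\<^sub>R w) \<le> norm w" if "0 < t" "t < 1" for t and w :: "real^4"
      using that by (simp add: mult_left_le_one_le)
    \<comment> \<open>Comparing the segment from u with the parallel one from 0 makes the derivative
      a difference of gradients at points u apart, which supplies the factor |u|; v supplies the
      other.\<close>
    have "((\<lambda>t. F (u + t *\<^sub>R v) - F (0 + t *\<^sub>R v)) has_real_derivative
        gradF (u + t *\<^sub>R v) \<bullet> v - gradF (0 + t *\<^sub>R v) \<bullet> v) (at t)" for t
      by (intro DERIV_diff line)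
    then obtain t where t: "0 < t" "t < 1" and eq: "(F (u + 1 *\<^sub>R v) - F (0 + 1 *\<^sub>R v)) - (F (u + 0 *\<^sub>R v) - F (0 + 0 *\<^sub>R v)) =
        (1 - 0) * (gradF (u + t *\<^sub>R v) \<bullet> v - gradF (0 + t *\<^sub>R v) \<bullet> v)"
      using MVT2[of 0 1 "\<lambda>t. F (u + t *\<^sub>R v) - F (0 + t *\<^sub>R v)"
        "\<lambda>t. gradF (u + t *\<^sub>R v) \<bullet> v - gradF (0 + t *\<^sub>R v) \<bullet> v"] by auto
    have n: "norm (u + t *\<^sub>R v) \<le> 2 * M" "norm (t *\<^sub>R v) \<le> 2 * M"
      using norm_triangle_ineq[of u "t *\<^sub>R v"] sc[OF t, of v] uv norm_ge_zero[of u] norm_ge_zero[of v] by linarith+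
    have "F (u + v) - F u - F v = (gradF (u + t *\<^sub>R v) - gradF (t *\<^sub>R v)) \<bullet> v"
      using eq by (simp add: F_0 inner_diff_left)
    then have "\<bar>F (u + v) - F u - F v\<bar> \<le> norm (gradF (u + t *\<^sub>R v) - gradF (t *\<^sub>R v)) * norm v"
      by (simp add: Cauchy_Schwarz_ineq2)
    also have "\<dots> \<le> (L * norm ((u + t *\<^sub>R v) - t *\<^sub>R v)) * norm v"
      by (intro mult_right_mono L(2) n) auto
    finally show "\<bar>F (u + v) - F u - F v\<bar> \<le> L * (norm u * norm v)" by (simp add: mult.assoc)
    obtain s where s: "0 < s" "s < 1" and eq': "F (0 + 1 *\<^sub>R u) - F (0 + 0 *\<^sub>R u) = (1 - 0) * (gradF (0 + s *\<^sub>R u) \<bullet> u)"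
      using MVT2[OF zero_less_one line[of 0 u]] by auto
    have n': "norm (s *\<^sub>R u) \<le> 2 * M" using sc[OF s, of u] uv norm_ge_zero[of u] by linarith
    have "F u = gradF (s *\<^sub>R u) \<bullet> u" using eq' by (simp add: F_0)
    then have "\<bar>F u\<bar> \<le> norm (gradF (s *\<^sub>R u)) * norm u" by (simp add: Cauchy_Schwarz_ineq2)
    also have "\<dots> \<le> (L * norm u) * norm u"
      by (intro mult_right_mono order_trans[OF L(3)[OF n']] mult_left_mono sc s L) auto
    finally show "\<bar>F u\<bar> \<le> L * (norm u * norm u)" by (simp add: mult.assoc)
  qed
qed

text \<open>The defect equals u . (gradF(u+v) - gradF(u)) + v . (gradF(u+v) - gradF(v)), so the
  Lipschitz bound for \<open>gradF\<close> suffices and no second derivative of G appears.\<close>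

lemma quad_bounded_G: "quad_bounded (Gf gradF)"
  unfolding quad_bounded_def
proof (intro conjI allI)
  show "continuous_on UNIV (Gf gradF)" using G_deriv by (intro has_derivative_continuous_on) auto
  fix M :: real
  obtain L where L: "L \<ge> 0"
    "\<And>u v. norm u \<le> 2 * M \<Longrightarrow> norm v \<le> 2 * M \<Longrightarrow> norm (gradF u - gradF v) \<le> L * norm (u - v)"
    "\<And>u. norm u \<le> 2 * M \<Longrightarrow> norm (gradF u) \<le> L * norm u"
    by (rule grad_local_bounds[of "2 * M"]) (rule that)
  show "\<exists>L\<ge>0. \<forall>u v. norm u \<le> M \<longrightarrow> norm v \<le> M \<longrightarrow>
      \<bar>Gf gradF (u + v) - Gf gradF u - Gf gradF v\<bar> \<le> L * (norm u * norm v) \<and> \<bar>Gf gradF u\<bar> \<le> L * (norm u * norm u)"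
  proof (intro exI[of _ "2 * L"] conjI allI impI)
    fix u v :: "real^4" assume uv: "norm u \<le> M" "norm v \<le> M"
    have n: "norm (u + v) \<le> 2 * M" "norm u \<le> 2 * M" "norm v \<le> 2 * M"
      using norm_triangle_ineq[of u v] uv norm_ge_zero[of u] norm_ge_zero[of v] by linarith+
    have "Gf gradF (u + v) - Gf gradF u - Gf gradF v =
        u \<bullet> (gradF (u + v) - gradF u) + v \<bullet> (gradF (u + v) - gradF v)"
      by (simp add: Gf_def inner_add_left inner_diff_right)
    then have "\<bar>Gf gradF (u + v) - Gf gradF u - Gf gradF v\<bar> \<le>
        \<bar>u \<bullet> (gradF (u + v) - gradF u)\<bar> + \<bar>v \<bullet> (gradF (u + v) - gradF v)\<bar>" by simp
    also have "\<dots> \<le> norm u * norm (gradF (u + v) - gradF u) + norm v * norm (gradF (u + v) - gradF v)"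
      by (intro add_mono Cauchy_Schwarz_ineq2)
    also have "\<dots> \<le> norm u * (L * norm ((u + v) - u)) + norm v * (L * norm ((u + v) - v))"
      by (intro add_mono mult_left_mono L(2) n) auto
    finally show "\<bar>Gf gradF (u + v) - Gf gradF u - Gf gradF v\<bar> \<le> 2 * L * (norm u * norm v)"
      by (simp add: algebra_simps)
    have "\<bar>Gf gradF u\<bar> \<le> norm u * norm (gradF u)" unfolding Gf_def by (rule Cauchy_Schwarz_ineq2)
    also have "\<dots> \<le> norm u * (L * norm u)" by (intro mult_left_mono L(3) n) auto
    also have "\<dots> = L * (norm u * norm u)" by simp
    also have "\<dots> \<le> 2 * L * (norm u * norm u)" using L(1) by (intro mult_right_mono) auto
    finally show "\<bar>Gf gradF u\<bar> \<le> 2 * L * (norm u * norm u)" .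
  qed (use L in simp)
qed

text \<open>Near 0 the Hessian has norm at most e, so \<open>gradF\<close>, which vanishes at 0, is
  bounded there by e |w|.\<close>

lemma G_small:
  assumes e: "e > 0"
  obtains \<delta> where "\<delta> > 0" "\<And>w. norm w \<le> \<delta> \<Longrightarrow> \<bar>Gf gradF w\<bar> \<le> e * (norm w * norm w)"
proof -
  have "isCont HessF 0" using Hess_cont by (simp add: continuous_on_eq_continuous_at)
  then obtain d where d: "d > 0" "\<And>w. norm w < d \<Longrightarrow> norm (HessF w) < e"
    using e unfolding continuous_at_eps_delta by (auto simp: dist_norm Hess_0)
  show ?thesis
  proof (rule that[of "d / 2"])
    show "d / 2 > 0" using d by simp
    fix w :: "real^4" assume w: "norm w \<le> d / 2"
    have H: "norm (HessF z) \<le> e" if "norm z \<le> d / 2" for z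
      using d(2)[of z] that d(1) by simp
    have "norm (gradF w - gradF 0) \<le> e * norm (w - 0)"
      by (rule grad_lipschitz[OF H w]) (use d in auto)
    then have "norm (gradF w) \<le> e * norm w" by (simp add: grad_0)
    then have "norm w * norm (gradF w) \<le> norm w * (e * norm w)" by (intro mult_left_mono) auto
    moreover have "\<bar>Gf gradF w\<bar> \<le> norm w * norm (gradF w)" unfolding Gf_def by (rule Cauchy_Schwarz_ineq2)
    ultimately show "\<bar>Gf gradF w\<bar> \<le> e * (norm w * norm w)" by (simp add: algebra_simps)
  qed
qed

definition R :: "real^4 \<Rightarrow> real" where
  "R w = (1 / (p + 2)) * Gf gradF w + (- 1) * F w"

lemma integrable_R: "bounded_L2 M U \<Longrightarrow> integrable lborel (\<lambda>x. R (U x))"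
  unfolding R_def by (intro Bochner_Integration.integrable_add integrable_mult_right
      quad_bounded_integral[OF quad_bounded_F] quad_bounded_integral[OF quad_bounded_G])

text \<open>The derivative along the ray is DG(xw)w / (p+2) - gradF(xw) . w. Condition (a) at xw,
  divided by x > 0, gives its sign; at x = 0 it vanishes because \<open>gradF 0 = 0\<close>.\<close>

lemma R_mono:
  assumes "0 \<le> s" "s \<le> t"
  shows "R (s *\<^sub>R w) \<le> R (t *\<^sub>R w)"
proof (rule DERIV_nonneg_imp_nondecreasing[OF assms(2)])
  fix x assume x: "s \<le> x" "x \<le> t"
  have line: "((\<lambda>t. t *\<^sub>R w) has_derivative (\<lambda>t. t *\<^sub>R w)) (at x)"
    by (auto intro!: derivative_eq_intros)
  have "((\<lambda>t. R (t *\<^sub>R w)) has_derivative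
      (\<lambda>t. (1 / (p + 2)) * DG (x *\<^sub>R w) (t *\<^sub>R w) + (- 1) * (gradF (x *\<^sub>R w) \<bullet> (t *\<^sub>R w)))) (at x)"
    unfolding R_def
    by (intro has_derivative_add has_derivative_mult_right has_derivative_compose[OF line G_deriv]
        has_derivative_compose[OF line F_deriv])
  moreover have "(\<lambda>t. (1 / (p + 2)) * DG (x *\<^sub>R w) (t *\<^sub>R w) + (- 1) * (gradF (x *\<^sub>R w) \<bullet> (t *\<^sub>R w))) =
      (*) ((1 / (p + 2)) * DG (x *\<^sub>R w) w - gradF (x *\<^sub>R w) \<bullet> w)"
    by (rule ext) (simp add: DG_def matrix_vector_mult_scaleR algebra_simps add_divide_distrib)
  ultimately have "((\<lambda>t. R (t *\<^sub>R w)) has_real_derivative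
      (1 / (p + 2)) * DG (x *\<^sub>R w) w - gradF (x *\<^sub>R w) \<bullet> w) (at x)"
    unfolding has_field_derivative_def by simp
  moreover have "0 \<le> (1 / (p + 2)) * DG (x *\<^sub>R w) w - gradF (x *\<^sub>R w) \<bullet> w"
  proof (cases "x = 0")
    case False
    then have x0: "x > 0" using x assms by simp
    have "(p + 1) * (x * (w \<bullet> gradF (x *\<^sub>R w))) \<le> x * (x * (w \<bullet> (HessF (x *\<^sub>R w) *v w)))"
      using superquad'[of "x *\<^sub>R w"] by (simp add: matrix_vector_mult_scaleR)
    then have "x * ((p + 1) * (w \<bullet> gradF (x *\<^sub>R w))) \<le> x * (x * (w \<bullet> (HessF (x *\<^sub>R w) *v w)))"
      by (simp add: algebra_simps)
    then have "(p + 1) * (w \<bullet> gradF (x *\<^sub>R w)) \<le> x * (w \<bullet> (HessF (x *\<^sub>R w) *v w))"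
      using x0 by (rule mult_left_le_imp_le)
    then have "(p + 2) * (gradF (x *\<^sub>R w) \<bullet> w) \<le> DG (x *\<^sub>R w) w"
      by (simp add: DG_def inner_commute algebra_simps)
    then show ?thesis using p_pos by (simp add: field_simps)
  qed (simp add: DG_def grad_0)
  ultimately show "\<exists>y. ((\<lambda>t. R (t *\<^sub>R w)) has_real_derivative y) (at x) \<and> 0 \<le> y" by blast
qed

lemma R_nonneg: "0 \<le> R w"
  using R_mono[of 0 1 w] by (simp add: R_def Gf_def F_0)

end

section \<open>The Nehari constraint\<close>

lemma bounded_L2_mono: "bounded_L2 M U \<Longrightarrow> M \<le> M' \<Longrightarrow> bounded_L2 M' U"
  unfolding bounded_L2_def by (auto elim: eventually_mono)

lemma bounded_L2_jet:
  assumes "Z \<in> H2_states" "8 * sqrt (nsq Z) \<le> M"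
  shows "bounded_L2 M (\<lambda>x. fst (Z x))"
proof (rule bounded_L2_mono[OF _ assms(2)])
  show "bounded_L2 (8 * sqrt (nsq Z)) (\<lambda>x. fst (Z x))"
    unfolding bounded_L2_def
    using jet_bound[OF assms(1)] square_int_bounded_linear[OF bounded_linear_fst H2_states_square_int[OF assms(1)]]
    by blast
qed

lemma ip_fst_le:
  assumes "square_int Z"
  shows "nsq (\<lambda>x. fst (Z x)) \<le> nsq Z"
  unfolding ip_def
  by (intro integral_mono integrable_inner_square_int square_int_bounded_linear[OF bounded_linear_fst] assms)
    (simp add: inner_prod_def)

text \<open>The quadratic part is abstracted to a symmetric coercive operator acting pointwise on
  states, so the coefficients and the speed enter only through \<open>T\<close> and
  \<open>\<kappa>\<close>.\<close>

locale variational = nonlinearity +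
  fixes T :: "state \<Rightarrow> state" and \<kappa> :: real
  assumes T_linear: "bounded_linear T"
    and T_sym: "T z \<bullet> z' = z \<bullet> T z'"
    and \<kappa>_pos: "\<kappa> > 0"
    and T_coercive: "\<kappa> * (z \<bullet> z) \<le> T z \<bullet> z"
begin

definition I :: "(real \<Rightarrow> state) \<Rightarrow> real" where
  "I Z = ip (\<lambda>x. T (Z x)) Z"

definition K :: "(real \<Rightarrow> state) \<Rightarrow> real" where
  "K Z = (LBINT x. F (fst (Z x)))"

definition N :: "(real \<Rightarrow> state) \<Rightarrow> real" where
  "N Z = (LBINT x. Gf gradF (fst (Z x)))"

definition J :: "(real \<Rightarrow> state) \<Rightarrow> real" where
  "J Z = I Z / 2 - K Z"

definition P :: "(real \<Rightarrow> state) \<Rightarrow> real" where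
  "P Z = I Z - N Z"

definition Q :: "(real \<Rightarrow> state) \<Rightarrow> real" where
  "Q Z = J Z - P Z / (p + 2)"

definition nehari :: "(real \<Rightarrow> state) set" where
  "nehari = {Z \<in> H2_states. nsq Z \<noteq> 0 \<and> P Z = 0}"

lemma T_square_int: "square_int Z \<Longrightarrow> square_int (\<lambda>x. T (Z x))"
  by (rule square_int_bounded_linear[OF T_linear])

lemma T_ip_sym: "ip (\<lambda>x. T (Z x)) Y = ip (\<lambda>x. T (Y x)) Z"
  unfolding ip_def using T_sym by (intro Bochner_Integration.integral_cong refl) (metis inner_commute)

lemma I_coercive:
  assumes "square_int Z"
  shows "\<kappa> * nsq Z \<le> I Z"
proof -
  have "\<kappa> * nsq Z = (LBINT x. \<kappa> * (Z x \<bullet> Z x))" by (simp add: ip_def)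
  also have "\<dots> \<le> I Z"
    unfolding I_def ip_def
    by (intro integral_mono integrable_mult_right integrable_inner_square_int T_square_int assms T_coercive)
  finally show ?thesis .
qed

lemma I_nonneg: "square_int Z \<Longrightarrow> 0 \<le> I Z"
  using I_coercive[of Z] \<kappa>_pos ip_self_nonneg[of Z] by (meson mult_nonneg_nonneg less_imp_le order_trans)

lemma I_add:
  assumes Z: "square_int Z" and Y: "square_int Y"
  shows "I (\<lambda>x. Z x + t *\<^sub>R Y x) = I Z + 2 * t * ip (\<lambda>x. T (Z x)) Y + t\<^sup>2 * I Y"
proof -
  interpret T: bounded_linear T by (rule T_linear)
  have tY: "square_int (\<lambda>x. t *\<^sub>R Y x)" by (rule square_int_scaleR[OF Y])
  have S: "square_int (\<lambda>x. Z x + t *\<^sub>R Y x)" by (rule square_int_add[OF Z tY])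
  have "I (\<lambda>x. Z x + t *\<^sub>R Y x) = ip (\<lambda>x. T (Z x + t *\<^sub>R Y x)) Z + ip (\<lambda>x. T (Z x + t *\<^sub>R Y x)) (\<lambda>x. t *\<^sub>R Y x)"
    unfolding I_def by (rule ip_add_right[OF T_square_int[OF S] Z tY])
  also have "\<dots> = ip (\<lambda>x. T (Z x)) (\<lambda>x. Z x + t *\<^sub>R Y x) + t * ip (\<lambda>x. T (Y x)) (\<lambda>x. Z x + t *\<^sub>R Y x)"
    unfolding ip_scaleR_right by (simp only: T_ip_sym[where Z = "\<lambda>x. Z x + t *\<^sub>R Y x"])
  also have "\<dots> = (ip (\<lambda>x. T (Z x)) Z + t * ip (\<lambda>x. T (Z x)) Y) + t * (ip (\<lambda>x. T (Y x)) Z + t * ip (\<lambda>x. T (Y x)) Y)"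
    unfolding ip_add_right[OF T_square_int[OF Z] Z tY] ip_add_right[OF T_square_int[OF Y] Z tY] ip_scaleR_right ..
  finally show ?thesis
    unfolding T_ip_sym[of Y Z] by (simp add: I_def power2_eq_square algebra_simps)
qed

lemma I_scaleR: "I (\<lambda>x. t *\<^sub>R Z x) = t\<^sup>2 * I Z"
proof -
  interpret T: bounded_linear T by (rule T_linear)
  show ?thesis by (simp add: I_def ip_def T.scaleR power2_eq_square)
qed

lemma jet_L2: "Z \<in> H2_states \<Longrightarrow> bounded_L2 (8 * sqrt (nsq Z)) (\<lambda>x. fst (Z x))"
  by (rule bounded_L2_jet) simp_all

text \<open>The coefficient of I is 1/2 - 1/(p+2): one half from J, the rest from the multiple of
  P.\<close>

lemma Q_eq:
  assumes "Z \<in> H2_states"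
  shows "Q Z = p / (2 * (p + 2)) * I Z + (LBINT x. R (fst (Z x)))"
proof -
  have "(LBINT x. R (fst (Z x))) = 1 / (p + 2) * N Z + (- 1) * K Z"
    unfolding R_def N_def K_def
    using quad_bounded_integral[OF quad_bounded_F jet_L2[OF assms]] quad_bounded_integral[OF quad_bounded_G jet_L2[OF assms]]
    by simp
  then show ?thesis using p_pos by (simp add: Q_def J_def P_def field_simps)
qed

lemma integral_R_nonneg: "0 \<le> (LBINT x. R (fst (Z x)))"
  by (rule integral_nonneg_AE) (simp add: R_nonneg)

lemma Q_ge:
  assumes "Z \<in> H2_states"
  shows "p / (2 * (p + 2)) * I Z \<le> Q Z"
  using Q_eq[OF assms] integral_R_nonneg[of Z] by linarith

text \<open>Applied with e = \<open>\<kappa>\<close> / 2, it makes N strictly smaller than I on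
  nonzero states with small jets. This both starts the rescaling below and excludes vanishing of
  minimizing sequences.\<close>

lemma N_le:
  assumes "Z \<in> H2_states" "AE x in lborel. norm (fst (Z x)) \<le> \<delta>"
    and small: "\<And>w. norm w \<le> \<delta> \<Longrightarrow> \<bar>Gf gradF w\<bar> \<le> e * (norm w * norm w)" and e: "e \<ge> 0"
  shows "N Z \<le> e * nsq Z"
proof -
  have Z: "square_int Z" using assms(1) by (rule H2_states_square_int)
  have fZ: "square_int (\<lambda>x. fst (Z x))" by (rule square_int_bounded_linear[OF bounded_linear_fst Z])
  have "N Z \<le> (LBINT x. e * (norm (fst (Z x)) * norm (fst (Z x))))"
    unfolding N_def
  proof (rule integral_mono_AE)
    show "AE x in lborel. Gf gradF (fst (Z x)) \<le> e * (norm (fst (Z x)) * norm (fst (Z x)))"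
      using assms(2) by eventually_elim (use small in \<open>auto intro: order_trans[OF abs_ge_self]\<close>)
  qed (intro quad_bounded_integral[OF quad_bounded_G jet_L2[OF assms(1)]] integrable_mult_right integrable_norm_square fZ)+
  also have "\<dots> = e * nsq (\<lambda>x. fst (Z x))" by (simp add: integral_norm_square)
  also have "\<dots> \<le> e * nsq Z" by (intro mult_left_mono ip_fst_le Z e)
  finally show ?thesis .
qed

lemma functional_cong_AE:
  assumes "AE x in lborel. Z x = Z' x" "square_int Z" "square_int Z'"
  shows "I Z = I Z'" "K Z = K Z'" "N Z = N Z'" "nsq Z = nsq Z'"
proof -
  have f: "square_int (\<lambda>x. fst (Z x))" "square_int (\<lambda>x. fst (Z' x))"
    using assms(2,3) by (auto intro: square_int_bounded_linear[OF bounded_linear_fst])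
  note m = borel_measurable_integrable[OF integrable_inner_square_int]
  show "I Z = I Z'" unfolding I_def ip_def
    by (intro integral_cong_AE m T_square_int assms) (use assms(1) in \<open>auto elim: eventually_mono\<close>)
  show "nsq Z = nsq Z'" unfolding ip_def
    by (intro integral_cong_AE m assms) (use assms(1) in \<open>auto elim: eventually_mono\<close>)
  show "K Z = K Z'" unfolding K_def
    by (intro integral_cong_AE quad_bounded_measurable[OF quad_bounded_F] f) (use assms(1) in \<open>auto elim: eventually_mono\<close>)
  show "N Z = N Z'" unfolding N_def
    by (intro integral_cong_AE quad_bounded_measurable[OF quad_bounded_G] f) (use assms(1) in \<open>auto elim: eventually_mono\<close>)
qed

lemma functional_shift: "I (\<lambda>x. Z (x + y)) = I Z" "K (\<lambda>x. Z (x + y)) = K Z" "N (\<lambda>x. Z (x + y)) = N Z"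
    "nsq (\<lambda>x. Z (x + y)) = nsq Z"
  using lborel_integral_shift[of "\<lambda>x. T (Z x) \<bullet> Z x" y] lborel_integral_shift[of "\<lambda>x. F (fst (Z x))" y]
    lborel_integral_shift[of "\<lambda>x. Gf gradF (fst (Z x))" y] lborel_integral_shift[of "\<lambda>x. Z x \<bullet> Z x" y]
  by (simp_all add: I_def K_def N_def ip_def)

lemma P_eq_0_of_zero:
  assumes "Z \<in> H2_states" "nsq Z = 0"
  shows "P Z = 0"
proof -
  have Z: "square_int Z" using assms(1) by (rule H2_states_square_int)
  interpret T: bounded_linear T by (rule T_linear)
  have "AE x in lborel. Z x = 0" using assms(2) ip_self_eq_0_iff[OF Z] by simp
  from functional_cong_AE[OF this Z square_int_zero]
  show ?thesis by (simp add: P_def I_def N_def ip_def Gf_def)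
qed

text \<open>P(tZ) is positive for small t, where the quadratic part dominates, and negative at t =
  1; the intermediate value theorem gives a zero in between.\<close>

lemma nehari_rescale:
  assumes Z: "Z \<in> H2_states" and neg: "P Z < 0"
  obtains t where "0 < t" "t < 1" "(\<lambda>x. t *\<^sub>R Z x) \<in> nehari"
proof -
  have sq: "square_int Z" using Z by (rule H2_states_square_int)
  have pos: "nsq Z > 0"
    using P_eq_0_of_zero[OF Z] neg ip_self_nonneg[of Z] by (cases "nsq Z = 0") auto
  define M where "M = 8 * sqrt (nsq Z)"
  have M: "M > 0" using pos by (simp add: M_def)
  obtain \<delta> where \<delta>: "\<delta> > 0" "\<And>w. norm w \<le> \<delta> \<Longrightarrow> \<bar>Gf gradF w\<bar> \<le> (\<kappa> / 2) * (norm w * norm w)"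
    using G_small[of "\<kappa> / 2"] \<kappa>_pos by auto
  \<comment> \<open>\<open>\<delta>\<close> / M brings the jet of sZ below \<open>\<delta>\<close>;
    1/2 keeps s below 1.\<close>
  define s where "s = min (1 / 2) (\<delta> / M)"
  have s: "0 < s" "s < 1" "s * M \<le> \<delta>"
    using \<delta>(1) M by (auto simp: s_def min_def field_simps split: if_splits)
  define g where "g t = t\<^sup>2 * I Z - (LBINT x. Gf gradF (t *\<^sub>R fst (Z x)))" for t
  have g_eq: "g t = P (\<lambda>x. t *\<^sub>R Z x)" for t by (simp add: g_def P_def I_scaleR N_def)
  have "continuous_on {0..1} g"
    unfolding g_def by (intro continuous_intros quad_bounded_scale_continuous[OF quad_bounded_G jet_L2[OF Z]])
  then have cont: "continuous_on {s..1} g" by (rule continuous_on_subset) (use s in auto)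
  have "g s > 0"
  proof -
    have "AE x in lborel. norm (fst (s *\<^sub>R Z x)) \<le> \<delta>"
      using jet_bound[OF Z]
    proof eventually_elim
      case (elim x)
      then have "s * norm (fst (Z x)) \<le> s * M" using s by (intro mult_left_mono) (auto simp: M_def)
      with s(3) have "s * norm (fst (Z x)) \<le> \<delta>" by linarith
      then show ?case using s by simp
    qed
    from N_le[OF H2_states_scaleR[OF Z] this \<delta>(2)] \<kappa>_pos
    have "N (\<lambda>x. s *\<^sub>R Z x) \<le> \<kappa> / 2 * nsq (\<lambda>x. s *\<^sub>R Z x)" by simp
    also have "\<dots> = s\<^sup>2 * (\<kappa> * nsq Z / 2)" by (simp add: ip_def power2_eq_square)
    also have "\<dots> < s\<^sup>2 * (\<kappa> * nsq Z)" using s pos \<kappa>_pos by (intro mult_strict_left_mono) auto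
    also have "\<dots> \<le> s\<^sup>2 * I Z" by (intro mult_left_mono I_coercive sq) simp
    finally show ?thesis by (simp add: g_eq P_def I_scaleR)
  qed
  moreover have "g 1 < 0" using neg by (simp add: g_eq)
  ultimately obtain t where t: "s \<le> t" "t \<le> 1" "g t = 0"
    using IVT2'[of g 1 0 s] cont s by auto
  have "t \<noteq> 1" using t \<open>g 1 < 0\<close> by auto
  then have t': "0 < t" "t < 1" using t s by auto
  have "nsq (\<lambda>x. t *\<^sub>R Z x) = t\<^sup>2 * nsq Z" by (simp add: ip_def power2_eq_square)
  then have "(\<lambda>x. t *\<^sub>R Z x) \<in> nehari"
    using t t' pos H2_states_scaleR[OF Z] by (simp add: nehari_def g_eq)
  with t' show ?thesis by (rule that)
qed

definition S :: real where "S = Inf (J ` nehari)"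

lemma Q_nehari: "Z \<in> nehari \<Longrightarrow> Q Z = J Z"
  by (simp add: nehari_def Q_def)

text \<open>On the Nehari set J coincides with Q, which is nonnegative, so the infimum is taken over
  a set bounded below.\<close>

lemma S_le: "Z \<in> nehari \<Longrightarrow> S \<le> J Z"
  unfolding S_def
proof (rule cInf_lower)
  show "bdd_below (J ` nehari)"
  proof (rule bdd_belowI2)
    fix Z assume Z: "Z \<in> nehari"
    then have H: "Z \<in> H2_states" by (simp add: nehari_def)
    have "0 \<le> p / (2 * (p + 2)) * I Z"
      using p_pos I_nonneg[OF H2_states_square_int[OF H]] by simp
    also have "\<dots> \<le> J Z" using Q_ge[OF H] by (simp add: Q_nehari[OF Z])
    finally show "0 \<le> J Z" .
  qed
qed simp

text \<open>The rescaling factor is less than 1 and does not raise Q: both t^2 I and the integral of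
  R are nondecreasing in t.\<close>

lemma S_le_Q:
  assumes Z: "Z \<in> H2_states" and ne: "nsq Z \<noteq> 0" and le: "P Z \<le> 0"
  shows "S \<le> Q Z"
proof (cases "P Z = 0")
  case True
  then have "Z \<in> nehari" using Z ne by (simp add: nehari_def)
  then show ?thesis using S_le Q_nehari by simp
next
  case False
  then have "P Z < 0" using le by simp
  then obtain t where t: "0 < t" "t < 1" and n: "(\<lambda>x. t *\<^sub>R Z x) \<in> nehari"
    using nehari_rescale[OF Z] by blast
  have H: "(\<lambda>x. t *\<^sub>R Z x) \<in> H2_states" by (rule H2_states_scaleR[OF Z])
  have "S \<le> Q (\<lambda>x. t *\<^sub>R Z x)" using S_le[OF n] Q_nehari[OF n] by simp
  also have "\<dots> = p / (2 * (p + 2)) * (t\<^sup>2 * I Z) + (LBINT x. R (t *\<^sub>R fst (Z x)))"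
    by (simp add: Q_eq[OF H] I_scaleR)
  also have "\<dots> \<le> p / (2 * (p + 2)) * I Z + (LBINT x. R (fst (Z x)))"
  proof (rule add_mono)
    have "t\<^sup>2 * I Z \<le> 1 * I Z"
      using t I_nonneg[OF H2_states_square_int[OF Z]] by (intro mult_right_mono) (auto simp: power_le_one)
    then show "p / (2 * (p + 2)) * (t\<^sup>2 * I Z) \<le> p / (2 * (p + 2)) * I Z"
      using p_pos by (intro mult_left_mono) auto
    show "(LBINT x. R (t *\<^sub>R fst (Z x))) \<le> (LBINT x. R (fst (Z x)))"
    proof (rule integral_mono)
      show "integrable lborel (\<lambda>x. R (t *\<^sub>R fst (Z x)))"
        using integrable_R[OF jet_L2[OF H]] by simp
      show "integrable lborel (\<lambda>x. R (fst (Z x)))"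
        by (rule integrable_R[OF jet_L2[OF Z]])
      show "R (t *\<^sub>R fst (Z x)) \<le> R (fst (Z x))" for x
        using R_mono[of t 1 "fst (Z x)"] t by simp
    qed
  qed
  finally show ?thesis by (simp add: Q_eq[OF Z])
qed

end

section \<open>Compactness of minimizing sequences\<close>

context variational
begin

text \<open>If all averages of a member were small, its jet would be small a.e. and N would be less
  than I, against P = 0. Averages are used instead of point values because after translation they
  are continuous under weak convergence.\<close>

lemma nonvanishing:
  assumes Zs: "\<And>n. Zs n \<in> nehari" and bd: "\<And>n. nsq (Zs n) \<le> B"
  obtains d \<delta> :: real and y :: "nat \<Rightarrow> real" where "d > 0" "\<delta> > 0" "\<And>n. norm (jet_average d (Zs n) (y n)) > \<delta>"
proof -
  obtain \<delta> where \<delta>: "\<delta> > 0" "\<And>w. norm w \<le> \<delta> \<Longrightarrow> \<bar>Gf gradF w\<bar> \<le> (\<kappa> / 2) * (norm w * norm w)"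
    using G_small[of "\<kappa> / 2"] \<kappa>_pos by auto
  define m where "m = sqrt \<bar>B\<bar> + 1"
  have m: "m > 0" by (simp add: m_def add_nonneg_pos)
  \<comment> \<open>Chosen so that 4 sqrt d m = \<open>\<delta>\<close> / 2: half of
    \<open>\<delta>\<close> for the average, half for the distance to it.\<close>
  define d where "d = (\<delta> / (8 * m))\<^sup>2"
  have d: "d > 0" using \<delta>(1) m by (simp add: d_def)
  have sd: "4 * sqrt d * m = \<delta> / 2"
    using \<delta>(1) m by (simp add: d_def)
  have "\<exists>y. norm (jet_average d (Zs n) y) > \<delta> / 2" for n
  proof (rule ccontr)
    assume "\<not> ?thesis"
    then have avg: "norm (jet_average d (Zs n) y) \<le> \<delta> / 2" for y by (simp add: not_less)
    have H: "Zs n \<in> H2_states" and ne: "nsq (Zs n) \<noteq> 0" and P0: "P (Zs n) = 0"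
      using Zs[of n] by (auto simp: nehari_def)
    have "sqrt (nsq (Zs n)) \<le> sqrt \<bar>B\<bar>" using bd[of n] by (intro real_sqrt_le_mono) simp
    then have "sqrt (nsq (Zs n)) \<le> m" unfolding m_def by linarith
    then have close: "4 * sqrt d * sqrt (nsq (Zs n)) \<le> \<delta> / 2"
      unfolding sd[symmetric] using d by (intro mult_left_mono) auto
    have "AE x in lborel. norm (fst (Zs n x)) \<le> \<delta>"
      using jet_average_close[OF H]
    proof eventually_elim
      case (elim x)
      then have "norm (fst (Zs n x) - jet_average d (Zs n) x) \<le> 4 * sqrt d * sqrt (nsq (Zs n))"
        using d by blast
      then show ?case
        using norm_triangle_sub[of "fst (Zs n x)" "jet_average d (Zs n) x"] avg[of x] close by linarith
    qed
    from N_le[OF H this \<delta>(2)] \<kappa>_pos have "N (Zs n) \<le> \<kappa> / 2 * nsq (Zs n)" by simp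
    moreover have "\<kappa> * nsq (Zs n) \<le> I (Zs n)" by (rule I_coercive[OF H2_states_square_int[OF H]])
    moreover have "\<kappa> * nsq (Zs n) > 0" using ne ip_self_nonneg[of "Zs n"] \<kappa>_pos by simp
    ultimately show False using P0 by (simp add: P_def)
  qed
  then obtain y where "\<And>n. norm (jet_average d (Zs n) (y n)) > \<delta> / 2" by metis
  with d \<delta>(1) show ?thesis using that[of d "\<delta> / 2" y] by simp
qed

text \<open>For I only the cross term 2 ip(TZ)(D n) remains, and it vanishes by weak convergence. K
  and N are not quadratic and need the a.e. convergence of the jets.\<close>

lemma splitting:
  assumes Zs: "\<And>n. Zs n \<in> H2_states" and bd: "\<And>n. nsq (Zs n) \<le> B" and Z: "Z \<in> H2_states"
    and wlim: "\<forall>\<phi>. square_int \<phi> \<longrightarrow> (\<lambda>n. ip \<phi> (Zs n)) \<longlonglongrightarrow> ip \<phi> Z"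
  shows "(\<lambda>n. I (Zs n) - I Z - I (\<lambda>x. Zs n x - Z x)) \<longlonglongrightarrow> 0"
    "(\<lambda>n. K (Zs n) - K Z - K (\<lambda>x. Zs n x - Z x)) \<longlonglongrightarrow> 0"
    "(\<lambda>n. N (Zs n) - N Z - N (\<lambda>x. Zs n x - Z x)) \<longlonglongrightarrow> 0"
    "\<exists>B'. \<forall>n. nsq (\<lambda>x. Zs n x - Z x) \<le> B'"
proof -
  have lim: "(\<lambda>n. ip \<phi> (Zs n)) \<longlonglongrightarrow> ip \<phi> Z" if "square_int \<phi>" for \<phi> using wlim that by blast
  have sq: "square_int Z" "square_int (Zs n)" for n using Z Zs by (auto intro: H2_states_square_int)
  define D where "D n x = Zs n x - Z x" for n x
  have DH: "D n \<in> H2_states" for n unfolding D_def[abs_def] by (rule H2_states_diff[OF Zs Z])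
  have Dsq: "square_int (D n)" for n by (rule H2_states_square_int[OF DH])
  define B' where "B' = 2 * B + 2 * nsq Z"
  have DB: "nsq (D n) \<le> B'" for n
    unfolding D_def[abs_def] parallelogram_ip[OF sq(2) sq(1)] B'_def
    using bd[of n] ip_self_nonneg[of "\<lambda>x. (1/2) *\<^sub>R (Zs n x + Z x)"] by linarith
  then show "\<exists>B'. \<forall>n. nsq (\<lambda>x. Zs n x - Z x) \<le> B'"
    unfolding D_def[abs_def] by blast
  have Ieq: "I (Zs n) - I Z - I (D n) = 2 * (ip (\<lambda>x. T (Z x)) (Zs n) - ip (\<lambda>x. T (Z x)) Z)" for n
    using I_add[OF sq(1) Dsq[of n], of 1] ip_diff_right[OF T_square_int[OF sq(1)] sq(2)[of n] sq(1)]
    by (simp add: D_def[abs_def])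
  have "(\<lambda>n. 2 * (ip (\<lambda>x. T (Z x)) (Zs n) - ip (\<lambda>x. T (Z x)) Z)) \<longlonglongrightarrow> 2 * (ip (\<lambda>x. T (Z x)) Z - ip (\<lambda>x. T (Z x)) Z)"
    by (intro tendsto_intros lim T_square_int sq)
  then show "(\<lambda>n. I (Zs n) - I Z - I (\<lambda>x. Zs n x - Z x)) \<longlonglongrightarrow> 0"
    using Ieq by (simp add: D_def[abs_def])
  define M where "M = 8 * sqrt (nsq Z) + 8 * sqrt \<bar>B'\<bar>"
  have MZ: "bounded_L2 M (\<lambda>x. fst (Z x))"
    by (rule bounded_L2_jet[OF Z]) (simp add: M_def)
  have MD: "bounded_L2 M (\<lambda>x. fst (D n x))" for n
  proof (rule bounded_L2_jet[OF DH])
    have "sqrt (nsq (D n)) \<le> sqrt \<bar>B'\<bar>" using DB[of n] by (intro real_sqrt_le_mono) simp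
    then show "8 * sqrt (nsq (D n)) \<le> M" using real_sqrt_ge_zero[OF ip_self_nonneg[of Z]] unfolding M_def by linarith
  qed
  have fD: "nsq (\<lambda>x. fst (D n x)) \<le> B'" for n
    using ip_fst_le[OF Dsq[of n]] DB[of n] by linarith
  have "AE x in lborel. (\<lambda>n. fst (Zs n x)) \<longlonglongrightarrow> fst (Z x)"
    by (rule jet_tendsto_AE[where B = B]) (fact Zs bd Z lim)+
  then have lim0: "AE x in lborel. (\<lambda>n. fst (D n x)) \<longlonglongrightarrow> 0"
  proof eventually_elim
    case (elim x)
    from tendsto_diff[OF elim tendsto_const[of "fst (Z x)"]] show ?case by (simp add: D_def)
  qed
  have add: "fst (Z x) + fst (D n x) = fst (Zs n x)" for n x by (simp add: D_def)
  show "(\<lambda>n. K (Zs n) - K Z - K (\<lambda>x. Zs n x - Z x)) \<longlonglongrightarrow> 0"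
    using quad_bounded_splitting[OF quad_bounded_F MZ MD fD lim0]
    unfolding add K_def by (simp only: D_def)
  show "(\<lambda>n. N (Zs n) - N Z - N (\<lambda>x. Zs n x - Z x)) \<longlonglongrightarrow> 0"
    using quad_bounded_splitting[OF quad_bounded_G MZ MD fD lim0]
    unfolding add N_def by (simp only: D_def)
qed

theorem minimizing_sequence_compact:
  assumes Zs: "\<And>n. Zs n \<in> nehari" and min: "(\<lambda>n. J (Zs n)) \<longlonglongrightarrow> S"
  obtains r :: "nat \<Rightarrow> nat" and y :: "nat \<Rightarrow> real" and Z where "strict_mono r" "Z \<in> nehari" "J Z = S"
    "(\<lambda>n. nsq (\<lambda>x. Zs (r n) (x + y n) - Z x)) \<longlonglongrightarrow> 0"
proof -
  define \<theta> where "\<theta> = p / (2 * (p + 2))"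
  have \<theta>: "\<theta> > 0" using p_pos by (simp add: \<theta>_def)
  have H: "Zs n \<in> H2_states" and P0: "P (Zs n) = 0" for n using Zs[of n] by (auto simp: nehari_def)
  obtain C where C: "\<And>n. \<bar>J (Zs n)\<bar> \<le> C"
    using convergent_imp_Bseq[OF convergentI[OF min]] by (auto simp: Bseq_def)
  \<comment> \<open>From \<open>\<theta>\<close> \<open>\<kappa>\<close> nsq <=
    \<open>\<theta>\<close> I <= Q = J <= C.\<close>
  define B where "B = C / (\<theta> * \<kappa>)"
  have bd: "nsq (Zs n) \<le> B" for n
  proof -
    have "\<theta> * (\<kappa> * nsq (Zs n)) \<le> \<theta> * I (Zs n)"
      using \<theta> by (intro mult_left_mono I_coercive H2_states_square_int H) auto
    also have "\<dots> \<le> J (Zs n)" using Q_ge[OF H] Q_nehari[OF Zs] by (simp add: \<theta>_def)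
    also have "\<dots> \<le> C" using C[of n] by simp
    finally show ?thesis using \<theta> \<kappa>_pos by (simp add: B_def field_simps)
  qed
  obtain d \<delta> :: real and y where d: "d > 0" and \<delta>: "\<delta> > 0" and y: "\<And>n. norm (jet_average d (Zs n) (y n)) > \<delta>"
    by (rule nonvanishing[where Zs = Zs, OF Zs bd]) (rule that)
  define Y where "Y n x = Zs n (x + y n)" for n x
  have YH: "Y n \<in> H2_states" for n unfolding Y_def[abs_def] by (rule H2_states_shift[OF H])
  have Yf: "I (Y n) = I (Zs n)" "K (Y n) = K (Zs n)" "N (Y n) = N (Zs n)" "nsq (Y n) = nsq (Zs n)" for n
    unfolding Y_def[abs_def] by (rule functional_shift)+
  obtain r Z where r: "strict_mono r" and Zsq: "square_int Z"
    and wlim: "\<And>\<phi>. square_int \<phi> \<Longrightarrow> (\<lambda>n. ip \<phi> (Y (r n))) \<longlonglongrightarrow> ip \<phi> Z"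
    by (rule weakly_convergent_subsequence[of Y B, OF H2_states_square_int[OF YH]]) (use bd Yf in \<open>auto intro: that\<close>)
  have ZH: "Z \<in> H2_states" by (rule H2_states_weak_limit[where Zs = "\<lambda>n. Y (r n)", OF YH Zsq wlim])
  \<comment> \<open>The averages at 0 of the translated sequence exceed \<open>\<delta>\<close> in
    norm and converge to the average of Z.\<close>
  have ne: "nsq Z \<noteq> 0"
  proof
    assume "nsq Z = 0"
    then have "jet_average d Z 0 = 0" using jet_average_bound[OF Zsq d, of 0] by simp
    moreover have "(\<lambda>n. norm (jet_average d (Y (r n)) 0)) \<longlonglongrightarrow> norm (jet_average d Z 0)"
      by (intro tendsto_norm jet_average_tendsto[where Zs = "\<lambda>n. Y (r n)", OF wlim d])
    moreover have "\<delta> \<le> norm (jet_average d (Y (r n)) 0)" for n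
      using y[of "r n"] unfolding Y_def[abs_def] jet_average_shift by simp
    ultimately have "\<delta> \<le> 0" using LIMSEQ_le_const[of _ "norm (jet_average d Z 0)" \<delta>] by force
    then show False using \<delta> by simp
  qed
  define D where "D n x = Y (r n) x - Z x" for n x
  have DH: "D n \<in> H2_states" for n unfolding D_def[abs_def] by (rule H2_states_diff[OF YH ZH])
  have Dsq: "square_int (D n)" for n by (rule H2_states_square_int[OF DH])
  have bdY: "nsq (Y (r n)) \<le> B" for n using bd Yf by simp
  have D_eq: "(\<lambda>x. Y (r n) x - Z x) = D n" for n by (simp add: D_def[abs_def])
  have "\<forall>\<phi>. square_int \<phi> \<longrightarrow> (\<lambda>n. ip \<phi> (Y (r n))) \<longlonglongrightarrow> ip \<phi> Z" using wlim by blast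
  note sp = splitting[where Zs = "\<lambda>n. Y (r n)" and Z = Z, OF YH bdY ZH this, unfolded D_eq]
  have PY: "P (Y n) = 0" for n using P0[of n] by (simp add: P_def Yf)
  \<comment> \<open>Linear in I, N and K, so that the three splittings combine.\<close>
  have Q_expand: "Q X = \<theta> * I X + (N X / (p + 2) - K X)" for X
  proof -
    have \<theta>': "\<theta> = 1 / 2 - 1 / (p + 2)" using p_pos by (simp add: \<theta>_def field_simps)
    show ?thesis unfolding \<theta>' Q_def J_def P_def by (simp add: algebra_simps diff_divide_distrib)
  qed
  have Plim: "(\<lambda>n. P (D n)) \<longlonglongrightarrow> - P Z"
  proof -
    have "(\<lambda>n. - P Z - (I (Y (r n)) - I Z - I (D n)) + (N (Y (r n)) - N Z - N (D n))) \<longlonglongrightarrow> - P Z - 0 + 0"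
      by (intro tendsto_add tendsto_diff tendsto_const sp)
    moreover have "- P Z - (I (Y (r n)) - I Z - I (D n)) + (N (Y (r n)) - N Z - N (D n)) = P (D n)" for n
      using PY[of "r n"] by (simp add: P_def)
    ultimately show ?thesis by simp
  qed
  have Qlim: "(\<lambda>n. Q (D n)) \<longlonglongrightarrow> S - Q Z"
  proof -
    have "(\<lambda>n. J (Y (r n)) - Q Z - \<theta> * (I (Y (r n)) - I Z - I (D n)) - (N (Y (r n)) - N Z - N (D n)) / (p + 2)
        + (K (Y (r n)) - K Z - K (D n))) \<longlonglongrightarrow> S - Q Z - \<theta> * 0 - 0 / (p + 2) + 0"
      using LIMSEQ_subseq_LIMSEQ[OF min r] p_pos
      by (intro tendsto_intros sp) (auto simp: o_def J_def Yf)
    moreover have "J (Y (r n)) - Q Z - \<theta> * (I (Y (r n)) - I Z - I (D n)) - (N (Y (r n)) - N Z - N (D n)) / (p + 2)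
        + (K (Y (r n)) - K Z - K (D n)) = Q (D n)" for n
    proof -
      have "J (Y (r n)) = Q (Y (r n))" using PY by (simp add: Q_def)
      then show ?thesis unfolding Q_expand by (simp add: algebra_simps diff_divide_distrib add_divide_distrib)
    qed
    ultimately show ?thesis by simp
  qed
  have PZ: "P Z \<le> 0"
  proof (rule ccontr)
    assume "\<not> P Z \<le> 0"
    then have "\<forall>\<^sub>F n in sequentially. P (D n) < 0" using order_tendstoD(2)[OF Plim, of 0] by simp
    then have "\<forall>\<^sub>F n in sequentially. S \<le> Q (D n)"
    proof eventually_elim
      case (elim n)
      then have "nsq (D n) \<noteq> 0" using P_eq_0_of_zero[OF DH] by fastforce
      then show ?case using S_le_Q[OF DH] elim by simp
    qed
    then have "S \<le> S - Q Z" by (rule tendsto_lowerbound[OF Qlim]) simp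
    then have "\<theta> * I Z \<le> 0" using Q_ge[OF ZH] by (simp add: \<theta>_def)
    then have "I Z \<le> 0" using \<theta> by (simp add: mult_le_0_iff)
    then have "\<kappa> * nsq Z \<le> 0" using I_coercive[OF Zsq] by simp
    then show False using \<kappa>_pos ne ip_self_nonneg[of Z] by (simp add: mult_le_0_iff)
  qed
  have SQ: "S \<le> Q Z" by (rule S_le_Q[OF ZH ne PZ])
  \<comment> \<open>Q Z = S is not yet known. Adding Q Z - S >= 0 to Q(D n) keeps an upper bound for
    \<open>\<theta>\<close> I(D n) and makes the limit exactly 0.\<close>
  have Ilim: "(\<lambda>n. I (D n)) \<longlonglongrightarrow> 0"
  proof (rule real_tendsto_sandwich[of "\<lambda>n. 0"])
    show "\<forall>\<^sub>F n in sequentially. 0 \<le> I (D n)" using I_nonneg[OF Dsq] by simp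
    show "\<forall>\<^sub>F n in sequentially. I (D n) \<le> (Q (D n) + (Q Z - S)) / \<theta>"
    proof (rule always_eventually, rule allI)
      fix n
      have "\<theta> * I (D n) \<le> Q (D n) + (Q Z - S)" using Q_ge[OF DH[of n]] SQ by (simp add: \<theta>_def)
      then show "I (D n) \<le> (Q (D n) + (Q Z - S)) / \<theta>" using \<theta> by (simp add: field_simps)
    qed
    have "(\<lambda>n. (Q (D n) + (Q Z - S)) / \<theta>) \<longlonglongrightarrow> ((S - Q Z) + (Q Z - S)) / \<theta>"
      using \<theta> by (intro tendsto_intros Qlim) auto
    then show "(\<lambda>n. (Q (D n) + (Q Z - S)) / \<theta>) \<longlonglongrightarrow> 0" by simp
  qed simp
  have iplim: "(\<lambda>n. nsq (D n)) \<longlonglongrightarrow> 0"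
  proof (rule real_tendsto_sandwich[of "\<lambda>n. 0"])
    show "\<forall>\<^sub>F n in sequentially. 0 \<le> nsq (D n)" by (simp add: ip_self_nonneg)
    show "\<forall>\<^sub>F n in sequentially. nsq (D n) \<le> I (D n) / \<kappa>"
      using I_coercive[OF Dsq] \<kappa>_pos by (simp add: field_simps)
    show "(\<lambda>n. I (D n) / \<kappa>) \<longlonglongrightarrow> 0" using tendsto_divide[OF Ilim tendsto_const[of \<kappa>]] \<kappa>_pos by simp
  qed simp
  obtain B' where B': "\<And>n. nsq (D n) \<le> B'" using sp(4) by blast
  have fD: "bounded_L2 (8 * sqrt B') (\<lambda>x. fst (D n x))" for n
    by (rule bounded_L2_jet[OF DH]) (use B' in simp)
  have small: "(\<lambda>n. LBINT x. f (fst (D n x))) \<longlonglongrightarrow> 0" if f: "quad_bounded f" for f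
  proof -
    obtain L where L: "L \<ge> 0" "\<And>U :: real \<Rightarrow> real^4. bounded_L2 (8 * sqrt B') U \<Longrightarrow> \<bar>LBINT x. f (U x)\<bar> \<le> L * nsq U"
      by (rule quad_bounded_integral_le[OF f]) (rule that)
    have "norm (LBINT x. f (fst (D n x))) \<le> L * nsq (D n)" for n
      using L(2)[OF fD[of n]] mult_left_mono[OF ip_fst_le[OF Dsq[of n]] L(1)] by simp
    moreover have "(\<lambda>n. L * nsq (D n)) \<longlonglongrightarrow> 0" by (rule tendsto_mult_right_zero[OF iplim])
    ultimately show ?thesis by (intro Lim_null_comparison[where f = "\<lambda>n. LBINT x. f (fst (D n x))"] always_eventually) auto
  qed
  have Nlim: "(\<lambda>n. N (D n)) \<longlonglongrightarrow> 0" and Klim: "(\<lambda>n. K (D n)) \<longlonglongrightarrow> 0"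
    unfolding N_def K_def by (intro small quad_bounded_G quad_bounded_F)+
  \<comment> \<open>Strong convergence comes first; only now does the splitting of P upgrade P Z <=
    0 to equality, and that of Q give Q Z = S.\<close>
  have "(\<lambda>n. P (D n)) \<longlonglongrightarrow> 0 - 0" unfolding P_def by (intro tendsto_diff Ilim Nlim)
  from LIMSEQ_unique[OF Plim this] have P_Z: "P Z = 0" by simp
  have "(\<lambda>n. Q (D n)) \<longlonglongrightarrow> \<theta> * 0 + (0 / (p + 2) - 0)"
    unfolding Q_expand using p_pos by (intro tendsto_intros Ilim Nlim Klim) auto
  from LIMSEQ_unique[OF Qlim this] have "S - Q Z = 0" by simp
  then have "J Z = S" using P_Z by (simp add: Q_def)
  moreover have "Z \<in> nehari" using ZH ne P_Z by (simp add: nehari_def)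
  ultimately show ?thesis
    using that[of r Z "\<lambda>n. y (r n)"] r iplim by (simp add: D_def[abs_def] Y_def)
qed

end

section \<open>Minimizers are critical points\<close>

context variational
begin

definition dJ :: "(real \<Rightarrow> state) \<Rightarrow> (real \<Rightarrow> state) \<Rightarrow> real" where
  "dJ Z Y = ip (\<lambda>x. T (Z x)) Y - (LBINT x. gradF (fst (Z x)) \<bullet> fst (Y x))"

definition dP :: "(real \<Rightarrow> state) \<Rightarrow> (real \<Rightarrow> state) \<Rightarrow> real" where
  "dP Z Y = 2 * ip (\<lambda>x. T (Z x)) Y - (LBINT x. DG (fst (Z x)) (fst (Y x)))"

lemma functional_derivs:
  assumes Z: "Z \<in> H2_states" and Y: "Y \<in> H2_states"
  shows "((\<lambda>t. J (\<lambda>x. Z x + t *\<^sub>R Y x)) has_real_derivative dJ Z Y) (at 0)"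
    "((\<lambda>t. P (\<lambda>x. Z x + t *\<^sub>R Y x)) has_real_derivative dP Z Y) (at 0)"
    "integrable lborel (\<lambda>x. gradF (fst (Z x)) \<bullet> fst (Y x))"
    "integrable lborel (\<lambda>x. DG (fst (Z x)) (fst (Y x)))"
proof -
  define M where "M = 8 * sqrt (nsq Z) + 8 * sqrt (nsq Y)"
  have MZ: "bounded_L2 M (\<lambda>x. fst (Z x))" by (rule bounded_L2_jet[OF Z]) (simp add: M_def ip_self_nonneg)
  have MY: "bounded_L2 M (\<lambda>x. fst (Y x))" by (rule bounded_L2_jet[OF Y]) (simp add: M_def ip_self_nonneg)
  note dK = quad_bounded_gateaux[OF quad_bounded_F MZ MY F_deriv]
  note dN = quad_bounded_gateaux[OF quad_bounded_G MZ MY G_deriv]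
  have sq: "square_int Z" "square_int Y" using Z Y by (auto intro: H2_states_square_int)
  have dI: "((\<lambda>t. I (\<lambda>x. Z x + t *\<^sub>R Y x)) has_real_derivative 2 * ip (\<lambda>x. T (Z x)) Y) (at 0)"
    unfolding I_add[OF sq] by (auto intro!: derivative_eq_intros)
  show "integrable lborel (\<lambda>x. gradF (fst (Z x)) \<bullet> fst (Y x))" "integrable lborel (\<lambda>x. DG (fst (Z x)) (fst (Y x)))"
    by (rule dK(2) dN(2))+
  have dK': "((\<lambda>t. K (\<lambda>x. Z x + t *\<^sub>R Y x)) has_real_derivative (LBINT x. gradF (fst (Z x)) \<bullet> fst (Y x))) (at 0)"
    using dK(1) by (simp add: K_def)
  have dN': "((\<lambda>t. N (\<lambda>x. Z x + t *\<^sub>R Y x)) has_real_derivative (LBINT x. DG (fst (Z x)) (fst (Y x)))) (at 0)"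
    using dN(1) by (simp add: N_def)
  show "((\<lambda>t. J (\<lambda>x. Z x + t *\<^sub>R Y x)) has_real_derivative dJ Z Y) (at 0)"
    unfolding J_def dJ_def using DERIV_diff[OF DERIV_cdivide[OF dI, of 2] dK'] by simp
  show "((\<lambda>t. P (\<lambda>x. Z x + t *\<^sub>R Y x)) has_real_derivative dP Z Y) (at 0)"
    unfolding P_def dP_def by (rule DERIV_diff[OF dI dN'])
qed

lemma dJ_dP_lincomb:
  assumes Z: "Z \<in> H2_states" and Y: "Y \<in> H2_states" "Y' \<in> H2_states"
  shows "dJ Z (\<lambda>x. a *\<^sub>R Y x + b *\<^sub>R Y' x) = a * dJ Z Y + b * dJ Z Y'"
    "dP Z (\<lambda>x. a *\<^sub>R Y x + b *\<^sub>R Y' x) = a * dP Z Y + b * dP Z Y'"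
proof -
  have sq: "square_int Z" "square_int Y" "square_int Y'" using Z Y by (auto intro: H2_states_square_int)
  have i: "ip (\<lambda>x. T (Z x)) (\<lambda>x. a *\<^sub>R Y x + b *\<^sub>R Y' x) = a * ip (\<lambda>x. T (Z x)) Y + b * ip (\<lambda>x. T (Z x)) Y'"
    by (simp add: ip_add_right[OF T_square_int[OF sq(1)] square_int_scaleR[OF sq(2)] square_int_scaleR[OF sq(3)]] ip_scaleR_right)
  have g: "(LBINT x. gradF (fst (Z x)) \<bullet> fst (a *\<^sub>R Y x + b *\<^sub>R Y' x)) =
      a * (LBINT x. gradF (fst (Z x)) \<bullet> fst (Y x)) + b * (LBINT x. gradF (fst (Z x)) \<bullet> fst (Y' x))"
    using functional_derivs(3)[OF Z Y(1)] functional_derivs(3)[OF Z Y(2)] by (simp add: inner_add_right)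
  have lin: "DG w (a *\<^sub>R u + b *\<^sub>R v) = a * DG w u + b * DG w v" for w u v
    by (simp add: DG_def matrix_vector_right_distrib matrix_vector_mult_scaleR inner_add_left inner_add_right algebra_simps)
  have h: "(LBINT x. DG (fst (Z x)) (fst (a *\<^sub>R Y x + b *\<^sub>R Y' x))) =
      a * (LBINT x. DG (fst (Z x)) (fst (Y x))) + b * (LBINT x. DG (fst (Z x)) (fst (Y' x)))"
    using functional_derivs(4)[OF Z Y(1)] functional_derivs(4)[OF Z Y(2)] by (simp add: lin)
  show "dJ Z (\<lambda>x. a *\<^sub>R Y x + b *\<^sub>R Y' x) = a * dJ Z Y + b * dJ Z Y'"
    unfolding dJ_def i g by (simp add: algebra_simps)
  show "dP Z (\<lambda>x. a *\<^sub>R Y x + b *\<^sub>R Y' x) = a * dP Z Y + b * dP Z Y'"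
    unfolding dP_def i h by (simp add: algebra_simps)
qed

lemma dJ_self: "dJ Z Z = P Z"
  by (simp add: dJ_def P_def I_def N_def Gf_def inner_commute)

text \<open>Condition (a) bounds dP Z Z by 2 I - (p + 2) N, which is - p I when I = N. So Z itself
  is transversal to the constraint.\<close>

lemma dP_self_neg:
  assumes "Z \<in> nehari"
  shows "dP Z Z < 0"
proof -
  have H: "Z \<in> H2_states" and ne: "nsq Z \<noteq> 0" and P0: "P Z = 0" using assms by (auto simp: nehari_def)
  have "(p + 2) * N Z = (LBINT x. (p + 2) * Gf gradF (fst (Z x)))" by (simp add: N_def)
  also have "\<dots> \<le> (LBINT x. DG (fst (Z x)) (fst (Z x)))"
  proof (rule integral_mono)
    show "integrable lborel (\<lambda>x. (p + 2) * Gf gradF (fst (Z x)))"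
      by (intro integrable_mult_right quad_bounded_integral[OF quad_bounded_G jet_L2[OF H]])
    show "integrable lborel (\<lambda>x. DG (fst (Z x)) (fst (Z x)))" by (rule functional_derivs(4)[OF H H])
    show "(p + 2) * Gf gradF (fst (Z x)) \<le> DG (fst (Z x)) (fst (Z x))" for x
      using superquad'[of "fst (Z x)"] by (simp add: DG_def Gf_def algebra_simps)
  qed
  finally have "dP Z Z \<le> 2 * I Z - (p + 2) * N Z" by (simp add: dP_def I_def)
  also have "\<dots> = - p * I Z" using P0 by (simp add: P_def algebra_simps)
  also have "\<dots> < 0"
  proof -
    have "0 < \<kappa> * nsq Z" using ne ip_self_nonneg[of Z] \<kappa>_pos by simp
    also have "\<dots> \<le> I Z" by (rule I_coercive[OF H2_states_square_int[OF H]])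
    finally show ?thesis using p_pos by simp
  qed
  finally show ?thesis .
qed

text \<open>A direction \<open>W\<close> with \<open>dJ Z W < 0\<close> can be corrected by a multiple of \<open>Z\<close>, which does not
  change \<open>dJ\<close>, so that \<open>P\<close> also decreases slightly; then \<open>Q\<close> falls below its minimum on \<open>{P \<le> 0}\<close>.\<close>
theorem nehari_minimizer_critical:
  assumes Z: "Z \<in> nehari" and min: "J Z = S" and Y: "Y \<in> H2_states"
  shows "dJ Z Y = 0"
proof (rule ccontr)
  assume ne0: "dJ Z Y \<noteq> 0"
  have H: "Z \<in> H2_states" and P0: "P Z = 0" using Z by (auto simp: nehari_def)
  define m where "m = \<bar>dJ Z Y\<bar>"
  have m: "m > 0" using ne0 by (simp add: m_def)
  define s where "s = - sgn (dJ Z Y)"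
  have s: "s * dJ Z Y = - m" by (simp add: s_def m_def abs_sgn mult.commute)
  \<comment> \<open>\<open>\<sigma>\<close> solves dP Z W = - m, while dJ Z W = - m for every choice
    of \<open>\<sigma>\<close> because dJ Z Z = P Z = 0.\<close>
  define \<sigma> where "\<sigma> = (- m - s * dP Z Y) / dP Z Z"
  define W where "W x = \<sigma> *\<^sub>R Z x + s *\<^sub>R Y x" for x
  have WH: "W \<in> H2_states" unfolding W_def[abs_def] by (rule H2_states_lincomb[OF H Y])
  have dJW: "dJ Z W = - m"
    unfolding W_def[abs_def] dJ_dP_lincomb(1)[OF H H Y] using s by (simp add: dJ_self P0)
  have dPW: "dP Z W = - m"
    unfolding W_def[abs_def] dJ_dP_lincomb(2)[OF H H Y] using dP_self_neg[OF Z] by (simp add: \<sigma>_def)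
  note D = functional_derivs(1,2)[OF H WH]
  have "((\<lambda>t. Q (\<lambda>x. Z x + t *\<^sub>R W x)) has_real_derivative dJ Z W - dP Z W / (p + 2)) (at 0)"
    unfolding Q_def by (rule DERIV_diff[OF D(1) DERIV_cdivide[OF D(2)]])
  moreover have "dJ Z W - dP Z W / (p + 2) < 0"
  proof -
    \<comment> \<open>The derivative of Q along W is - m + m / (p + 2), negative because p + 2 >
      1.\<close>
    have "m / (p + 2) < m / 1" by (rule divide_strict_left_mono) (use m p_pos in auto)
    then show ?thesis unfolding dJW dPW by simp
  qed
  ultimately obtain d1 where d1: "d1 > 0"
    "\<And>t. t > 0 \<Longrightarrow> t < d1 \<Longrightarrow> Q (\<lambda>x. Z x + (0 + t) *\<^sub>R W x) < Q (\<lambda>x. Z x + 0 *\<^sub>R W x)"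
    using DERIV_neg_dec_right by blast
  have "dP Z W < 0" using dPW m by simp
  then obtain d2 where d2: "d2 > 0"
    "\<And>t. t > 0 \<Longrightarrow> t < d2 \<Longrightarrow> P (\<lambda>x. Z x + (0 + t) *\<^sub>R W x) < P (\<lambda>x. Z x + 0 *\<^sub>R W x)"
    using DERIV_neg_dec_right[OF D(2)] by blast
  define t where "t = min d1 d2 / 2"
  have t: "0 < t" "t < d1" "t < d2" using d1(1) d2(1) by (auto simp: t_def)
  define X where "X x = Z x + t *\<^sub>R W x" for x
  have XH: "X \<in> H2_states" using H2_states_lincomb[OF H WH, of 1 t] by (simp add: X_def[abs_def])
  have PX: "P X < 0" using d2(2)[OF t(1,3)] P0 by (simp add: X_def[abs_def])
  have "nsq X \<noteq> 0" using P_eq_0_of_zero[OF XH] PX by auto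
  then have "S \<le> Q X" using S_le_Q[OF XH] PX by simp
  moreover have "Q X < Q Z" using d1(2)[OF t(1,2)] by (simp add: X_def[abs_def])
  moreover have "Q Z = S" using Q_nehari[OF Z] min by simp
  ultimately show False by simp
qed

end

section \<open>The travelling-wave functional\<close>

text \<open>2 |x y| <= x^2 + y^2 charges the cross term to the diagonal, at the price of
  |\<open>\<gamma>\<close>| on each side.\<close>

lemma weighted_square_bound:
  fixes x y \<alpha> \<beta> \<gamma> \<kappa> :: real
  assumes "\<kappa> \<le> \<alpha> - \<bar>\<gamma>\<bar>" "\<kappa> \<le> \<beta> - \<bar>\<gamma>\<bar>"
  shows "\<kappa> * (x * x + y * y) \<le> \<alpha> * (x * x) + \<beta> * (y * y) - 2 * \<gamma> * (x * y)"
proof -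
  have "\<bar>2 * \<gamma> * (x * y)\<bar> = \<bar>\<gamma>\<bar> * (2 * \<bar>x\<bar> * \<bar>y\<bar>)" by (simp add: abs_mult)
  also have "\<dots> \<le> \<bar>\<gamma>\<bar> * (x * x + y * y)"
    using sum_squares_bound[of "\<bar>x\<bar>" "\<bar>y\<bar>"] by (intro mult_left_mono) (auto simp: power2_eq_square)
  finally have "2 * \<gamma> * (x * y) \<le> \<bar>\<gamma>\<bar> * (x * x) + \<bar>\<gamma>\<bar> * (y * y)" by (simp add: distrib_left)
  moreover have "\<kappa> * (x * x) \<le> (\<alpha> - \<bar>\<gamma>\<bar>) * (x * x)" "\<kappa> * (y * y) \<le> (\<beta> - \<bar>\<gamma>\<bar>) * (y * y)"
    using assms by (auto intro: mult_right_mono)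
  ultimately show ?thesis by (simp add: algebra_simps)
qed

lemma inner_state:
  fixes z z' :: state
  shows "z \<bullet> z' = fst z $ 1 * fst z' $ 1 + fst z $ 2 * fst z' $ 2 + fst z $ 3 * fst z' $ 3 + fst z $ 4 * fst z' $ 4
    + fst (snd z) * fst (snd z') + snd (snd z) * snd (snd z')"
  by (simp add: inner_prod_def inner_vec_def sum_4)

lemma components_square_int:
  assumes "Z \<in> H2_states"
  shows "square_int (\<lambda>x. fst (Z x) $ i)" "square_int (\<lambda>x. fst (snd (Z x)))" "square_int (\<lambda>x. snd (snd (Z x)))"
  unfolding state_nth_inner by (intro square_int_inner_const H2_states_square_int assms)+

text \<open>\<open>nonzeroX\<close> inspects psi and v only, while \<open>nsq\<close> of a state
  sees all six components; this reconciles the two notions of zero.\<close>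

lemma H2_triple_zero_AE:
  assumes "H2 f" "AE x in lborel. f x = 0"
  shows "AE x in lborel. wd f x = 0" "AE x in lborel. wd2 f x = 0"
proof -
  have t: "H2_triple f (wd f) (wd2 f)" using assms(1) by (simp add: H2_iff_triple)
  then have sq: "square_int f" by (simp add: H2_triple_def)
  have z: "H2_triple (\<lambda>x. 0) (\<lambda>x. 0) (\<lambda>x. 0)" using H2_triple_lincomb[OF t t, of 0 0] by simp
  have "weak_deriv f (\<lambda>x. 0)"
    by (rule weak_deriv_cong_AE[of "\<lambda>x. 0" "\<lambda>x. 0"])
      (use z assms(2) square_int_measurable[OF sq] in \<open>auto simp: H2_triple_def\<close>)
  with z sq have "H2_triple f (\<lambda>x. 0) (\<lambda>x. 0)" by (simp add: H2_triple_def)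
  from H2_triple_wd(2,3)[OF this] show "AE x in lborel. wd f x = 0" "AE x in lborel. wd2 f x = 0" .
qed

lemma nonzeroX_state:
  assumes "H2 \<psi>" "H2 v"
  shows "nonzeroX \<psi> v \<longleftrightarrow> nsq (state \<psi> v) \<noteq> 0"
proof -
  have "(AE x in lborel. \<psi> x = 0 \<and> v x = 0) \<longleftrightarrow> (AE x in lborel. state \<psi> v x = 0)"
  proof
    assume "AE x in lborel. \<psi> x = 0 \<and> v x = 0"
    then have z: "AE x in lborel. \<psi> x = 0" "AE x in lborel. v x = 0" by (auto elim: eventually_mono)
    show "AE x in lborel. state \<psi> v x = 0"
      using z H2_triple_zero_AE[OF assms(1) z(1)] H2_triple_zero_AE[OF assms(2) z(2)]
    proof eventually_elim
      case (elim x)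
      show ?case by (rule state_eqI) (use elim in \<open>simp_all add: state_def jet_nth\<close>)
    qed
  next
    assume "AE x in lborel. state \<psi> v x = 0"
    then show "AE x in lborel. \<psi> x = 0 \<and> v x = 0"
    proof eventually_elim
      case (elim x)
      then have "jet \<psi> v x = 0" by (simp add: state_def prod_eq_iff)
      then show ?case using jet_nth(1,3)[of \<psi> v x] by simp
    qed
  qed
  then show ?thesis
    unfolding nonzeroX_def ip_self_eq_0_iff[OF H2_states_square_int[OF state_in_H2_states[OF assms]]] by simp
qed

lemma H2_norm_nonneg: "0 \<le> H2_norm f"
  unfolding H2_norm_def by (intro real_sqrt_ge_zero integral_nonneg_AE) simp

locale travelling_wave = nonlinearity +
  fixes a c a2 c2 b b2 \<omega> :: real
  assumes coeffs_pos: "b > 0" "b2 > 0"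
    and speed: "\<bar>\<omega>\<bar> < min 1 (min (-a / b) (min (-c / b) (min (a2 / b2) (c2 / b2))))"
begin

text \<open>The symmetric matrix of \<open>Iw\<close>. It decouples into three 2x2 blocks, on (psi,
  v), (psi', v') and (psi'', v'').\<close>

definition form :: "state \<Rightarrow> state" where
  "form z = (vector [fst z $ 1 - \<omega> * fst z $ 3, - c * fst z $ 2 - \<omega> * b * fst z $ 4,
      fst z $ 3 - \<omega> * fst z $ 1, - a * fst z $ 4 - \<omega> * b * fst z $ 2],
    c2 * fst (snd z) - \<omega> * b2 * snd (snd z), a2 * snd (snd z) - \<omega> * b2 * fst (snd z))"

lemma form_nth:
  "fst (form z) $ 1 = fst z $ 1 - \<omega> * fst z $ 3" "fst (form z) $ 2 = - c * fst z $ 2 - \<omega> * b * fst z $ 4"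
  "fst (form z) $ 3 = fst z $ 3 - \<omega> * fst z $ 1" "fst (form z) $ 4 = - a * fst z $ 4 - \<omega> * b * fst z $ 2"
  "fst (snd (form z)) = c2 * fst (snd z) - \<omega> * b2 * snd (snd z)"
  "snd (snd (form z)) = a2 * snd (snd z) - \<omega> * b2 * fst (snd z)"
  unfolding form_def vector_def by simp_all

text \<open>The least diagonal entry of the three blocks after the off-diagonal entry of its block
  is subtracted in absolute value; the speed restriction says that each of these margins is
  positive.\<close>

definition coercivity :: real where
  "coercivity = min (1 - \<bar>\<omega>\<bar>) (min (min (- c - \<bar>\<omega>\<bar> * b) (- a - \<bar>\<omega>\<bar> * b)) (min (c2 - \<bar>\<omega>\<bar> * b2) (a2 - \<bar>\<omega>\<bar> * b2)))"

lemma coercivity_pos: "coercivity > 0"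
proof -
  have "\<bar>\<omega>\<bar> < 1" "\<bar>\<omega>\<bar> < - a / b" "\<bar>\<omega>\<bar> < - c / b" "\<bar>\<omega>\<bar> < a2 / b2" "\<bar>\<omega>\<bar> < c2 / b2"
    using speed unfolding min_less_iff_conj by blast+
  then show ?thesis
    unfolding pos_less_divide_eq[OF coeffs_pos(1)] pos_less_divide_eq[OF coeffs_pos(2)]
    by (simp add: coercivity_def)
qed

sublocale variational F gradF HessF p form coercivity
proof (rule variational.intro[OF nonlinearity_axioms variational_axioms.intro])
  have "linear form"
    by (rule linearI; rule state_eqI) (simp_all add: form_nth algebra_simps)
  then show "bounded_linear form" by (simp add: linear_conv_bounded_linear)
  show "form z \<bullet> z' = z \<bullet> form z'" for z z'
    unfolding inner_state form_nth by (simp add: algebra_simps)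
  show "coercivity > 0" by (rule coercivity_pos)
  show "coercivity * (z \<bullet> z) \<le> form z \<bullet> z" for z
  proof -
    have k: "coercivity \<le> 1 - \<bar>\<omega>\<bar>" "coercivity \<le> - c - \<bar>\<omega> * b\<bar>" "coercivity \<le> - a - \<bar>\<omega> * b\<bar>"
      "coercivity \<le> c2 - \<bar>\<omega> * b2\<bar>" "coercivity \<le> a2 - \<bar>\<omega> * b2\<bar>"
      using coeffs_pos by (auto simp: coercivity_def abs_mult min_le_iff_disj)
    show ?thesis
      using weighted_square_bound[OF k(1,1), of "fst z $ 1" "fst z $ 3"]
        weighted_square_bound[OF k(2,3), of "fst z $ 2" "fst z $ 4"]
        weighted_square_bound[OF k(4,5), of "fst (snd z)" "snd (snd z)"]
      unfolding inner_state form_nth by (simp add: algebra_simps)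
  qed
qed

lemma Iw_state:
  assumes "H2 \<psi>" "H2 v"
  shows "Iw a c a2 c2 b b2 \<omega> \<psi> v = I (state \<psi> v)"
proof -
  have H: "state \<psi> v \<in> H2_states" by (rule state_in_H2_states[OF assms])
  note i = integrable_inner_square_int[OF components_square_int(1)[OF H] components_square_int(1)[OF H]]
    integrable_inner_square_int[OF components_square_int(2)[OF H] components_square_int(2)[OF H]]
    integrable_inner_square_int[OF components_square_int(3)[OF H] components_square_int(3)[OF H]]
    integrable_inner_square_int[OF components_square_int(2)[OF H] components_square_int(3)[OF H]]
  have int: "integrable lborel (\<lambda>x. \<psi> x * \<psi> x)" "integrable lborel (\<lambda>x. wd \<psi> x * wd \<psi> x)"
    "integrable lborel (\<lambda>x. wd2 \<psi> x * wd2 \<psi> x)" "integrable lborel (\<lambda>x. v x * v x)"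
    "integrable lborel (\<lambda>x. wd v x * wd v x)" "integrable lborel (\<lambda>x. wd2 v x * wd2 v x)"
    "integrable lborel (\<lambda>x. \<psi> x * v x)" "integrable lborel (\<lambda>x. wd \<psi> x * wd v x)"
    "integrable lborel (\<lambda>x. wd2 \<psi> x * wd2 v x)"
    using i(1)[of 1 1] i(1)[of 2 2] i(2) i(1)[of 3 3] i(1)[of 4 4] i(3) i(1)[of 1 3] i(1)[of 2 4] i(4)
    by (simp_all add: state_def jet_nth)
  have i1: "integrable lborel (\<lambda>x. (\<psi> x)\<^sup>2 - c * (wd \<psi> x)\<^sup>2 + c2 * (wd2 \<psi> x)\<^sup>2
      + (v x)\<^sup>2 - a * (wd v x)\<^sup>2 + a2 * (wd2 v x)\<^sup>2)"
    unfolding power2_eq_square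
    by (intro Bochner_Integration.integrable_add Bochner_Integration.integrable_diff integrable_mult_right int)
  have i2: "integrable lborel (\<lambda>x. \<psi> x * v x + b * wd \<psi> x * wd v x + b2 * wd2 \<psi> x * wd2 v x)"
    unfolding mult.assoc by (intro Bochner_Integration.integrable_add integrable_mult_right int)
  have "Iw a c a2 c2 b b2 \<omega> \<psi> v = (LBINT x. ((\<psi> x)\<^sup>2 - c * (wd \<psi> x)\<^sup>2 + c2 * (wd2 \<psi> x)\<^sup>2
      + (v x)\<^sup>2 - a * (wd v x)\<^sup>2 + a2 * (wd2 v x)\<^sup>2)
      - 2 * \<omega> * (\<psi> x * v x + b * wd \<psi> x * wd v x + b2 * wd2 \<psi> x * wd2 v x))"
    unfolding Iw_def I1_def I2_def
    by (subst Bochner_Integration.integral_diff[OF i1 integrable_mult_right[OF i2]]) (simp only: integral_mult_right_zero)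
  also have "\<dots> = I (state \<psi> v)"
    unfolding I_def ip_def inner_state form_nth
    by (intro Bochner_Integration.integral_cong refl) (simp add: state_def jet_nth power2_eq_square algebra_simps)
  finally show ?thesis .
qed

lemma functionals_state:
  assumes "H2 \<psi>" "H2 v"
  shows "Jw a c a2 c2 b b2 \<omega> F \<psi> v = J (state \<psi> v)" "Pw a c a2 c2 b b2 \<omega> gradF \<psi> v = P (state \<psi> v)"
  using Iw_state[OF assms] by (simp_all add: Jw_def Pw_def J_def P_def Kf_def K_def Nf_def N_def state_def)

lemma functionals_H2_states:
  assumes "Z \<in> H2_states"
  shows "Jw a c a2 c2 b b2 \<omega> F (\<lambda>x. fst (Z x) $ 1) (\<lambda>x. fst (Z x) $ 3) = J Z"
    "Pw a c a2 c2 b b2 \<omega> gradF (\<lambda>x. fst (Z x) $ 1) (\<lambda>x. fst (Z x) $ 3) = P Z"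
proof -
  note r = H2_states_representative[OF assms]
  note e = functional_cong_AE[OF r(3) H2_states_square_int[OF state_in_H2_states[OF r(1,2)]] H2_states_square_int[OF assms]]
  show "Jw a c a2 c2 b b2 \<omega> F (\<lambda>x. fst (Z x) $ 1) (\<lambda>x. fst (Z x) $ 3) = J Z"
    "Pw a c a2 c2 b b2 \<omega> gradF (\<lambda>x. fst (Z x) $ 1) (\<lambda>x. fst (Z x) $ 3) = P Z"
    using e functionals_state[OF r(1,2)] by (simp_all add: J_def P_def)
qed

lemma Mw0_state: "(\<psi>, v) \<in> Mw0 a c a2 c2 b b2 \<omega> gradF \<longleftrightarrow> H2 \<psi> \<and> H2 v \<and> state \<psi> v \<in> nehari"
  using nonzeroX_state functionals_state(2) state_in_H2_states by (auto simp: Mw0_def nehari_def)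

lemma Mw0_components:
  assumes "Z \<in> nehari"
  shows "(\<lambda>x. fst (Z x) $ 1, \<lambda>x. fst (Z x) $ 3) \<in> Mw0 a c a2 c2 b b2 \<omega> gradF"
proof -
  have Z: "Z \<in> H2_states" "nsq Z \<noteq> 0" "P Z = 0" using assms by (auto simp: nehari_def)
  note r = H2_states_representative[OF Z(1)]
  have s: "state (\<lambda>x. fst (Z x) $ 1) (\<lambda>x. fst (Z x) $ 3) \<in> H2_states" by (rule state_in_H2_states[OF r(1,2)])
  note e = functional_cong_AE[OF r(3) H2_states_square_int[OF s] H2_states_square_int[OF Z(1)]]
  show ?thesis
    unfolding Mw0_state using r(1,2) s e Z by (simp add: nehari_def P_def)
qed

text \<open>\<open>nehari\<close> also contains states whose recorded derivatives differ from the
  chosen ones on null sets, so equality of the two infima needs both inclusions of the sets of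
  values.\<close>

lemma Sw_eq: "Sw a c a2 c2 b b2 \<omega> F gradF = S"
proof -
  have "(\<lambda>(\<psi>, v). Jw a c a2 c2 b b2 \<omega> F \<psi> v) ` Mw0 a c a2 c2 b b2 \<omega> gradF = J ` nehari"
  proof (intro equalityI subsetI)
    fix j assume "j \<in> (\<lambda>(\<psi>, v). Jw a c a2 c2 b b2 \<omega> F \<psi> v) ` Mw0 a c a2 c2 b b2 \<omega> gradF"
    then obtain \<psi> v where "(\<psi>, v) \<in> Mw0 a c a2 c2 b b2 \<omega> gradF" "j = Jw a c a2 c2 b b2 \<omega> F \<psi> v" by auto
    then show "j \<in> J ` nehari" by (auto simp: Mw0_state functionals_state(1))
  next
    fix j assume "j \<in> J ` nehari"
    then obtain Z where Z: "Z \<in> nehari" "j = J Z" by auto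
    then have "j = Jw a c a2 c2 b b2 \<omega> F (\<lambda>x. fst (Z x) $ 1) (\<lambda>x. fst (Z x) $ 3)"
      using functionals_H2_states(1)[of Z] by (simp add: nehari_def)
    with Mw0_components[OF Z(1)] show "j \<in> (\<lambda>(\<psi>, v). Jw a c a2 c2 b b2 \<omega> F \<psi> v) ` Mw0 a c a2 c2 b b2 \<omega> gradF"
      by (force intro: rev_image_eqI)
  qed
  then show ?thesis by (simp add: Sw_def S_def)
qed

text \<open>The squared norm of one function collects three of the six squares in
  \<open>nsq\<close>, so convergence of states controls both H^2 norms.\<close>

lemma H2_norm_le:
  assumes "Z \<in> H2_states"
  shows "H2_norm (\<lambda>x. fst (Z x) $ 1) \<le> sqrt (nsq Z)" "H2_norm (\<lambda>x. fst (Z x) $ 3) \<le> sqrt (nsq Z)"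
proof -
  let ?\<psi> = "\<lambda>x. fst (Z x) $ 1" and ?v = "\<lambda>x. fst (Z x) $ 3"
  note r = H2_states_representative[OF assms]
  let ?X = "state ?\<psi> ?v"
  have X: "?X \<in> H2_states" by (rule state_in_H2_states[OF r(1,2)])
  have eq: "nsq ?X = nsq Z"
    by (rule functional_cong_AE(4)[OF r(3) H2_states_square_int[OF X] H2_states_square_int[OF assms]])
  note i = integrable_inner_square_int[OF components_square_int(1)[OF X] components_square_int(1)[OF X]]
    integrable_inner_square_int[OF components_square_int(2)[OF X] components_square_int(2)[OF X]]
    integrable_inner_square_int[OF components_square_int(3)[OF X] components_square_int(3)[OF X]]
  have iX: "integrable lborel (\<lambda>x. ?X x \<bullet> ?X x)"
    by (intro integrable_inner_square_int H2_states_square_int X)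
  have le: "sqrt (LBINT x. f x) \<le> sqrt (nsq Z)"
    if "integrable lborel f" "\<And>x. f x \<le> ?X x \<bullet> ?X x" for f
    unfolding eq[symmetric] unfolding ip_def by (intro real_sqrt_le_mono integral_mono that iX)
  show "H2_norm ?\<psi> \<le> sqrt (nsq Z)"
    unfolding H2_norm_def
    by (rule le, use i(1)[of 1 1] i(1)[of 2 2] i(2) in \<open>simp add: state_def jet_nth power2_eq_square\<close>)
      (unfold inner_state, simp add: state_def jet_nth power2_eq_square)
  show "H2_norm ?v \<le> sqrt (nsq Z)"
    unfolding H2_norm_def
    by (rule le, use i(1)[of 3 3] i(1)[of 4 4] i(3) in \<open>simp add: state_def jet_nth power2_eq_square\<close>)
      (unfold inner_state, simp add: state_def jet_nth power2_eq_square)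
qed

end

theorem theorem1p1:
  fixes a c a2 c2 b b2 \<omega> p q1 q2 Cb :: real
    and F :: "real^4 \<Rightarrow> real"
    and gradF :: "real^4 \<Rightarrow> real^4"
    and HessF :: "real^4 \<Rightarrow> real^4^4"
    and \<psi>s vs :: "nat \<Rightarrow> real \<Rightarrow> real"
  assumes coeffs: "a < 0" "c < 0" "a2 > 0" "c2 > 0" "b > 0" "b2 > 0"
    and omega: "0 < \<bar>\<omega>\<bar>"
      "\<bar>\<omega>\<bar> < min 1 (min (-a / b) (min (-c / b) (min (a2 / b2) (c2 / b2))))"
    and F_C2: "\<And>w. (F has_derivative (\<lambda>h. gradF w \<bullet> h)) (at w)"
      "\<And>w. (gradF has_derivative (\<lambda>h. HessF w *v h)) (at w)"
      "continuous_on UNIV HessF"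
    and F0: "F 0 = 0"
    and cond_a: "p > 0" "\<And>w. frechet_derivative (Gf gradF) (at w) w \<ge> (p + 2) * Gf gradF w"
    and cond_b: "0 < q1" "q1 \<le> q2" "Cb > 0"
      "\<And>w. norm (HessF w) \<le> Cb * (norm w powr q1 + norm w powr q2)"
    and cond_c: "\<exists>u v. H2 u \<and> H2 v \<and> Kf F u v > 0"
    and minseq: "\<And>n. (\<psi>s n, vs n) \<in> Mw0 a c a2 c2 b b2 \<omega> gradF"
      "(\<lambda>n. Jw a c a2 c2 b b2 \<omega> F (\<psi>s n) (vs n)) \<longlonglongrightarrow> Sw a c a2 c2 b b2 \<omega> F gradF"
  shows "\<exists>r :: nat \<Rightarrow> nat. \<exists>y :: nat \<Rightarrow> real. \<exists>\<psi>0 v0.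
           strict_mono r \<and>
           (\<psi>0, v0) \<in> Mw0 a c a2 c2 b b2 \<omega> gradF \<and>
           (\<lambda>k. H2_norm (\<lambda>x. \<psi>s (r k) (x + y k) - \<psi>0 x)) \<longlonglongrightarrow> 0 \<and>
           (\<lambda>k. H2_norm (\<lambda>x. vs (r k) (x + y k) - v0 x)) \<longlonglongrightarrow> 0 \<and>
           Jw a c a2 c2 b b2 \<omega> F \<psi>0 v0 = Sw a c a2 c2 b b2 \<omega> F gradF \<and>
           (\<forall>h k. H2 h \<and> H2 k \<longrightarrow>
              ((\<lambda>t. Jw a c a2 c2 b b2 \<omega> F (\<lambda>x. \<psi>0 x + t * h x) (\<lambda>x. v0 x + t * k x))
                 has_real_derivative 0) (at 0))"
proof -
  \<comment> \<open>Both \<open>0 powr q1\<close> and \<open>0 powr q2\<close> are 0, so (b) at the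
    origin bounds the norm by 0.\<close>
  have Hess0: "HessF 0 = 0" using cond_b(4)[of 0] by simp
  interpret travelling_wave F gradF HessF p a c a2 c2 b b2 \<omega>
    by unfold_locales (use coeffs omega F_C2 F0 cond_a Hess0 in auto)
  define Zs where "Zs n = state (\<psi>s n) (vs n)" for n
  have H: "H2 (\<psi>s n)" "H2 (vs n)" and n: "Zs n \<in> nehari" for n
    using minseq(1)[of n] by (auto simp: Mw0_state Zs_def)
  have "(\<lambda>n. J (Zs n)) \<longlonglongrightarrow> S"
    using minseq(2) by (simp add: functionals_state(1)[OF H] Sw_eq Zs_def)
  from minimizing_sequence_compact[where Zs = Zs, OF n this]
  obtain r y Z where r: "strict_mono r" and Z: "Z \<in> nehari" and JZ: "J Z = S"
    and lim: "(\<lambda>n. nsq (\<lambda>x. Zs (r n) (x + y n) - Z x)) \<longlonglongrightarrow> 0" .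
  have ZH: "Z \<in> H2_states" using Z by (simp add: nehari_def)
  define \<psi>0 v0 where "\<psi>0 x = fst (Z x) $ 1" and "v0 x = fst (Z x) $ 3" for x
  define D where "D n x = Zs (r n) (x + y n) - Z x" for n x
  have DH: "D n \<in> H2_states" for n
    unfolding D_def[abs_def] Zs_def by (intro H2_states_diff H2_states_shift state_in_H2_states H ZH)
  \<comment> \<open>Both differences are components of the same state \<open>D k\<close>, hence
    controlled by the same null sequence.\<close>
  have D1: "(\<lambda>x. \<psi>s (r k) (x + y k) - \<psi>0 x) = (\<lambda>x. fst (D k x) $ 1)"
    and D3: "(\<lambda>x. vs (r k) (x + y k) - v0 x) = (\<lambda>x. fst (D k x) $ 3)" for k
    by (simp_all add: D_def Zs_def \<psi>0_def v0_def state_def jet_nth)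
  have lim': "(\<lambda>n. sqrt (nsq (D n))) \<longlonglongrightarrow> 0"
    using tendsto_real_sqrt[OF lim] by (simp add: D_def[abs_def])
  have "(\<lambda>k. H2_norm (\<lambda>x. \<psi>s (r k) (x + y k) - \<psi>0 x)) \<longlonglongrightarrow> 0"
    unfolding D1 by (rule real_tendsto_sandwich[OF _ _ tendsto_const lim'])
      (simp_all add: H2_norm_nonneg H2_norm_le[OF DH])
  moreover have "(\<lambda>k. H2_norm (\<lambda>x. vs (r k) (x + y k) - v0 x)) \<longlonglongrightarrow> 0"
    unfolding D3 by (rule real_tendsto_sandwich[OF _ _ tendsto_const lim'])
      (simp_all add: H2_norm_nonneg H2_norm_le[OF DH])
  moreover have "(\<psi>0, v0) \<in> Mw0 a c a2 c2 b b2 \<omega> gradF"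
    using Mw0_components[OF Z] by (simp add: \<psi>0_def[abs_def] v0_def[abs_def])
  moreover have "Jw a c a2 c2 b b2 \<omega> F \<psi>0 v0 = Sw a c a2 c2 b b2 \<omega> F gradF"
    using functionals_H2_states(1)[OF ZH] JZ by (simp add: \<psi>0_def[abs_def] v0_def[abs_def] Sw_eq)
  moreover have "((\<lambda>t. Jw a c a2 c2 b b2 \<omega> F (\<lambda>x. \<psi>0 x + t * h x) (\<lambda>x. v0 x + t * k x)) has_real_derivative 0) (at 0)"
    if hk: "H2 h \<and> H2 k" for h k
  proof -
    have Y: "state h k \<in> H2_states" using hk by (intro state_in_H2_states) auto
    \<comment> \<open>The perturbed pair consists of components 1 and 3 of a state on the line
      through Z, so its derivative at 0 is \<open>dJ Z (state h k)\<close>.\<close>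
    have "Jw a c a2 c2 b b2 \<omega> F (\<lambda>x. \<psi>0 x + t * h x) (\<lambda>x. v0 x + t * k x) = J (\<lambda>x. Z x + t *\<^sub>R state h k x)" for t
    proof -
      have "(\<lambda>x. Z x + t *\<^sub>R state h k x) \<in> H2_states" using H2_states_lincomb[OF ZH Y, of 1 t] by simp
      from functionals_H2_states(1)[OF this] show ?thesis
        by (simp add: \<psi>0_def v0_def state_def jet_nth)
    qed
    then show ?thesis
      using functional_derivs(1)[OF ZH Y] nehari_minimizer_critical[OF Z JZ Y] by simp
  qed
  ultimately show ?thesis using r by blast
qed

end
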